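(* Let $G$ be a chain graph of dimension $d$. Identifying $\mathcal{N}(G)$ with the nd parameter space for $\mathcal{N}(G)\subseteq\mathbb{R}^d$ via the bijection $p\mapsto$ (nd parameter values of $p$), the set of $p\in\mathcal{N}(G)$ that are not faithful to $G$ has Lebesgue measure zero in $\mathbb{R}^d$.
   Context: A chain graph (CG) over $V=\{1,\dots,N\}$ is a graph with (at most one) undirected or directed edge between any two nodes and no directed pseudocycle (a closed route following edges $v_i - v_{i+1}$ or $v_i\to v_{i+1}$ with at least one directed edge). A route is a sequence of nodes with consecutive nodes adjacent (nodes may repeat). A section of a route is a maximal subroute all of whose edges are undirected; a section $v_2-\dots-v_{l-1}$ is a collider section if $v_1\to v_2-\dots-v_{l-1}\leftarrow v_l$ is a subroute. A route is superactive with respect to $K$ if every collider section has some node in $K$ and every other section has no node in $K$. For disjoint $I,J,K\subseteq V$, $I\perp_G J\mid K$ (separation) holds if no route from a node of $I$ to a node of $J$ is superactive with respect to $K$. A distribution $p$ is faithful to $G$ if for all disjoint $I,J,K$: $X_I\perp X_J\mid X_K$ under $p$ iff $I\perp_G J\mid K$. Connectivity components $B_1,\dots,B_n$ are ordered so directed edges go from lower to higher index; $Pa(B_i)$ is the set of parents of nodes of $B_i$; the moral graph $H^m$ joins nodes adjacent in $H$ or sharing a child component. $\mathcal{N}(G)$ is the set of regular Gaussian distributions $p$ on $\mathbb{R}^N$ with $p(x)=\prod_i p(x_{B_i}\mid x_{Pa(B_i)})$ and each marginal $p(x_{B_i\cup Pa(B_i)})$ a product of non-negative functions over the complete sets of $(G_{B_i\cup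 Pa(B_i)})^m$. For $p\in\mathcal{N}(G)$ with mean $\mu$ and $\Omega^i$ the precision matrix of its marginal on $B_i\cup Pa(B_i)$, the nd parameters are: the entries of $\mu$; the diagonal entries of $\Omega^i_{B_i,B_i}$; the entry of $\Omega^i_{B_i,B_i}$ for each undirected edge within $B_i$; and $(\Omega^i_{B_i,Pa(B_i)})_{j,k}$ for each directed edge $k\to j$, $j\in B_i$ (other entries determined by symmetry or zero). The nd parameter space is the set of real nd parameter values making every completed $\Omega^i_{B_i,B_i}$ positive definite; $p\mapsto$ its nd parameters is a bijection onto it. The dimension is $d=2|V|+|G|$, $|G|$ the number of edges. *)

theory Defs
  imports "HOL-Analysis.Analysis" "HOL-Combinatorics.Permutations"
begin

text \<open>Chain graph on V = {1..N}: U is the set of undirected edges, stored symmetrically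
  (a - b is represented by (a,b) and (b,a)); D is the set of directed edges ((a,b) means a \<rightarrow> b).\<close>

definition verts :: "nat \<Rightarrow> nat set" where
  "verts N = {1..N}"

definition directed_pseudocycle :: "(nat \<times> nat) set \<Rightarrow> (nat \<times> nat) set \<Rightarrow> nat list \<Rightarrow> bool" where
  "directed_pseudocycle U D xs \<longleftrightarrow> length xs \<ge> 2 \<and> hd xs = last xs \<and>
     (\<forall>i. Suc i < length xs \<longrightarrow> (xs!i, xs!Suc i) \<in> U \<or> (xs!i, xs!Suc i) \<in> D) \<and>
     (\<exists>i. Suc i < length xs \<and> (xs!i, xs!Suc i) \<in> D)"

definition chain_graph :: "nat \<Rightarrow> (nat \<times> nat) set \<Rightarrow> (nat \<times> nat) set \<Rightarrow> bool" where
  "chain_graph N U D \<longleftrightarrow>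
     U \<subseteq> verts N \<times> verts N \<and> D \<subseteq> verts N \<times> verts N \<and> sym U \<and>
     (\<forall>v. (v, v) \<notin> U \<and> (v, v) \<notin> D) \<and>
     (\<forall>a b. (a, b) \<in> D \<longrightarrow> (b, a) \<notin> D \<and> (a, b) \<notin> U) \<and>
     \<not> (\<exists>xs. directed_pseudocycle U D xs)"

definition adj :: "(nat \<times> nat) set \<Rightarrow> (nat \<times> nat) set \<Rightarrow> nat \<Rightarrow> nat \<Rightarrow> bool" where
  "adj U D a b \<longleftrightarrow> (a, b) \<in> U \<or> (a, b) \<in> D \<or> (b, a) \<in> D"

definition is_route :: "(nat \<times> nat) set \<Rightarrow> (nat \<times> nat) set \<Rightarrow> nat list \<Rightarrow> bool" where
  "is_route U D xs \<longleftrightarrow> xs \<noteq> [] \<and> (\<forall>i. Suc i < length xs \<longrightarrow> adj U D (xs!i) (xs!Suc i))"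

definition is_section :: "(nat \<times> nat) set \<Rightarrow> nat list \<Rightarrow> nat \<Rightarrow> nat \<Rightarrow> bool" where
  "is_section U xs a b \<longleftrightarrow> a \<le> b \<and> b < length xs \<and>
     (\<forall>i. a \<le> i \<and> i < b \<longrightarrow> (xs!i, xs!Suc i) \<in> U) \<and>
     (a = 0 \<or> (xs!(a - 1), xs!a) \<notin> U) \<and>
     (Suc b = length xs \<or> (xs!b, xs!Suc b) \<notin> U)"

definition collider_section :: "(nat \<times> nat) set \<Rightarrow> nat list \<Rightarrow> nat \<Rightarrow> nat \<Rightarrow> bool" where
  "collider_section D xs a b \<longleftrightarrow> 0 < a \<and> Suc b < length xs \<and>
     (xs!(a - 1), xs!a) \<in> D \<and> (xs!Suc b, xs!b) \<in> D"

definition superactive :: "(nat \<times> nat) set \<Rightarrow> (nat \<times> nat) set \<Rightarrow> nat set \<Rightarrow> nat list \<Rightarrow> bool" where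
  "superactive U D K xs \<longleftrightarrow>
     (\<forall>a b. is_section U xs a b \<longrightarrow>
        (if collider_section D xs a b then (\<exists>i\<in>{a..b}. xs!i \<in> K) else (\<forall>i\<in>{a..b}. xs!i \<notin> K)))"

definition separated :: "(nat \<times> nat) set \<Rightarrow> (nat \<times> nat) set \<Rightarrow> nat set \<Rightarrow> nat set \<Rightarrow> nat set \<Rightarrow> bool" where
  "separated U D I J K \<longleftrightarrow>
     \<not> (\<exists>xs. is_route U D xs \<and> hd xs \<in> I \<and> last xs \<in> J \<and> superactive U D K xs)"

definition comps_on :: "(nat \<times> nat) set \<Rightarrow> nat set \<Rightarrow> nat set set" where
  "comps_on U A = {C. \<exists>v\<in>A. C = {w\<in>A. (v, w) \<in> (U \<inter> (A \<times> A))\<^sup>*}}"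

definition comp_of :: "nat \<Rightarrow> (nat \<times> nat) set \<Rightarrow> nat \<Rightarrow> nat set" where
  "comp_of N U v = {w \<in> verts N. (v, w) \<in> U\<^sup>*}"

definition parents :: "(nat \<times> nat) set \<Rightarrow> nat set \<Rightarrow> nat set" where
  "parents D B = {a. \<exists>b\<in>B. (a, b) \<in> D}"

definition moral_adj :: "(nat \<times> nat) set \<Rightarrow> (nat \<times> nat) set \<Rightarrow> nat set \<Rightarrow> nat \<Rightarrow> nat \<Rightarrow> bool" where
  "moral_adj U D A a b \<longleftrightarrow> a \<in> A \<and> b \<in> A \<and> a \<noteq> b \<and>
     (adj U D a b \<or> (\<exists>C\<in>comps_on U A. a \<in> parents D C \<and> b \<in> parents D C))"

definition moral_complete :: "(nat \<times> nat) set \<Rightarrow> (nat \<times> nat) set \<Rightarrow> nat set \<Rightarrow> nat set \<Rightarrow> bool" where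
  "moral_complete U D A S \<longleftrightarrow> S \<subseteq> A \<and> (\<forall>a\<in>S. \<forall>b\<in>S. a \<noteq> b \<longrightarrow> moral_adj U D A a b)"

definition det_on :: "nat set \<Rightarrow> (nat \<Rightarrow> nat \<Rightarrow> real) \<Rightarrow> real" where
  "det_on A M = (\<Sum>p | p permutes A. of_int (sign p) * (\<Prod>i\<in>A. M i (p i)))"

definition inv_on :: "nat set \<Rightarrow> (nat \<Rightarrow> nat \<Rightarrow> real) \<Rightarrow> (nat \<Rightarrow> nat \<Rightarrow> real)" where
  "inv_on A M = (THE W. (\<forall>i j. (i \<notin> A \<or> j \<notin> A) \<longrightarrow> W i j = 0) \<and>
      (\<forall>i\<in>A. \<forall>j\<in>A. (\<Sum>k\<in>A. M i k * W k j) = (if i = j then 1 else 0)))"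

definition regular_gaussian :: "nat \<Rightarrow> (nat \<Rightarrow> real) \<Rightarrow> (nat \<Rightarrow> nat \<Rightarrow> real) \<Rightarrow> bool" where
  "regular_gaussian N mu Sg \<longleftrightarrow>
     (\<forall>i\<in>verts N. \<forall>j\<in>verts N. Sg i j = Sg j i) \<and>
     (\<forall>x. (\<exists>i\<in>verts N. x i \<noteq> 0) \<longrightarrow> (\<Sum>i\<in>verts N. \<Sum>j\<in>verts N. x i * Sg i j * x j) > 0)"

text \<open>Density of the marginal on A of N(mu, Sg): the Gaussian density with mean mu_A and
  covariance Sigma_AA, evaluated at x_A (for A = {} it is the constant 1).\<close>
definition gdens :: "nat set \<Rightarrow> (nat \<Rightarrow> real) \<Rightarrow> (nat \<Rightarrow> nat \<Rightarrow> real) \<Rightarrow> (nat \<Rightarrow> real) \<Rightarrow> real" where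
  "gdens A mu Sg x =
     exp (- (1/2) * (\<Sum>i\<in>A. \<Sum>j\<in>A. (x i - mu i) * inv_on A Sg i j * (x j - mu j)))
       / sqrt ((2 * pi) ^ card A * det_on A Sg)"

definition cond_indep :: "(nat \<Rightarrow> real) \<Rightarrow> (nat \<Rightarrow> nat \<Rightarrow> real) \<Rightarrow> nat set \<Rightarrow> nat set \<Rightarrow> nat set \<Rightarrow> bool" where
  "cond_indep mu Sg I J K \<longleftrightarrow>
     (\<forall>x. gdens (I \<union> J \<union> K) mu Sg x * gdens K mu Sg x =
          gdens (I \<union> K) mu Sg x * gdens (J \<union> K) mu Sg x)"

definition faithful :: "nat \<Rightarrow> (nat \<times> nat) set \<Rightarrow> (nat \<times> nat) set \<Rightarrow> (nat \<Rightarrow> real) \<Rightarrow> (nat \<Rightarrow> nat \<Rightarrow> real) \<Rightarrow> bool" where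
  "faithful N U D mu Sg \<longleftrightarrow>
     (\<forall>I J K. I \<subseteq> verts N \<longrightarrow> J \<subseteq> verts N \<longrightarrow> K \<subseteq> verts N \<longrightarrow>
        I \<inter> J = {} \<longrightarrow> I \<inter> K = {} \<longrightarrow> J \<inter> K = {} \<longrightarrow>
        (cond_indep mu Sg I J K \<longleftrightarrow> separated U D I J K))"

definition in_NG :: "nat \<Rightarrow> (nat \<times> nat) set \<Rightarrow> (nat \<times> nat) set \<Rightarrow> (nat \<Rightarrow> real) \<Rightarrow> (nat \<Rightarrow> nat \<Rightarrow> real) \<Rightarrow> bool" where
  "in_NG N U D mu Sg \<longleftrightarrow> regular_gaussian N mu Sg \<and>
     (\<forall>x. gdens (verts N) mu Sg x =
        (\<Prod>B\<in>comps_on U (verts N).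
           gdens (B \<union> parents D B) mu Sg x / gdens (parents D B) mu Sg x)) \<and>
     (\<forall>B\<in>comps_on U (verts N). \<exists>psi :: nat set \<Rightarrow> (nat \<Rightarrow> real) \<Rightarrow> real.
        (\<forall>S y. psi S y \<ge> 0) \<and>
        (\<forall>S y z. (\<forall>i\<in>S. y i = z i) \<longrightarrow> psi S y = psi S z) \<and>
        (\<forall>x. gdens (B \<union> parents D B) mu Sg x =
             (\<Prod>S | moral_complete U D (B \<union> parents D B) S. psi S x)))"

datatype nd_index = Mean nat | Diag nat | UEdge nat nat | DEdge nat nat

definition nd_indices :: "nat \<Rightarrow> (nat \<times> nat) set \<Rightarrow> (nat \<times> nat) set \<Rightarrow> nd_index set" where
  "nd_indices N U D = Mean ` verts N \<union> Diag ` verts N \<union>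
     {UEdge a b | a b. (a, b) \<in> U \<and> a < b} \<union> {DEdge k j | k j. (k, j) \<in> D}"

definition Omega_of :: "nat \<Rightarrow> (nat \<times> nat) set \<Rightarrow> (nat \<times> nat) set \<Rightarrow> (nat \<Rightarrow> nat \<Rightarrow> real) \<Rightarrow> nat \<Rightarrow> (nat \<Rightarrow> nat \<Rightarrow> real)" where
  "Omega_of N U D Sg v = inv_on (comp_of N U v \<union> parents D (comp_of N U v)) Sg"

fun nd_coord :: "nat \<Rightarrow> (nat \<times> nat) set \<Rightarrow> (nat \<times> nat) set \<Rightarrow> (nat \<Rightarrow> real) \<Rightarrow> (nat \<Rightarrow> nat \<Rightarrow> real) \<Rightarrow> nd_index \<Rightarrow> real" where
  "nd_coord N U D mu Sg (Mean v) = mu v"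
| "nd_coord N U D mu Sg (Diag v) = Omega_of N U D Sg v v v"
| "nd_coord N U D mu Sg (UEdge a b) = Omega_of N U D Sg a a b"
| "nd_coord N U D mu Sg (DEdge k j) = Omega_of N U D Sg j j k"

definition nd_params :: "nat \<Rightarrow> (nat \<times> nat) set \<Rightarrow> (nat \<times> nat) set \<Rightarrow> (nat \<Rightarrow> real) \<Rightarrow> (nat \<Rightarrow> nat \<Rightarrow> real) \<Rightarrow> (nd_index \<Rightarrow> real)" where
  "nd_params N U D mu Sg = restrict (nd_coord N U D mu Sg) (nd_indices N U D)"

definition nd_lebesgue :: "nat \<Rightarrow> (nat \<times> nat) set \<Rightarrow> (nat \<times> nat) set \<Rightarrow> (nd_index \<Rightarrow> real) measure" where
  "nd_lebesgue N U D = completion (PiM (nd_indices N U D) (\<lambda>_. lborel))"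

end

theory Submission
  imports Defs "Jordan_Normal_Form.Determinant"
begin

text \<open>
  Write \<open>A = M + E\<close> for the matrix of nd parameters, with \<open>M\<close> the entries within components and \<open>E\<close> those on arrows.
  For \<open>p\<close> in \<open>N(G)\<close> with covariance \<open>\<Sigma>\<close>, the factorization says that every vector \<open>x = \<Sigma> g\<close> satisfies \<open>A x = M y\<close> and
  \<open>A\<^sup>T y = g\<close> for some \<open>y\<close>. Hence the conditional covariances given \<open>K\<close> are, up to sign, the entries of the
  inverse of the saddle matrix with blocks \<open>M\<close>, \<open>A\<close>, \<open>A\<^sup>T\<close>, \<open>0\<close>, where the second index ranges outside \<open>K\<close>.

  Separation implies independence: for \<open>z = x - y\<close> the system reads \<open>M z + E x = 0\<close>, \<open>A\<^sup>T (x - z) = g\<close>. On the anterior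
  set of \<open>I \<union> J \<union> K\<close>, cutting \<open>x\<close> and \<open>z\<close> down to what is reachable from \<open>I\<close> by superactive routes gives a solution of the
  homogeneous system, which is zero because \<open>M\<close> is positive definite and \<open>A\<close> is block triangular.

  Conversely, independence of \<open>i\<close> and \<open>j\<close> given \<open>K\<close> is the vanishing of a determinant that is polynomial in the nd
  parameters, so it suffices to find one parameter where it does not vanish when a superactive route exists.
  Fix \<open>M\<close> as a diagonally dominant Laplacian, for which the inverse without arrows is explicit, and add the arrows
  one at a time. Adding \<open>a \<rightarrow> b\<close> with coefficient \<open>t\<close> is a rank-two update; since the diagonal entries of the inverse at
  the two affected indices have opposite signs, an entry of the inverse can vanish for all \<open>t\<close> only if
  its two indices are joined by no superactive route, with or without the new arrow.
\<close>

section \<open>Positive definite matrices over finite index sets\<close>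

text \<open>Covariances are rational functions of the nd parameters, and conditioning inverts
  submatrices of them. In the saddle matrix every entry is a parameter, a sum of parameters or 0,
  and conditioning on \<open>K\<close> only deletes rows and columns; this makes dependence a
  polynomial condition. The obstacle is the witness for non-vanishing. A superactive route may
  repeat nodes and edges, so putting weight only on the edges of one route does not exclude
  cancellation. The induction over arrows therefore treats all pairs of indices at once, residual
  indices included, because a new arrow joins \<open>Var a\<close> to \<open>Res b\<close>. Without
  arrows nothing cancels, since the inverse of the Laplacian is a sum over walks whose weights are
  all positive. Zero sets are measured in the whole coordinate space, so a witness is just a real
  assignment of the parameters.\<close>

definition pd_on :: "'a set \<Rightarrow> ('a \<Rightarrow> 'a \<Rightarrow> real) \<Rightarrow> bool" where
  "pd_on A M \<longleftrightarrow> finite A \<and> (\<forall>i\<in>A. \<forall>j\<in>A. M i j = M j i) \<and>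
     (\<forall>x. (\<exists>i\<in>A. x i \<noteq> 0) \<longrightarrow> (\<Sum>i\<in>A. \<Sum>j\<in>A. x i * M i j * x j) > 0)"

definition mvec :: "'a set \<Rightarrow> ('a \<Rightarrow> 'a \<Rightarrow> real) \<Rightarrow> ('a \<Rightarrow> real) \<Rightarrow> 'a \<Rightarrow> real" where
  "mvec A M x i = (\<Sum>j\<in>A. M i j * x j)"

lemma quad_eq: "(\<Sum>i\<in>A. \<Sum>j\<in>A. x i * M i j * y j) = (\<Sum>i\<in>A. x i * mvec A M y i)"
  by (simp add: mvec_def sum_distrib_left mult.assoc)

lemma mvec_add: "mvec A M (\<lambda>k. x k + y k) i = mvec A M x i + mvec A M y i"
  by (simp add: mvec_def distrib_left sum.distrib)

lemma mvec_diff: "mvec A M (\<lambda>k. x k - y k) i = mvec A M x i - mvec A M y i"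
  by (simp add: mvec_def right_diff_distrib sum_subtractf)

lemma mvec_scale: "mvec A M (\<lambda>k. c * x k) i = c * mvec A M x i"
  by (simp add: mvec_def sum_distrib_left algebra_simps)

lemma mvec_cong: "(\<And>j. j \<in> A \<Longrightarrow> x j = y j) \<Longrightarrow> mvec A M x i = mvec A M y i"
  by (simp add: mvec_def)

lemma mvec_restrict:
  assumes "finite B" "A \<subseteq> B" "\<And>j. j \<in> B - A \<Longrightarrow> x j = 0"
  shows "mvec B M x i = mvec A M x i"
  unfolding mvec_def using assms by (intro sum.mono_neutral_right) auto

lemma mvec_swap:
  assumes "\<And>i j. i \<in> A \<Longrightarrow> j \<in> A \<Longrightarrow> M i j = M' j i"
  shows "(\<Sum>i\<in>A. x i * mvec A M y i) = (\<Sum>i\<in>A. y i * mvec A M' x i)"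
proof -
  have "(\<Sum>i\<in>A. x i * mvec A M y i) = (\<Sum>i\<in>A. \<Sum>j\<in>A. y j * (M' j i * x i))"
    using assms by (simp add: mvec_def sum_distrib_left algebra_simps cong: sum.cong)
  also have "\<dots> = (\<Sum>j\<in>A. \<Sum>i\<in>A. y j * (M' j i * x i))" by (rule sum.swap)
  finally show ?thesis by (simp add: mvec_def sum_distrib_left)
qed

lemma pd_onD:
  assumes "pd_on A M"
  shows "finite A" "\<And>i j. i \<in> A \<Longrightarrow> j \<in> A \<Longrightarrow> M i j = M j i"
    "\<And>x i. i \<in> A \<Longrightarrow> x i \<noteq> 0 \<Longrightarrow> (\<Sum>i\<in>A. x i * mvec A M x i) > 0"
  using assms by (auto simp: pd_on_def quad_eq)

lemma pd_on_swap: "pd_on A M \<Longrightarrow> (\<Sum>i\<in>A. x i * mvec A M y i) = (\<Sum>i\<in>A. y i * mvec A M x i)"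
  by (intro mvec_swap pd_onD(2))

lemma pd_on_zero: "pd_on A M \<Longrightarrow> (\<Sum>i\<in>A. x i * mvec A M x i) = 0 \<Longrightarrow> i \<in> A \<Longrightarrow> x i = 0"
  using pd_onD(3)[of A M i x] by fastforce

lemma pd_on_nonneg: "pd_on A M \<Longrightarrow> (\<Sum>i\<in>A. x i * mvec A M x i) \<ge> 0"
  by (cases "\<exists>i\<in>A. x i \<noteq> 0") (auto dest: pd_onD(3)[of A M _ x])

lemma pd_on_subset:
  assumes "pd_on A M" "B \<subseteq> A"
  shows "pd_on B M"
proof -
  have fin: "finite A" "finite B" using assms finite_subset by (auto simp: pd_on_def)
  have "(\<Sum>i\<in>B. \<Sum>j\<in>B. x i * M i j * x j) > 0" if x: "i \<in> B" "x i \<noteq> 0" for x i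
  proof -
    let ?x = "\<lambda>i. if i \<in> B then x i else 0"
    have "(\<Sum>i\<in>A. ?x i * mvec A M ?x i) > 0"
      using x assms(2) by (intro pd_onD(3)[OF assms(1), of i]) auto
    also have "(\<Sum>i\<in>A. ?x i * mvec A M ?x i) = (\<Sum>i\<in>B. ?x i * mvec A M ?x i)"
      using fin assms(2) by (intro sum.mono_neutral_right) auto
    also have "\<dots> = (\<Sum>i\<in>B. x i * mvec B M x i)"
    proof (intro sum.cong refl)
      fix i assume "i \<in> B"
      have "mvec A M ?x i = mvec B M ?x i" using fin assms(2) by (intro mvec_restrict) auto
      also have "\<dots> = mvec B M x i" by (intro mvec_cong) auto
      finally show "?x i * mvec A M ?x i = x i * mvec B M x i" using \<open>i \<in> B\<close> by simp
    qed
    finally show ?thesis by (simp add: quad_eq)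
  qed
  then show ?thesis using assms fin by (auto simp: pd_on_def subset_eq)
qed

lemma pd_on_inj:
  assumes "pd_on A M" "\<And>i. i \<in> A \<Longrightarrow> mvec A M x i = mvec A M y i" "i \<in> A"
  shows "x i = y i"
proof -
  have "(\<Sum>i\<in>A. (x i - y i) * mvec A M (\<lambda>k. x k - y k) i) = 0"
    using assms(2) by (simp add: mvec_diff)
  from pd_on_zero[OF assms(1) this assms(3)] show ?thesis by simp
qed

text \<open>Induction by bordering. The rows of \<open>A\<close> annihilate \<open>?u\<close>, so
  row \<open>a\<close> applied to it gives the Schur complement, which is the quadratic form at
  \<open>?u\<close> and hence positive. A multiple of \<open>?u\<close> then corrects row
  \<open>a\<close> and leaves the other rows alone.\<close>

lemma pd_on_solve:
  assumes "pd_on A M"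
  shows "\<exists>x. \<forall>i\<in>A. mvec A M x i = b i"
proof -
  have "finite A" using assms by (rule pd_onD)
  then show ?thesis using assms
  proof (induction A arbitrary: b rule: finite_induct)
    case (insert a A)
    have pdA: "pd_on A M" using insert.prems by (rule pd_on_subset) auto
    obtain u where u: "\<And>i. i \<in> A \<Longrightarrow> mvec A M u i = - M i a" using insert.IH[OF pdA, of "\<lambda>i. - M i a"] by auto
    obtain s where s: "\<And>i. i \<in> A \<Longrightarrow> mvec A M s i = b i" using insert.IH[OF pdA, of b] by auto
    let ?u = "u(a := 1)"
    have mi: "mvec (insert a A) M x i = M i a * x a + mvec A M x i" for x i
      using insert.hyps by (simp add: mvec_def)
    have upd: "mvec A M (x(a := c)) i = mvec A M x i" for x c i
      using insert.hyps by (intro mvec_cong) auto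
    have u0: "mvec (insert a A) M ?u i = 0" if "i \<in> A" for i
      using u[OF that] by (simp add: mi upd)
    have "0 < (\<Sum>i\<in>insert a A. ?u i * mvec (insert a A) M ?u i)"
      by (intro pd_onD(3)[OF insert.prems, of a]) auto
    also have "\<dots> = mvec (insert a A) M ?u a"
      using insert.hyps u0 by (simp add: sum.neutral)
    finally have pos: "mvec (insert a A) M ?u a > 0" .
    define t where "t = (b a - mvec A M s a) / mvec (insert a A) M ?u a"
    let ?x = "\<lambda>i. (s(a := 0)) i + t * ?u i"
    have e: "mvec (insert a A) M ?x i = mvec A M s i + t * mvec (insert a A) M ?u i" for i
    proof -
      have "mvec (insert a A) M ?x i = mvec (insert a A) M (s(a := 0)) i + t * mvec (insert a A) M ?u i"
        by (simp only: mvec_add mvec_scale)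
      moreover have "mvec (insert a A) M (s(a := 0)) i = mvec A M s i" by (simp only: mi upd) simp
      ultimately show ?thesis by simp
    qed
    have "mvec (insert a A) M ?x i = b i" if "i \<in> insert a A" for i
    proof (cases "i = a")
      case True
      then show ?thesis unfolding e using pos by (simp add: t_def)
    next
      case False
      then show ?thesis unfolding e using s[of i] u0[of i] that by simp
    qed
    then show ?case by blast
  qed simp
qed

text \<open>\<open>inv_on\<close> is a definite description, so a solution must also be unique:
  \<open>pd_on_inj\<close> fixes its columns on \<open>A\<close>, and they are 0 elsewhere by
  stipulation.\<close>

lemma inv_on_props:
  assumes "pd_on A M"
  shows inv_on_outside: "i \<notin> A \<or> j \<notin> A \<Longrightarrow> inv_on A M i j = 0"
    and inv_on_mult: "\<And>i j. i \<in> A \<Longrightarrow> j \<in> A \<Longrightarrow> (\<Sum>k\<in>A. M i k * inv_on A M k j) = (if i = j then 1 else 0)"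
proof -
  have "\<forall>j. \<exists>w. \<forall>i\<in>A. mvec A M w i = (if i = j then 1 else 0)"
    by (intro allI pd_on_solve[OF assms])
  from choice[OF this] obtain w where
    w: "\<And>i j. i \<in> A \<Longrightarrow> mvec A M (w j) i = (if i = j then 1 else 0)" by auto
  let ?P = "\<lambda>W. (\<forall>i j. (i \<notin> A \<or> j \<notin> A) \<longrightarrow> W i j = 0) \<and>
      (\<forall>i\<in>A. \<forall>j\<in>A. (\<Sum>k\<in>A. M i k * W k j) = (if i = j then 1 else 0))"
  have "?P (THE W. ?P W)"
  proof (rule theI[of ?P])
    show "?P (\<lambda>i j. if i \<in> A \<and> j \<in> A then w j i else 0)"
      using w by (auto simp: mvec_def cong: sum.cong)
  next
    fix W assume W: "?P W"
    show "W = (\<lambda>i j. if i \<in> A \<and> j \<in> A then w j i else 0)"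
    proof (intro ext)
      fix i j
      have "W i j = w j i" if "i \<in> A" "j \<in> A"
        using that W w by (intro pd_on_inj[OF assms, of "\<lambda>k. W k j" "w j" i]) (auto simp: mvec_def)
      then show "W i j = (if i \<in> A \<and> j \<in> A then w j i else 0)" using W by auto
    qed
  qed
  then have "?P (inv_on A M)" unfolding inv_on_def .
  then show "i \<notin> A \<or> j \<notin> A \<Longrightarrow> inv_on A M i j = 0"
    "\<And>i j. i \<in> A \<Longrightarrow> j \<in> A \<Longrightarrow> (\<Sum>k\<in>A. M i k * inv_on A M k j) = (if i = j then 1 else 0)"
    by auto
qed

lemma mvec_inv_on:
  assumes "pd_on A M" "i \<in> A"
  shows "mvec A M (mvec A (inv_on A M) x) i = x i"
proof -
  have "mvec A M (mvec A (inv_on A M) x) i = (\<Sum>k\<in>A. \<Sum>j\<in>A. M i k * inv_on A M k j * x j)"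
    by (simp add: mvec_def sum_distrib_left mult.assoc)
  also have "\<dots> = (\<Sum>j\<in>A. (\<Sum>k\<in>A. M i k * inv_on A M k j) * x j)"
    by (subst sum.swap) (simp add: sum_distrib_right)
  also have "\<dots> = (\<Sum>j\<in>A. (if i = j then 1 else 0) * x j)"
    using inv_on_mult[OF assms(1) assms(2)] by (intro sum.cong refl) simp
  also have "\<dots> = (\<Sum>j\<in>A. if i = j then x j else 0)" by (intro sum.cong refl) simp
  also have "\<dots> = x i" using assms pd_onD(1)[OF assms(1)] by simp
  finally show ?thesis .
qed

lemma inv_on_unique:
  assumes "pd_on A M" "\<And>i. i \<in> A \<Longrightarrow> mvec A M w i = x i" "i \<in> A"
  shows "mvec A (inv_on A M) x i = w i"
proof (rule pd_on_inj[OF assms(1) _ assms(3)])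
  fix i assume "i \<in> A"
  then show "mvec A M (mvec A (inv_on A M) x) i = mvec A M w i"
    by (simp only: mvec_inv_on[OF assms(1)] assms(2))
qed

text \<open>Both entries are the bilinear form of \<open>M\<close> at columns \<open>i\<close> and
  \<open>j\<close> of \<open>W\<close>. No definiteness is assumed, because the saddle matrix, to
  which this is applied as well, is indefinite.\<close>

lemma right_inverse_sym:
  fixes M W :: "'a \<Rightarrow> 'a \<Rightarrow> real"
  assumes fin: "finite A" and sym: "\<And>i j. i \<in> A \<Longrightarrow> j \<in> A \<Longrightarrow> M i j = M j i"
    and inv: "\<And>i j. i \<in> A \<Longrightarrow> j \<in> A \<Longrightarrow> (\<Sum>k\<in>A. M i k * W k j) = (if i = j then 1 else 0)"
    and ij: "i \<in> A" "j \<in> A"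
  shows "W i j = W j i"
proof -
  have W: "mvec A M (\<lambda>k. W k l) k = (if k = l then 1 else 0)" if "l \<in> A" "k \<in> A" for k l
    using inv that by (simp add: mvec_def)
  have sel: "(\<Sum>k\<in>A. x k * mvec A M (\<lambda>k. W k l) k) = x l" if "l \<in> A" for x and l
  proof -
    have "(\<Sum>k\<in>A. x k * mvec A M (\<lambda>k. W k l) k) = (\<Sum>k\<in>A. if k = l then x k else 0)"
      using that by (intro sum.cong refl) (simp only: W, simp)
    then show ?thesis using fin that by simp
  qed
  have "W j i = (\<Sum>k\<in>A. W k i * mvec A M (\<lambda>k. W k j) k)" using sel[OF ij(2), of "\<lambda>k. W k i"] by simp
  also have "\<dots> = (\<Sum>k\<in>A. W k j * mvec A M (\<lambda>k. W k i) k)" using sym by (intro mvec_swap)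
  also have "\<dots> = W i j" using sel[OF ij(1), of "\<lambda>k. W k j"] by simp
  finally show ?thesis by simp
qed

lemma inv_on_sym:
  assumes "pd_on A M"
  shows "inv_on A M i j = inv_on A M j i"
proof (cases "i \<in> A \<and> j \<in> A")
  case True
  then show ?thesis
    using right_inverse_sym[OF pd_onD(1,2)[OF assms] inv_on_mult[OF assms], of i j] by blast
next
  case False
  then show ?thesis using inv_on_outside[OF assms] by auto
qed

text \<open>Substituting \<open>x = M u\<close> turns the form of the inverse at \<open>x\<close>
  into the form of \<open>M\<close> at \<open>u\<close>.\<close>

lemma pd_on_inv_on:
  assumes "pd_on A M"
  shows "pd_on A (inv_on A M)"
proof -
  have "(\<Sum>i\<in>A. x i * mvec A (inv_on A M) x i) > 0" if x: "i \<in> A" "x i \<noteq> 0" for x i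
  proof -
    let ?u = "mvec A (inv_on A M) x"
    have mu: "mvec A M ?u k = x k" if "k \<in> A" for k using that assms by (rule mvec_inv_on[rotated])
    have "\<exists>k\<in>A. ?u k \<noteq> 0"
    proof (rule ccontr)
      assume "\<not> ?thesis"
      then have "mvec A M ?u i = 0" by (simp add: mvec_def[of A M])
      then show False using mu x by simp
    qed
    then obtain k where "k \<in> A" "?u k \<noteq> 0" by blast
    then have "0 < (\<Sum>k\<in>A. ?u k * mvec A M ?u k)" by (rule pd_onD(3)[OF assms])
    also have "\<dots> = (\<Sum>k\<in>A. x k * ?u k)" using mu by (intro sum.cong) auto
    finally show ?thesis .
  qed
  then show ?thesis using assms inv_on_sym[OF assms] by (auto simp: pd_on_def quad_eq)
qed

text \<open>Triangularity is expressed by a rank function that is constant along the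
  symmetric part and strictly decreasing along the remaining part.\<close>
lemma triangular_inj:
  fixes rk :: "'a \<Rightarrow> nat"
  assumes pd: "pd_on V M"
    and M: "\<And>v w. v \<in> V \<Longrightarrow> w \<in> V \<Longrightarrow> M v w \<noteq> 0 \<Longrightarrow> rk v = rk w"
    and F: "\<And>v w. v \<in> V \<Longrightarrow> w \<in> V \<Longrightarrow> F v w \<noteq> 0 \<Longrightarrow> rk w < rk v"
    and x: "\<And>v. v \<in> V \<Longrightarrow> x v \<noteq> 0 \<Longrightarrow> mvec V M x v + mvec V F x v = 0"
    and "v \<in> V"
  shows "x v = 0"
proof (rule ccontr)
  assume "x v \<noteq> 0"
  then obtain u where u: "u \<in> V" "x u \<noteq> 0" and min: "\<And>w. w \<in> V \<Longrightarrow> x w \<noteq> 0 \<Longrightarrow> rk u \<le> rk w"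
    using ex_has_least_nat[of "\<lambda>w. w \<in> V \<and> x w \<noteq> 0" v rk] \<open>v \<in> V\<close> by auto
  \<comment> \<open>On the lowest rank where \<open>x\<close> does not vanish, \<open>F\<close>
    contributes nothing, since it looks only at lower ranks. The cut \<open>?x\<close> then has zero
    energy under \<open>M\<close>.\<close>
  let ?x = "\<lambda>w. if rk w = rk u then x w else 0"
  have "?x w * mvec V M ?x w = 0" if w: "w \<in> V" for w
  proof (cases "?x w = 0")
    case False
    then have r: "rk w = rk u" "x w \<noteq> 0" by (auto split: if_splits)
    have "mvec V M ?x w = mvec V M x w"
      unfolding mvec_def
    proof (intro sum.cong refl)
      fix k assume k: "k \<in> V"
      show "M w k * ?x k = M w k * x k" using M[OF w k] r(1) by (cases "M w k = 0") auto
    qed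
    moreover have "mvec V F x w = 0"
      unfolding mvec_def
    proof (intro sum.neutral ballI)
      fix k assume k: "k \<in> V"
      show "F w k * x k = 0" using F[OF w k] min[OF k] r by fastforce
    qed
    ultimately show ?thesis using x[OF w r(2)] by simp
  qed simp
  then have "(\<Sum>w\<in>V. ?x w * mvec V M ?x w) = 0" by (intro sum.neutral) blast
  from pd_on_zero[OF pd this u(1)] u(2) show False by simp
qed

section \<open>Determinants over finite index sets\<close>

lemma det_on_row:
  assumes "finite A" "a \<in> A"
  shows "det_on A (M(a := r)) =
    (\<Sum>p | p permutes A. r (p a) * (of_int (sign p) * (\<Prod>i\<in>A - {a}. M i (p i))))"
proof -
  have "(\<Prod>i\<in>A. (M(a := r)) i (p i)) = r (p a) * (\<Prod>i\<in>A - {a}. M i (p i))" for p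
  proof -
    have "(\<Prod>i\<in>A. (M(a := r)) i (p i)) =
        (M(a := r)) a (p a) * (\<Prod>i\<in>A - {a}. (M(a := r)) i (p i))"
      by (rule prod.remove[OF assms])
    also have "(\<Prod>i\<in>A - {a}. (M(a := r)) i (p i)) = (\<Prod>i\<in>A - {a}. M i (p i))"
      by (intro prod.cong) auto
    finally show ?thesis by simp
  qed
  then show ?thesis unfolding det_on_def by (simp only: mult.left_commute)
qed

lemma det_on_row_sum:
  assumes "finite A" "a \<in> A"
  shows "det_on A (M(a := \<lambda>j. \<Sum>k\<in>B. u k * r k j)) = (\<Sum>k\<in>B. u k * det_on A (M(a := r k)))"
proof -
  let ?c = "\<lambda>p. of_int (sign p) * (\<Prod>i\<in>A - {a}. M i (p i)) :: real"
  have "det_on A (M(a := \<lambda>j. \<Sum>k\<in>B. u k * r k j)) =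
      (\<Sum>p | p permutes A. \<Sum>k\<in>B. u k * (r k (p a) * ?c p))"
    unfolding det_on_row[OF assms] by (simp only: sum_distrib_right mult.assoc)
  also have "\<dots> = (\<Sum>k\<in>B. \<Sum>p | p permutes A. u k * (r k (p a) * ?c p))"
    by (rule sum.swap)
  finally show ?thesis unfolding det_on_row[OF assms] by (simp only: sum_distrib_left)
qed

lemma det_on_equal_rows:
  assumes fin: "finite A" and ab: "a \<in> A" "b \<in> A" "a \<noteq> b" and eq: "M a = M b"
  shows "det_on A M = 0"
proof -
  let ?t = "Transposition.transpose a b"
  have t: "?t permutes A" using ab by (intro permutes_swap_id) auto
  let ?f = "\<lambda>p. of_int (sign p) * (\<Prod>i\<in>A. M i (p i)) :: real"
  have "?f (p \<circ> ?t) = - ?f p" if p: "p permutes A" for p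
  proof -
    have perm: "permutation p" "permutation ?t"
      using p t fin permutation_permutes by blast+
    have row: "M (?t i) = M i" for i using eq by (simp add: Transposition.transpose_def)
    have "(\<Prod>i\<in>A. M i ((p \<circ> ?t) i)) = (\<Prod>i\<in>A. ((\<lambda>i. M i ((p \<circ> ?t) i)) \<circ> ?t) i)"
      using prod.permute[OF t, of "\<lambda>i. M i ((p \<circ> ?t) i)"] by (simp only: comp_def)
    also have "\<dots> = (\<Prod>i\<in>A. M i (p i))"
      by (simp only: comp_def row transpose_involutory)
    finally have "(\<Prod>i\<in>A. M i ((p \<circ> ?t) i)) = (\<Prod>i\<in>A. M i (p i))" .
    moreover have "sign (p \<circ> ?t) = - sign p"
      using sign_compose[OF perm] ab(3) by (simp add: sign_swap_id)
    ultimately show ?thesis by (simp only: of_int_minus minus_mult_left)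
  qed
  then have "(\<Sum>p | p permutes A. ?f (p \<circ> ?t)) = - det_on A M"
    by (simp add: det_on_def sum_negf)
  moreover have "(\<Sum>p | p permutes A. ?f (p \<circ> ?t)) = det_on A M"
    unfolding det_on_def
  proof (rule sum.reindex_bij_witness[of _ "\<lambda>p. p \<circ> ?t" "\<lambda>p. p \<circ> ?t"])
    fix p :: "nat \<Rightarrow> nat"
    show "(p \<circ> ?t) \<circ> ?t = p" "(p \<circ> ?t) \<circ> ?t = p" by (simp_all add: fun_eq_iff)
    assume "p \<in> {p. p permutes A}"
    then show "p \<circ> ?t \<in> {p. p permutes A}" "p \<circ> ?t \<in> {p. p permutes A}"
      using permutes_compose[OF t] by simp_all
  qed (rule refl)
  ultimately show ?thesis by simp
qed

text \<open>Replacing row \<open>a\<close> by the combination of all rows with coefficients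
  \<open>u\<close> keeps the determinant, as \<open>u a = 1\<close> and equal rows give 0. The new
  row is 0 outside column \<open>a\<close>, so only permutations fixing \<open>a\<close>
  survive.\<close>

lemma det_on_insert:
  assumes fin: "finite A" and a: "a \<notin> A" and ua: "u a = 1"
    and u: "\<And>j. j \<in> A \<Longrightarrow> (\<Sum>k\<in>insert a A. u k * M k j) = 0"
  shows "det_on (insert a A) M = (\<Sum>k\<in>insert a A. u k * M k a) * det_on A M"
proof -
  let ?A = "insert a A"
  let ?r = "\<lambda>j. \<Sum>k\<in>?A. u k * M k j"
  have fA: "finite ?A" "a \<in> ?A" using fin by auto
  have "det_on ?A (M(a := ?r)) = (\<Sum>k\<in>?A. u k * det_on ?A (M(a := M k)))"
    by (rule det_on_row_sum[OF fA])
  also have "\<dots> = u a * det_on ?A (M(a := M a)) + (\<Sum>k\<in>A. u k * det_on ?A (M(a := M k)))"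
    using fin a by simp
  also have "(\<Sum>k\<in>A. u k * det_on ?A (M(a := M k))) = 0"
  proof (intro sum.neutral ballI)
    fix k assume k: "k \<in> A"
    have "det_on ?A (M(a := M k)) = 0"
      using k a fA by (intro det_on_equal_rows[of ?A a k]) auto
    then show "u k * det_on ?A (M(a := M k)) = 0" by simp
  qed
  finally have "det_on ?A M = det_on ?A (M(a := ?r))"
    by (simp only: ua fun_upd_triv mult_1 add_0_right)
  also have "\<dots> = (\<Sum>p | p permutes ?A. ?r (p a) * (of_int (sign p) * (\<Prod>i\<in>A. M i (p i))))"
    using a by (subst det_on_row[OF fA]) (simp add: insert_Diff_if)
  also have "\<dots> = (\<Sum>p | p permutes A. ?r (p a) * (of_int (sign p) * (\<Prod>i\<in>A. M i (p i))))"
  proof (rule sum.mono_neutral_right)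
    show "finite {p. p permutes ?A}" using fA(1) by (rule finite_permutations)
    show "{p. p permutes A} \<subseteq> {p. p permutes ?A}" by (auto intro: permutes_subset)
    have "?r (p a) = 0" if p: "p permutes ?A" "\<not> p permutes A" for p
    proof -
      have "p a \<noteq> a" using p permutes_superset[OF p(1), of A] by auto
      then have "p a \<in> A" using permutes_in_image[OF p(1), of a] by auto
      then show ?thesis by (rule u)
    qed
    then show "\<forall>p\<in>{p. p permutes ?A} - {p. p permutes A}.
        ?r (p a) * (of_int (sign p) * (\<Prod>i\<in>A. M i (p i))) = 0" by simp
  qed
  also have "\<dots> = (\<Sum>p | p permutes A. ?r a * (of_int (sign p) * (\<Prod>i\<in>A. M i (p i))))"
    using a by (intro sum.cong refl) (simp add: permutes_not_in)
  finally show ?thesis by (simp add: det_on_def sum_distrib_left)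
qed

text \<open>For a covariance matrix, \<open>u\<close> gives the coefficients of the residual of
  \<open>a\<close> after regression on \<open>A\<close>, and the positive number is the variance of
  that residual.\<close>

lemma pd_on_regression:
  assumes pd: "pd_on (insert a A) M" and a: "a \<notin> A"
  shows "\<exists>u. u a = 1 \<and> (\<forall>j\<in>A. mvec (insert a A) M u j = 0) \<and> mvec (insert a A) M u a > 0"
proof -
  have fin: "finite A" using pd_onD(1)[OF pd] by simp
  obtain u where u: "\<And>i. i \<in> A \<Longrightarrow> mvec A M u i = - M i a"
    using pd_on_solve[OF pd_on_subset[OF pd], of A "\<lambda>i. - M i a"] by auto
  let ?u = "u(a := 1)"
  have z: "mvec (insert a A) M ?u j = 0" if "j \<in> A" for j
  proof -
    have "mvec A M ?u j = mvec A M u j" using a by (intro mvec_cong) auto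
    then show ?thesis using u[OF that] a fin by (simp add: mvec_def)
  qed
  have "0 < (\<Sum>i\<in>insert a A. ?u i * mvec (insert a A) M ?u i)"
    by (intro pd_onD(3)[OF pd, of a]) auto
  also have "\<dots> = mvec (insert a A) M ?u a"
    using fin a z by (simp add: sum.neutral)
  finally show ?thesis using z by (intro exI[of _ ?u]) auto
qed

lemma det_on_insert_regression:
  assumes pd: "pd_on (insert a A) M" and a: "a \<notin> A" and ua: "u a = 1"
    and u: "\<And>j. j \<in> A \<Longrightarrow> mvec (insert a A) M u j = 0"
  shows "det_on (insert a A) M = mvec (insert a A) M u a * det_on A M"
proof -
  have fin: "finite A" using pd_onD(1)[OF pd] by simp
  have sw: "(\<Sum>k\<in>insert a A. u k * M k j) = mvec (insert a A) M u j" if "j \<in> insert a A" for j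
    unfolding mvec_def using pd_onD(2)[OF pd] that by (intro sum.cong refl) (metis mult.commute)
  show ?thesis
    using det_on_insert[where u = u and M = M, OF fin a ua] sw u by simp
qed

lemma pd_on_det_pos:
  assumes "pd_on A M" shows "det_on A M > 0"
proof -
  have "finite A" using assms by (rule pd_onD)
  then show ?thesis using assms
  proof (induction A rule: finite_induct)
    case empty
    show ?case by (simp add: det_on_def)
  next
    case (insert a A)
    obtain u where "u a = 1" "\<And>j. j \<in> A \<Longrightarrow> mvec (insert a A) M u j = 0" "mvec (insert a A) M u a > 0"
      using pd_on_regression[OF insert.prems insert.hyps(2)] by blast
    then show ?case
      using det_on_insert_regression[OF insert.prems insert.hyps(2), of u] insert.IH
        pd_on_subset[OF insert.prems, of A] by (auto intro: mult_pos_pos)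
  qed
qed

section \<open>Zero sets of separately polynomial functions\<close>

text \<open>Polynomial in each coordinate with the others fixed. The class contains constants and
  coordinates, is closed under sums and products, and suffices for a Fubini argument on zero
  sets.\<close>

definition sep_poly :: "'i set \<Rightarrow> (('i \<Rightarrow> real) \<Rightarrow> real) \<Rightarrow> bool" where
  "sep_poly I f \<longleftrightarrow> f \<in> borel_measurable (PiM I (\<lambda>_. lborel)) \<and>
     (\<forall>x i. \<exists>p. \<forall>t. f (x(i := t)) = poly p t)"

lemma sep_poly_const: "sep_poly I (\<lambda>_. c)"
  unfolding sep_poly_def by (auto intro!: exI[of _ "[:c:]"])

lemma sep_poly_coord:
  assumes "k \<in> I" shows "sep_poly I (\<lambda>x. x k)"
proof -
  have "\<exists>p. \<forall>t. (x(i := t)) k = poly p t" for x :: "'a \<Rightarrow> real" and i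
    by (cases "i = k") (auto intro: exI[of _ "[:0, 1:]"] exI[of _ "[:x k:]"])
  then show ?thesis
    using measurable_component_singleton[OF assms, of "\<lambda>_. lborel :: real measure"]
    by (simp add: sep_poly_def)
qed

lemma sep_poly_add:
  assumes "sep_poly I f" "sep_poly I g" shows "sep_poly I (\<lambda>x. f x + g x)"
  unfolding sep_poly_def
proof (intro conjI allI)
  show "(\<lambda>x. f x + g x) \<in> borel_measurable (PiM I (\<lambda>_. lborel))"
    using assms unfolding sep_poly_def by (intro borel_measurable_add) auto
  fix x i
  obtain p q where "\<forall>t. f (x(i := t)) = poly p t" "\<forall>t. g (x(i := t)) = poly q t"
    using assms unfolding sep_poly_def by meson
  then show "\<exists>p. \<forall>t. f (x(i := t)) + g (x(i := t)) = poly p t" by (intro exI[of _ "p + q"]) simp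
qed

lemma sep_poly_mult:
  assumes "sep_poly I f" "sep_poly I g" shows "sep_poly I (\<lambda>x. f x * g x)"
  unfolding sep_poly_def
proof (intro conjI allI)
  show "(\<lambda>x. f x * g x) \<in> borel_measurable (PiM I (\<lambda>_. lborel))"
    using assms unfolding sep_poly_def by (intro borel_measurable_times) auto
  fix x i
  obtain p q where "\<forall>t. f (x(i := t)) = poly p t" "\<forall>t. g (x(i := t)) = poly q t"
    using assms unfolding sep_poly_def by meson
  then show "\<exists>p. \<forall>t. f (x(i := t)) * g (x(i := t)) = poly p t" by (intro exI[of _ "p * q"]) simp
qed

lemma sep_poly_sum: "(\<And>k. k \<in> S \<Longrightarrow> sep_poly I (f k)) \<Longrightarrow> sep_poly I (\<lambda>x. \<Sum>k\<in>S. f k x)"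
  by (induction S rule: infinite_finite_induct) (auto intro: sep_poly_const sep_poly_add)

lemma sep_poly_prod: "(\<And>k. k \<in> S \<Longrightarrow> sep_poly I (f k)) \<Longrightarrow> sep_poly I (\<lambda>x. \<Prod>k\<in>S. f k x)"
  by (induction S rule: infinite_finite_induct) (auto intro: sep_poly_const sep_poly_mult)

text \<open>Fubini, one coordinate at a time: along the line through \<open>x0\<close> in direction
  \<open>i\<close> the function is a nonzero polynomial, so all but finitely many slices again
  contain a point where it does not vanish.\<close>

lemma sep_poly_null_sets:
  assumes "finite I" "sep_poly I f" "x0 \<in> PiE I (\<lambda>_. UNIV)" "f x0 \<noteq> 0"
  shows "{x \<in> space (PiM I (\<lambda>_. lborel)). f x = 0} \<in> null_sets (PiM I (\<lambda>_. lborel))"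
  using assms
proof (induction I arbitrary: f x0 rule: finite_induct)
  case empty
  then have *: "{x \<in> space (PiM {} (\<lambda>_. lborel)). f x = 0} = {}" by (auto simp: space_PiM)
  show ?case unfolding * by simp
next
  case (insert i I)
  interpret product_sigma_finite "\<lambda>_::'a. lborel :: real measure"
    by unfold_locales
  let ?M = "\<lambda>I. PiM I (\<lambda>_::'a. lborel :: real measure)"
  let ?Z = "{x \<in> space (?M (insert i I)). f x = 0}"
  have meas: "f \<in> borel_measurable (?M (insert i I))"
    and sep: "\<And>x k. \<exists>p. \<forall>t. f (x(k := t)) = poly p t"
    using insert.prems(1) by (auto simp: sep_poly_def)
  have Z: "?Z \<in> sets (?M (insert i I))" using meas by measurable
  obtain p where p: "\<And>t. f (x0(i := t)) = poly p t" using sep by blast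
  have "poly p (x0 i) \<noteq> 0" using p[of "x0 i"] insert.prems(3) by simp
  then have fin: "finite {t. poly p t = 0}" by (intro poly_roots_finite) auto
  have slice: "{x \<in> space (?M I). f (x(i := t)) = 0} \<in> null_sets (?M I)" if t: "poly p t \<noteq> 0" for t
  proof (rule insert.IH[of "\<lambda>x. f (x(i := t))" "x0(i := undefined)"])
    have upd: "(\<lambda>x. x(i := t)) \<in> ?M I \<rightarrow>\<^sub>M ?M (insert i I)"
      by (rule measurable_fun_upd[where J = I]) auto
    have "\<exists>p. \<forall>s. f ((x(k := s))(i := t)) = poly p s" for x k
    proof (cases "k = i")
      case True
      then show ?thesis by (auto intro: exI[of _ "[:f (x(i := t)):]"])
    next
      case False
      then show ?thesis using sep[of "x(i := t)" k] by (simp add: fun_upd_twist)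
    qed
    then show "sep_poly I (\<lambda>x. f (x(i := t)))"
      using measurable_compose[OF upd meas] by (simp add: sep_poly_def)
    \<comment> \<open>Points of the smaller product space are \<open>undefined\<close> outside
      \<open>I\<close>, so the witness must lose its coordinate \<open>i\<close>.\<close>
    show "x0(i := undefined) \<in> PiE I (\<lambda>_. UNIV)"
      using insert.prems(2) insert.hyps(2) by (auto simp: PiE_def extensional_def)
    show "f ((x0(i := undefined))(i := t)) \<noteq> 0" using t p by simp
  qed
  have "emeasure (?M (insert i I)) ?Z = (\<integral>\<^sup>+ x. indicator ?Z x \<partial>?M (insert i I))"
    using Z by simp
  also have "\<dots> = (\<integral>\<^sup>+ t. \<integral>\<^sup>+ x. indicator ?Z (x(i := t)) \<partial>?M I \<partial>lborel)"
    using insert.hyps Z by (intro product_nn_integral_insert_rev) auto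
  also have "\<dots> = (\<integral>\<^sup>+ t. 0 \<partial>(lborel :: real measure))"
  proof (rule nn_integral_cong_AE)
    have "AE t in lborel. t \<notin> {t. poly p t = 0}"
      using fin by (intro AE_not_in finite_imp_null_set_lborel)
    then show "AE t in lborel. (\<integral>\<^sup>+ x. indicator ?Z (x(i := t)) \<partial>?M I) = 0"
    proof (rule AE_mp, intro AE_I2 impI)
      fix t :: real assume "t \<notin> {t. poly p t = 0}"
      then have n: "{x \<in> space (?M I). f (x(i := t)) = 0} \<in> null_sets (?M I)" using slice by simp
      have "(\<integral>\<^sup>+ x. indicator ?Z (x(i := t)) \<partial>?M I) =
          (\<integral>\<^sup>+ x. indicator {x \<in> space (?M I). f (x(i := t)) = 0} x \<partial>?M I)"
        by (intro nn_integral_cong) (auto simp: indicator_def space_PiM PiE_def extensional_def)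
      also have "\<dots> = 0" using n by (auto simp: null_sets_def)
      finally show "(\<integral>\<^sup>+ x. indicator ?Z (x(i := t)) \<partial>?M I) = 0" .
    qed
  qed
  finally show ?case using Z by (simp add: null_sets_def)
qed

section \<open>Superactive routes as alternating sequences of sections and arrows\<close>

lemma chain_graphD:
  assumes "chain_graph N U D"
  shows "U \<subseteq> verts N \<times> verts N" "D \<subseteq> verts N \<times> verts N"
    "\<And>a b. (a, b) \<in> U \<Longrightarrow> (b, a) \<in> U"
    "\<And>a b. (a, b) \<in> D \<Longrightarrow> (b, a) \<notin> D" "\<And>a b. (a, b) \<in> D \<Longrightarrow> (a, b) \<notin> U"
    "\<And>a b. (a, b) \<in> D \<Longrightarrow> (b, a) \<notin> U"
  using assms unfolding chain_graph_def sym_def by blast+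

lemma finite_verts: "finite (verts N)"
  by (simp add: verts_def)

lemma rtrancl_iff_successively:
  "(u, v) \<in> R\<^sup>* \<longleftrightarrow> (\<exists>ys. ys \<noteq> [] \<and> successively (\<lambda>a b. (a, b) \<in> R) ys \<and> hd ys = u \<and> last ys = v)"
proof
  assume "(u, v) \<in> R\<^sup>*"
  then show "\<exists>ys. ys \<noteq> [] \<and> successively (\<lambda>a b. (a, b) \<in> R) ys \<and> hd ys = u \<and> last ys = v"
  proof induction
    case base
    show ?case by (intro exI[of _ "[u]"]) simp
  next
    case (step v w)
    then obtain ys where "ys \<noteq> []" "successively (\<lambda>a b. (a, b) \<in> R) ys" "hd ys = u" "last ys = v"
      by blast
    then show ?case using step.hyps
      by (intro exI[of _ "ys @ [w]"]) (simp add: successively_append_iff)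
  qed
next
  have "(hd ys, last ys) \<in> R\<^sup>*" if "ys \<noteq> []" "successively (\<lambda>a b. (a, b) \<in> R) ys" for ys
    using that
  proof (induction ys)
    case (Cons a ys)
    then show ?case
      by (cases ys) (auto intro: converse_rtrancl_into_rtrancl)
  qed simp
  then show "\<exists>ys. ys \<noteq> [] \<and> successively (\<lambda>a b. (a, b) \<in> R) ys \<and> hd ys = u \<and> last ys = v \<Longrightarrow> (u, v) \<in> R\<^sup>*"
    by blast
qed

text \<open>A section of a route may be left at \<open>v\<close> through a tail or the end of the route (\<open>Var v\<close>),
  or through an arrowhead at \<open>v\<close> (\<open>Res v\<close>). Algebraically, \<open>Var v\<close> indexes the random variable at \<open>v\<close>
  and \<open>Res v\<close> the residual of \<open>v\<close> given the parents of its component.\<close>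
datatype node = Var nat | Res nat

fun vertex :: "node \<Rightarrow> nat" where
  "vertex (Var v) = v"
| "vertex (Res v) = v"

fun is_res :: "node \<Rightarrow> bool" where
  "is_res (Var v) = False"
| "is_res (Res v) = True"

text \<open>The labels say how a section is entered and left. Arrowheads at both ends make it a
  collider section, which must meet \<open>K\<close>; any other section must avoid
  \<open>K\<close>.\<close>

definition sect :: "(nat \<times> nat) set \<Rightarrow> nat set \<Rightarrow> (node \<times> node) set" where
  "sect U K = {(\<xi>, \<eta>).
     if is_res \<xi> \<and> is_res \<eta> then \<exists>k\<in>K. (vertex \<xi>, k) \<in> U\<^sup>* \<and> (k, vertex \<eta>) \<in> U\<^sup>*
     else vertex \<xi> \<notin> K \<and> (vertex \<xi>, vertex \<eta>) \<in> (U \<inter> (- K) \<times> (- K))\<^sup>*}"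

text \<open>Passing an arrow \<open>a\<close> to \<open>b\<close> in either direction: its tail is
  seen at \<open>Var a\<close>, its head at \<open>Res b\<close>.\<close>

definition cross :: "(nat \<times> nat) set \<Rightarrow> (node \<times> node) set" where
  "cross D = (\<lambda>(a, b). (Var a, Res b)) ` D \<union> (\<lambda>(a, b). (Res b, Var a)) ` D"

definition conn :: "(nat \<times> nat) set \<Rightarrow> (nat \<times> nat) set \<Rightarrow> nat set \<Rightarrow> (node \<times> node) set" where
  "conn U D K = sect U K O (cross D O sect U K)\<^sup>*"

lemma cross_iff:
  "(\<xi>, \<eta>) \<in> cross D \<longleftrightarrow> (\<exists>a b. (a, b) \<in> D \<and> (\<xi> = Var a \<and> \<eta> = Res b \<or> \<xi> = Res b \<and> \<eta> = Var a))"
  by (auto simp: cross_def)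

lemma conn_base: "(\<xi>, \<eta>) \<in> sect U K \<Longrightarrow> (\<xi>, \<eta>) \<in> conn U D K"
  unfolding conn_def by auto

lemma conn_step:
  "(\<xi>, \<rho>) \<in> conn U D K \<Longrightarrow> (\<rho>, \<zeta>) \<in> cross D \<Longrightarrow> (\<zeta>, \<eta>) \<in> sect U K \<Longrightarrow> (\<xi>, \<eta>) \<in> conn U D K"
  unfolding conn_def by (blast intro: rtrancl_into_rtrancl)

lemma conn_induct [consumes 1, case_names base step]:
  assumes "(\<xi>, \<eta>) \<in> conn U D K"
    and "\<And>\<eta>. (\<xi>, \<eta>) \<in> sect U K \<Longrightarrow> P \<eta>"
    and "\<And>\<rho> \<zeta> \<eta>. (\<xi>, \<rho>) \<in> conn U D K \<Longrightarrow> P \<rho> \<Longrightarrow> (\<rho>, \<zeta>) \<in> cross D \<Longrightarrow> (\<zeta>, \<eta>) \<in> sect U K \<Longrightarrow> P \<eta>"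
  shows "P \<eta>"
proof -
  obtain \<mu> where \<mu>: "(\<xi>, \<mu>) \<in> sect U K" "(\<mu>, \<eta>) \<in> (cross D O sect U K)\<^sup>*"
    using assms(1) unfolding conn_def by blast
  from \<mu>(2) have "(\<xi>, \<eta>) \<in> conn U D K \<and> P \<eta>"
  proof induction
    case base
    show ?case using \<mu>(1) assms(2) by (auto intro: conn_base)
  next
    case (step \<rho> \<eta>)
    then show ?case using assms(3) by (blast intro: conn_step)
  qed
  then show ?thesis ..
qed

lemma conn_trans:
  assumes "(\<xi>, \<rho>) \<in> conn U D K" "(\<rho>, \<zeta>) \<in> cross D" "(\<zeta>, \<eta>) \<in> conn U D K"
  shows "(\<xi>, \<eta>) \<in> conn U D K"
  using assms(3)
proof (induction rule: conn_induct)
  case (base \<eta>)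
  then show ?case by (rule conn_step[OF assms(1,2)])
next
  case (step \<rho> \<zeta> \<eta>)
  then show ?case by (blast intro: conn_step)
qed

lemma conn_cases:
  assumes "(\<xi>, \<eta>) \<in> conn U D K"
  obtains \<zeta> where "(\<zeta>, \<eta>) \<in> sect U K" "\<zeta> = \<xi> \<or> (\<exists>\<rho>. (\<xi>, \<rho>) \<in> conn U D K \<and> (\<rho>, \<zeta>) \<in> cross D)"
  using assms by (induction rule: conn_induct) blast+

text \<open>At the two ends of the route the labels stand in for the missing arrowheads. This keeps
  the condition meaningful for a piece of a route, so that routes can be cut and joined.\<close>

definition section_ok :: "(nat \<times> nat) set \<Rightarrow> nat set \<Rightarrow> node \<Rightarrow> nat list \<Rightarrow> node \<Rightarrow> nat \<Rightarrow> nat \<Rightarrow> bool" where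
  "section_ok D K \<xi> xs \<eta> a b \<longleftrightarrow>
     ((\<exists>i\<in>{a..b}. xs!i \<in> K) \<longleftrightarrow>
        (if a = 0 then is_res \<xi> else (xs!(a - 1), xs!a) \<in> D) \<and>
        (if Suc b = length xs then is_res \<eta> else (xs!Suc b, xs!b) \<in> D))"

definition active_route ::
  "(nat \<times> nat) set \<Rightarrow> (nat \<times> nat) set \<Rightarrow> nat set \<Rightarrow> node \<Rightarrow> nat list \<Rightarrow> node \<Rightarrow> bool" where
  "active_route U D K \<xi> xs \<eta> \<longleftrightarrow> is_route U D xs \<and> hd xs = vertex \<xi> \<and> last xs = vertex \<eta> \<and>
     (\<forall>a b. is_section U xs a b \<longrightarrow> section_ok D K \<xi> xs \<eta> a b)"

lemma separated_iff_active_route: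
  "separated U D I J K \<longleftrightarrow> \<not> (\<exists>i\<in>I. \<exists>j\<in>J. \<exists>xs. active_route U D K (Var i) xs (Var j))"
proof -
  have "superactive U D K xs \<longleftrightarrow> (\<forall>a b. is_section U xs a b \<longrightarrow> section_ok D K (Var i) xs (Var j) a b)"
    for xs i j
  proof -
    have coll: "collider_section D xs a b \<longleftrightarrow>
       (if a = 0 then is_res (Var i) else (xs!(a - 1), xs!a) \<in> D) \<and>
       (if Suc b = length xs then is_res (Var j) else (xs!Suc b, xs!b) \<in> D)"
      if "is_section U xs a b" for a b
      using that by (auto simp: collider_section_def is_section_def)
    have "(if collider_section D xs a b then \<exists>i\<in>{a..b}. xs!i \<in> K else \<forall>i\<in>{a..b}. xs!i \<notin> K) \<longleftrightarrow>
        section_ok D K (Var i) xs (Var j) a b" if "is_section U xs a b" for a b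
      unfolding section_ok_def coll[OF that, symmetric] by auto
    then show ?thesis unfolding superactive_def by blast
  qed
  then show ?thesis unfolding separated_def active_route_def by auto
qed

section \<open>Cutting and joining routes at arrows\<close>

lemma is_route_iff: "is_route U D xs \<longleftrightarrow> xs \<noteq> [] \<and> successively (adj U D) xs"
  by (simp add: is_route_def successively_conv_nth)

lemma active_route_single:
  assumes "ys \<noteq> []" "successively (\<lambda>a b. (a, b) \<in> U) ys"
  shows "active_route U D K \<xi> ys \<eta> \<longleftrightarrow> hd ys = vertex \<xi> \<and> last ys = vertex \<eta> \<and>
    (if is_res \<xi> \<and> is_res \<eta> then \<exists>k\<in>set ys. k \<in> K else \<forall>k\<in>set ys. k \<notin> K)"
proof -
  have nth: "(ys!i, ys!Suc i) \<in> U" if "Suc i < length ys" for i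
    using assms(2) that by (simp add: successively_conv_nth)
  have "is_route U D ys"
    using assms nth by (auto simp: is_route_def adj_def)
  moreover have "is_section U ys a b \<longleftrightarrow> a = 0 \<and> b = length ys - 1" for a b
  proof
    assume s: "is_section U ys a b"
    have "a = 0"
      using s nth[of "a - 1"] by (cases a) (auto simp: is_section_def)
    moreover have "Suc b = length ys"
      using s nth[of b] by (auto simp: is_section_def)
    ultimately show "a = 0 \<and> b = length ys - 1" by simp
  next
    assume "a = 0 \<and> b = length ys - 1"
    then show "is_section U ys a b" using assms(1) nth by (auto simp: is_section_def)
  qed
  moreover have "(\<exists>i\<in>{0..length ys - 1}. ys!i \<in> K) \<longleftrightarrow> (\<exists>k\<in>set ys. k \<in> K)"
  proof -
    have "{0..length ys - 1} = {i. i < length ys}" using assms(1) by (cases ys) auto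
    then show ?thesis by (simp add: in_set_conv_nth Bex_def) blast
  qed
  ultimately show ?thesis
    using assms(1) unfolding active_route_def section_ok_def by auto
qed

text \<open>No section straddles a junction that is not an undirected edge, so the sections of the
  concatenation are those of the two pieces.\<close>

lemma is_section_append:
  assumes "xs \<noteq> []" "ys \<noteq> []" "(last xs, hd ys) \<notin> U"
  shows "is_section U (xs @ ys) a b \<longleftrightarrow> b < length xs \<and> is_section U xs a b \<or>
    (\<exists>a' b'. a = length xs + a' \<and> b = length xs + b' \<and> is_section U ys a' b')"
proof -
  let ?n = "length xs"
  have n: "?n > 0" "length ys > 0" using assms by auto
  have L: "(xs @ ys)!i = xs!i" if "i < ?n" for i using that by (simp add: nth_append)
  have R: "(xs @ ys)!(?n + i) = ys!i" for i by (simp add: nth_append)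
  have junction: "((xs @ ys)!(?n - 1), (xs @ ys)!?n) \<notin> U"
    using assms n by (simp add: nth_append last_conv_nth hd_conv_nth)
  consider "b < ?n" | "a < ?n" "?n \<le> b" | "?n \<le> a" by linarith
  then show ?thesis
  proof cases
    case 1
    have j: "((xs @ ys)!b, (xs @ ys)!Suc b) \<notin> U" if "Suc b = ?n"
      using junction that by (metis diff_Suc_1)
    have mid: "(\<forall>i. a \<le> i \<and> i < b \<longrightarrow> ((xs @ ys)!i, (xs @ ys)!Suc i) \<in> U) \<longleftrightarrow>
        (\<forall>i. a \<le> i \<and> i < b \<longrightarrow> (xs!i, xs!Suc i) \<in> U)"
      using 1 by (intro all_cong1 imp_cong refl) (simp add: L)
    have left: "((xs @ ys)!(a - 1), (xs @ ys)!a) = (xs!(a - 1), xs!a)" if "a \<le> b"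
      using that 1 by (simp add: L)
    have right: "Suc b = length (xs @ ys) \<or> ((xs @ ys)!b, (xs @ ys)!Suc b) \<notin> U \<longleftrightarrow>
        Suc b = ?n \<or> (xs!b, xs!Suc b) \<notin> U"
    proof (cases "Suc b = ?n")
      case True
      then show ?thesis using j by simp
    next
      case False
      then show ?thesis using 1 by (simp add: L)
    qed
    show ?thesis
      unfolding is_section_def[of U "xs @ ys"] mid right using 1 left
      by (auto simp: is_section_def)
  next
    case 2
    have "\<not> is_section U (xs @ ys) a b"
    proof
      assume "is_section U (xs @ ys) a b"
      moreover have "a \<le> ?n - 1 \<and> ?n - 1 < b" using 2 n by linarith
      ultimately have "((xs @ ys)!(?n - 1), (xs @ ys)!Suc (?n - 1)) \<in> U"
        unfolding is_section_def by blast
      then show False using junction n by simp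
    qed
    then show ?thesis using 2 by auto
  next
    case 3
    then obtain a' where a: "a = ?n + a'" using le_Suc_ex by blast
    have sec: "is_section U (xs @ ys) a (?n + b') \<longleftrightarrow> is_section U ys a' b'" for b'
    proof -
      have mid: "(\<forall>i. a \<le> i \<and> i < ?n + b' \<longrightarrow> ((xs @ ys)!i, (xs @ ys)!Suc i) \<in> U) \<longleftrightarrow>
        (\<forall>i. a' \<le> i \<and> i < b' \<longrightarrow> (ys!i, ys!Suc i) \<in> U)"
      proof safe
        fix i assume *: "\<forall>i. a \<le> i \<and> i < ?n + b' \<longrightarrow> ((xs @ ys)!i, (xs @ ys)!Suc i) \<in> U" and i: "a' \<le> i" "i < b'"
        have "a \<le> ?n + i \<and> ?n + i < ?n + b'" using i a by simp
        with * have "((xs @ ys)!(?n + i), (xs @ ys)!Suc (?n + i)) \<in> U" by blast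
        then show "(ys!i, ys!Suc i) \<in> U" using R[of i] R[of "Suc i"] by (simp only: add_Suc_right)
      next
        fix i assume *: "\<forall>i. a' \<le> i \<and> i < b' \<longrightarrow> (ys!i, ys!Suc i) \<in> U" and i: "a \<le> i" "i < ?n + b'"
        then obtain i' where i': "i = ?n + i'" using a le_Suc_ex[of ?n i] by auto
        then have "(ys!i', ys!Suc i') \<in> U" using * i a by simp
        then show "((xs @ ys)!i, (xs @ ys)!Suc i) \<in> U"
          unfolding i' using R[of i'] R[of "Suc i'"] by (simp only: add_Suc_right)
      qed
      have left: "(a = 0 \<or> ((xs @ ys)!(a - 1), (xs @ ys)!a) \<notin> U) \<longleftrightarrow> (a' = 0 \<or> (ys!(a' - 1), ys!a') \<notin> U)"
      proof (cases a')
        case 0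
        then show ?thesis using junction a by simp
      next
        case (Suc k)
        then show ?thesis using a R[of k] R[of a'] by simp
      qed
      have right: "((xs @ ys)!(?n + b'), (xs @ ys)!Suc (?n + b')) = (ys!b', ys!Suc b')"
        using R[of b'] R[of "Suc b'"] by simp
      show ?thesis unfolding is_section_def mid left right using a by simp
    qed
    show ?thesis
    proof
      assume s: "is_section U (xs @ ys) a b"
      then have "?n \<le> b" using 3 unfolding is_section_def by linarith
      then obtain b' where "b = ?n + b'" using le_Suc_ex by blast
      then show "b < ?n \<and> is_section U xs a b \<or>
          (\<exists>a' b'. a = ?n + a' \<and> b = ?n + b' \<and> is_section U ys a' b')"
        using s sec a by blast
    next
      assume r: "b < ?n \<and> is_section U xs a b \<or>
          (\<exists>a' b'. a = ?n + a' \<and> b = ?n + b' \<and> is_section U ys a' b')"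
      have "\<not> (b < ?n \<and> is_section U xs a b)" using 3 unfolding is_section_def by linarith
      with r obtain a'' b' where "a = ?n + a''" "b = ?n + b'" "is_section U ys a'' b'" by blast
      then show "is_section U (xs @ ys) a b" using a sec by simp
    qed
  qed
qed

text \<open>The labels \<open>\<rho>\<close> and \<open>\<zeta>\<close> at the cut record which end
  of the severed arrow each piece used to see, so the condition on every section is
  unchanged.\<close>

lemma active_route_append:
  assumes cg: "chain_graph N U D" and ne: "xs \<noteq> []" "ys \<noteq> []" and x: "(\<rho>, \<zeta>) \<in> cross D"
    and ends: "last xs = vertex \<rho>" "hd ys = vertex \<zeta>"
  shows "active_route U D K \<xi> (xs @ ys) \<eta> \<longleftrightarrow> active_route U D K \<xi> xs \<rho> \<and> active_route U D K \<zeta> ys \<eta>"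
proof -
  let ?n = "length xs"
  obtain a0 b0 where e: "(a0, b0) \<in> D" "\<rho> = Var a0 \<and> \<zeta> = Res b0 \<or> \<rho> = Res b0 \<and> \<zeta> = Var a0"
    using x by (auto simp: cross_iff)
  have nU: "(last xs, hd ys) \<notin> U" and adj: "adj U D (last xs) (hd ys)"
    using e ends chain_graphD(5,6)[OF cg] by (auto simp: adj_def)
  \<comment> \<open>Since \<open>D\<close> has no two opposite arrows, the labels determine the
    direction of the severed arrow.\<close>
  have hd: "(last xs, hd ys) \<in> D \<longleftrightarrow> is_res \<zeta>" "(hd ys, last xs) \<in> D \<longleftrightarrow> is_res \<rho>"
    using e ends chain_graphD(4)[OF cg] by auto
  have last_nth: "xs!(?n - 1) = last xs" "ys!0 = hd ys" using ne by (auto simp: last_conv_nth hd_conv_nth)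
  have lens: "?n > 0" "length ys > 0" using ne by auto
  have L: "(xs @ ys)!i = xs!i" if "i < ?n" for i using that by (simp add: nth_append)
  have R: "(xs @ ys)!(?n + i) = ys!i" for i by (simp add: nth_append)
  have ok1: "section_ok D K \<xi> (xs @ ys) \<eta> a b \<longleftrightarrow> section_ok D K \<xi> xs \<rho> a b" if s: "b < ?n" "is_section U xs a b" for a b
  proof -
    have ab: "a \<le> b" using s by (simp add: is_section_def)
    have "(if Suc b = length (xs @ ys) then is_res \<eta> else ((xs @ ys)!Suc b, (xs @ ys)!b) \<in> D) \<longleftrightarrow>
        (if Suc b = ?n then is_res \<rho> else (xs!Suc b, xs!b) \<in> D)"
    proof (cases "Suc b = ?n")
      case True
      then have "(xs @ ys)!Suc b = hd ys" "(xs @ ys)!b = last xs"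
        using R[of 0] L[of b] last_nth True[symmetric] by auto
      then show ?thesis using True lens hd by simp
    next
      case False
      then show ?thesis using s(1) lens by (simp add: L)
    qed
    moreover have "(\<exists>i\<in>{a..b}. (xs @ ys)!i \<in> K) \<longleftrightarrow> (\<exists>i\<in>{a..b}. xs!i \<in> K)"
      using s(1) by (intro bex_cong refl) (simp add: L)
    moreover have "(xs @ ys)!(a - 1) = xs!(a - 1)" "(xs @ ys)!a = xs!a" using ab s(1) by (simp_all add: L)
    ultimately show ?thesis unfolding section_ok_def by (simp only:)
  qed
  have ok2: "section_ok D K \<xi> (xs @ ys) \<eta> (?n + a) (?n + b) \<longleftrightarrow> section_ok D K \<zeta> ys \<eta> a b" for a b
  proof -
    have "(if ?n + a = 0 then is_res \<xi> else ((xs @ ys)!(?n + a - 1), (xs @ ys)!(?n + a)) \<in> D) \<longleftrightarrow>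
        (if a = 0 then is_res \<zeta> else (ys!(a - 1), ys!a) \<in> D)"
    proof (cases a)
      case 0
      then show ?thesis using L[of "?n - 1"] R[of 0] last_nth hd lens by simp
    next
      case (Suc k)
      then show ?thesis using R[of k] R[of a] by simp
    qed
    moreover have "(\<exists>i\<in>{?n + a..?n + b}. (xs @ ys)!i \<in> K) \<longleftrightarrow> (\<exists>i\<in>{a..b}. ys!i \<in> K)"
    proof -
      have "{?n + a..?n + b} = (+) ?n ` {a..b}"
        using image_add_atLeastAtMost[of ?n a b] by (simp add: add.commute)
      then show ?thesis by (simp only: bex_simps R)
    qed
    moreover have "(if Suc (?n + b) = length (xs @ ys) then is_res \<eta> else ((xs @ ys)!Suc (?n + b), (xs @ ys)!(?n + b)) \<in> D) \<longleftrightarrow>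
        (if Suc b = length ys then is_res \<eta> else (ys!Suc b, ys!b) \<in> D)"
      using R[of b] R[of "Suc b"] by simp
    ultimately show ?thesis unfolding section_ok_def by (simp only:)
  qed
  have secs: "(\<forall>a b. is_section U (xs @ ys) a b \<longrightarrow> section_ok D K \<xi> (xs @ ys) \<eta> a b) \<longleftrightarrow>
     (\<forall>a b. is_section U xs a b \<longrightarrow> section_ok D K \<xi> xs \<rho> a b) \<and>
     (\<forall>a b. is_section U ys a b \<longrightarrow> section_ok D K \<zeta> ys \<eta> a b)"
    (is "?l \<longleftrightarrow> ?r1 \<and> ?r2")
  proof (intro iffI conjI allI impI)
    fix a b assume l: ?l and s: "is_section U xs a b"
    have b: "b < ?n" using s by (simp add: is_section_def)
    then show "section_ok D K \<xi> xs \<rho> a b"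
      using l s ok1[OF b s] is_section_append[OF ne nU] by blast
  next
    fix a b assume l: ?l and s: "is_section U ys a b"
    then show "section_ok D K \<zeta> ys \<eta> a b"
      using l ok2 is_section_append[OF ne nU] by blast
  next
    fix a b assume r: "?r1 \<and> ?r2" and "is_section U (xs @ ys) a b"
    then show "section_ok D K \<xi> (xs @ ys) \<eta> a b"
      unfolding is_section_append[OF ne nU] using ok1 ok2 by blast
  qed
  have "is_route U D (xs @ ys) \<longleftrightarrow> is_route U D xs \<and> is_route U D ys"
    using ne adj by (auto simp: is_route_iff successively_append_iff)
  then show ?thesis
    unfolding active_route_def secs using ne ends by auto
qed

lemma sect_iff_walk:
  "(\<xi>, \<eta>) \<in> sect U K \<longleftrightarrow> (\<exists>ys. ys \<noteq> [] \<and> successively (\<lambda>a b. (a, b) \<in> U) ys \<and>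
     hd ys = vertex \<xi> \<and> last ys = vertex \<eta> \<and>
     (if is_res \<xi> \<and> is_res \<eta> then \<exists>k\<in>set ys. k \<in> K else \<forall>k\<in>set ys. k \<notin> K))"
proof (cases "is_res \<xi> \<and> is_res \<eta>")
  case True
  show ?thesis
  proof
    assume "(\<xi>, \<eta>) \<in> sect U K"
    then obtain k where k: "k \<in> K" "(vertex \<xi>, k) \<in> U\<^sup>*" "(k, vertex \<eta>) \<in> U\<^sup>*"
      using True by (auto simp: sect_def)
    obtain xs where xs: "xs \<noteq> []" "successively (\<lambda>a b. (a, b) \<in> U) xs" "hd xs = vertex \<xi>" "last xs = k"
      using k(2) unfolding rtrancl_iff_successively by blast
    obtain ys where ys: "ys \<noteq> []" "successively (\<lambda>a b. (a, b) \<in> U) ys" "hd ys = k" "last ys = vertex \<eta>"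
      using k(3) unfolding rtrancl_iff_successively by blast
    have "successively (\<lambda>a b. (a, b) \<in> U) (xs @ tl ys)"
      using xs ys by (cases ys) (auto simp: successively_append_iff successively_Cons)
    moreover have "last (xs @ tl ys) = vertex \<eta>" using xs ys by (cases ys) (auto simp: last_append)
    moreover have "k \<in> set (xs @ tl ys)" using xs by auto
    ultimately show "\<exists>ys. ys \<noteq> [] \<and> successively (\<lambda>a b. (a, b) \<in> U) ys \<and>
     hd ys = vertex \<xi> \<and> last ys = vertex \<eta> \<and>
     (if is_res \<xi> \<and> is_res \<eta> then \<exists>k\<in>set ys. k \<in> K else \<forall>k\<in>set ys. k \<notin> K)"
      using True xs k(1) by (intro exI[of _ "xs @ tl ys"]) auto
  next
    assume "\<exists>ys. ys \<noteq> [] \<and> successively (\<lambda>a b. (a, b) \<in> U) ys \<and>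
     hd ys = vertex \<xi> \<and> last ys = vertex \<eta> \<and>
     (if is_res \<xi> \<and> is_res \<eta> then \<exists>k\<in>set ys. k \<in> K else \<forall>k\<in>set ys. k \<notin> K)"
    then obtain ys k where ys: "successively (\<lambda>a b. (a, b) \<in> U) ys" "hd ys = vertex \<xi>"
      "last ys = vertex \<eta>" "k \<in> set ys" "k \<in> K" using True by auto
    obtain ps qs where "ys = ps @ k # qs" using split_list[OF ys(4)] by blast
    then have pq: "ys = (ps @ [k]) @ qs" "ys = ps @ (k # qs)" by auto
    have "successively (\<lambda>a b. (a, b) \<in> U) ((ps @ [k]) @ qs)" "successively (\<lambda>a b. (a, b) \<in> U) (ps @ (k # qs))"
      using ys(1) pq by simp_all
    then have "successively (\<lambda>a b. (a, b) \<in> U) (ps @ [k])" "successively (\<lambda>a b. (a, b) \<in> U) (k # qs)"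
      unfolding successively_append_iff by blast+
    moreover have "hd (ps @ [k]) = vertex \<xi>" using ys(2) pq(2) by (cases ps) auto
    moreover have "last (k # qs) = vertex \<eta>" using ys(3) pq(2) by auto
    moreover have "ps @ [k] \<noteq> []" "last (ps @ [k]) = k" "k # qs \<noteq> []" "hd (k # qs) = k" by auto
    ultimately have "(vertex \<xi>, k) \<in> U\<^sup>*" "(k, vertex \<eta>) \<in> U\<^sup>*"
      unfolding rtrancl_iff_successively by blast+
    then show "(\<xi>, \<eta>) \<in> sect U K" using True ys(5) by (auto simp: sect_def)
  qed
next
  case False
  have walk: "successively (\<lambda>a b. (a, b) \<in> U \<inter> (- K) \<times> (- K)) ys \<and> hd ys \<notin> K \<longleftrightarrow>
      successively (\<lambda>a b. (a, b) \<in> U) ys \<and> (\<forall>k\<in>set ys. k \<notin> K)" if "ys \<noteq> []" for ys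
    using that
  proof (induction ys)
    case (Cons a ys)
    then show ?case by (cases ys) auto
  qed simp
  have "(\<xi>, \<eta>) \<in> sect U K \<longleftrightarrow> (\<exists>ys. ys \<noteq> [] \<and>
      (successively (\<lambda>a b. (a, b) \<in> U \<inter> (- K) \<times> (- K)) ys \<and> hd ys \<notin> K) \<and> hd ys = vertex \<xi> \<and> last ys = vertex \<eta>)"
    using False unfolding sect_def rtrancl_iff_successively by auto
  also have "\<dots> \<longleftrightarrow> (\<exists>ys. ys \<noteq> [] \<and> successively (\<lambda>a b. (a, b) \<in> U) ys \<and>
     hd ys = vertex \<xi> \<and> last ys = vertex \<eta> \<and> (\<forall>k\<in>set ys. k \<notin> K))"
  proof (rule ex_cong1)
    fix ys
    show "ys \<noteq> [] \<and> (successively (\<lambda>a b. (a, b) \<in> U \<inter> (- K) \<times> (- K)) ys \<and> hd ys \<notin> K) \<and>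
        hd ys = vertex \<xi> \<and> last ys = vertex \<eta> \<longleftrightarrow>
      ys \<noteq> [] \<and> successively (\<lambda>a b. (a, b) \<in> U) ys \<and> hd ys = vertex \<xi> \<and> last ys = vertex \<eta> \<and>
        (\<forall>k\<in>set ys. k \<notin> K)"
      using walk[of ys] by argo
  qed
  finally show ?thesis unfolding if_not_P[OF False] .
qed

text \<open>From routes to \<open>conn\<close>: cut at any step that is not undirected. Both pieces
  are shorter, and \<open>conn_trans\<close> joins what the induction gives for them.\<close>

lemma ex_active_route_iff_conn:
  assumes cg: "chain_graph N U D"
  shows "(\<exists>xs. active_route U D K \<xi> xs \<eta>) \<longleftrightarrow> (\<xi>, \<eta>) \<in> conn U D K"
proof
  assume "(\<xi>, \<eta>) \<in> conn U D K"
  then show "\<exists>xs. active_route U D K \<xi> xs \<eta>"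
  proof (induction rule: conn_induct)
    case (base \<eta>)
    then show ?case unfolding sect_iff_walk using active_route_single by blast
  next
    case (step \<rho> \<zeta> \<eta>)
    then obtain xs where xs: "active_route U D K \<xi> xs \<rho>" by blast
    obtain ys where ys: "ys \<noteq> []" "active_route U D K \<zeta> ys \<eta>"
      using step.hyps(3) unfolding sect_iff_walk using active_route_single by blast
    have "active_route U D K \<xi> (xs @ ys) \<eta>"
    proof -
      have "xs \<noteq> []" "last xs = vertex \<rho>" "hd ys = vertex \<zeta>"
        using xs ys by (auto simp: active_route_def is_route_def)
      from active_route_append[OF cg this(1) ys(1) step.hyps(2) this(2,3)] xs ys(2)
      show ?thesis by blast
    qed
    then show ?case ..
  qed
next
  have "(\<xi>, \<eta>) \<in> conn U D K" if "active_route U D K \<xi> xs \<eta>" for xs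
    using that
  proof (induction "length xs" arbitrary: xs \<xi> \<eta> rule: less_induct)
    case less
    have route: "xs \<noteq> []" "\<And>i. Suc i < length xs \<Longrightarrow> adj U D (xs!i) (xs!Suc i)"
      and ends: "hd xs = vertex \<xi>" "last xs = vertex \<eta>"
      using less.prems by (auto simp: active_route_def is_route_def)
    show ?case
    proof (cases "successively (\<lambda>a b. (a, b) \<in> U) xs")
      case True
      then show ?thesis
        using less.prems active_route_single[OF route(1) True] route(1) sect_iff_walk
        by (intro conn_base) blast
    next
      case False
      then obtain i where i: "Suc i < length xs" "(xs!i, xs!Suc i) \<notin> U"
        by (auto simp: successively_conv_nth)
      let ?xs = "take (Suc i) xs" and ?ys = "drop (Suc i) xs"
      have ne: "?xs \<noteq> []" "?ys \<noteq> []" using i route(1) by auto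
      have lh: "last ?xs = xs!i" "hd ?ys = xs!Suc i"
        using i ne by (auto simp: last_conv_nth hd_drop_conv_nth min_def)
      obtain \<rho> \<zeta> where x: "(\<rho>, \<zeta>) \<in> cross D" "last ?xs = vertex \<rho>" "hd ?ys = vertex \<zeta>"
      proof (cases "(xs!i, xs!Suc i) \<in> D")
        case True
        then show thesis using that[of "Var (xs!i)" "Res (xs!Suc i)"] lh by (auto simp: cross_iff)
      next
        case False
        then have "(xs!Suc i, xs!i) \<in> D" using route(2)[OF i(1)] i(2) by (auto simp: adj_def)
        then show thesis using that[of "Res (xs!i)" "Var (xs!Suc i)"] lh by (auto simp: cross_iff)
      qed
      have "active_route U D K \<xi> (?xs @ ?ys) \<eta>" using less.prems by simp
      then have "active_route U D K \<xi> ?xs \<rho>" "active_route U D K \<zeta> ?ys \<eta>"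
        using active_route_append[OF cg ne x] by blast+
      moreover have "length ?xs < length xs" "length ?ys < length xs" using i by auto
      ultimately have "(\<xi>, \<rho>) \<in> conn U D K" "(\<zeta>, \<eta>) \<in> conn U D K" using less.hyps by blast+
      then show ?thesis using x(1) conn_trans by blast
    qed
  qed
  then show "\<exists>xs. active_route U D K \<xi> xs \<eta> \<Longrightarrow> (\<xi>, \<eta>) \<in> conn U D K" by blast
qed

lemma separated_iff_conn:
  assumes "chain_graph N U D"
  shows "separated U D I J K \<longleftrightarrow> \<not> (\<exists>i\<in>I. \<exists>j\<in>J. (Var i, Var j) \<in> conn U D K)"
  unfolding separated_iff_active_route ex_active_route_iff_conn[OF assms] ..

text \<open>Undirected edges count too. The size of this set serves as rank: it is constant on
  components and grows strictly along arrows, in place of a numbering of the components.\<close>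

definition ancestors :: "(nat \<times> nat) set \<Rightarrow> (nat \<times> nat) set \<Rightarrow> nat \<Rightarrow> nat set" where
  "ancestors U D v = {w. (w, v) \<in> (U \<union> D)\<^sup>*}"

lemma finite_ancestors:
  assumes "chain_graph N U D"
  shows "finite (ancestors U D v)"
proof -
  have "ancestors U D v \<subseteq> insert v (verts N)"
    using chain_graphD(1,2)[OF assms] by (auto simp: ancestors_def elim: converse_rtranclE)
  then show ?thesis using finite_subset finite_verts by blast
qed

lemma no_descending_cycle:
  assumes "chain_graph N U D" "(a, b) \<in> D"
  shows "(b, a) \<notin> (U \<union> D)\<^sup>*"
proof
  assume "(b, a) \<in> (U \<union> D)\<^sup>*"
  then obtain ys where ys: "ys \<noteq> []" "successively (\<lambda>a b. (a, b) \<in> U \<union> D) ys" "hd ys = b" "last ys = a"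
    unfolding rtrancl_iff_successively by blast
  have succ: "successively (\<lambda>a b. (a, b) \<in> U \<union> D) (ys @ [b])"
    using ys assms(2) by (simp add: successively_append_iff)
  have "directed_pseudocycle U D (ys @ [b])"
    unfolding directed_pseudocycle_def
  proof (intro conjI)
    show "2 \<le> length (ys @ [b])" using ys(1) by (cases ys) auto
    show "hd (ys @ [b]) = last (ys @ [b])" using ys by simp
    show "\<forall>i. Suc i < length (ys @ [b]) \<longrightarrow>
        ((ys @ [b])!i, (ys @ [b])!Suc i) \<in> U \<or> ((ys @ [b])!i, (ys @ [b])!Suc i) \<in> D"
      using succ unfolding successively_conv_nth by blast
    have "Suc (length ys - 1) = length ys" using ys(1) by simp
    then show "\<exists>i. Suc i < length (ys @ [b]) \<and> ((ys @ [b])!i, (ys @ [b])!Suc i) \<in> D"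
      using ys assms(2) by (intro exI[of _ "length ys - 1"]) (auto simp: nth_append last_conv_nth)
  qed
  then show False using assms(1) unfolding chain_graph_def by blast
qed

lemma card_ancestors:
  assumes cg: "chain_graph N U D"
  shows card_ancestors_U: "(a, b) \<in> U \<Longrightarrow> card (ancestors U D a) = card (ancestors U D b)"
    and card_ancestors_D: "(a, b) \<in> D \<Longrightarrow> card (ancestors U D a) < card (ancestors U D b)"
proof -
  assume "(a, b) \<in> U"
  then have "(a, b) \<in> U \<union> D" "(b, a) \<in> U \<union> D" using chain_graphD(3)[OF cg] by auto
  then have "ancestors U D a = ancestors U D b"
    unfolding ancestors_def by (auto intro: rtrancl_into_rtrancl)
  then show "card (ancestors U D a) = card (ancestors U D b)" by simp
next
  assume D: "(a, b) \<in> D"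
  have "ancestors U D a \<subseteq> ancestors U D b"
    using D unfolding ancestors_def by (auto intro: rtrancl_into_rtrancl)
  moreover have "b \<in> ancestors U D b" "b \<notin> ancestors U D a"
    using no_descending_cycle[OF cg D] by (auto simp: ancestors_def)
  ultimately have "ancestors U D a \<subset> ancestors U D b" by blast
  then show "card (ancestors U D a) < card (ancestors U D b)"
    using finite_ancestors[OF cg] by (intro psubset_card_mono)
qed

section \<open>The global Markov property\<close>

lemma sect_Var: "(\<zeta>, Var v) \<in> sect U K \<longleftrightarrow> vertex \<zeta> \<notin> K \<and> (vertex \<zeta>, v) \<in> (U \<inter> (- K) \<times> (- K))\<^sup>*"
  by (simp add: sect_def)

lemma Var_sect: "(Var v, \<zeta>) \<in> sect U K \<longleftrightarrow> v \<notin> K \<and> (v, vertex \<zeta>) \<in> (U \<inter> (- K) \<times> (- K))\<^sup>*"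
  by (simp add: sect_def)

lemma Res_sect_Res: "(Res a, Res b) \<in> sect U K \<longleftrightarrow> (\<exists>k\<in>K. (a, k) \<in> U\<^sup>* \<and> (k, b) \<in> U\<^sup>*)"
  by (simp add: sect_def)

lemma avoiding_walk_end: "(u, v) \<in> (U \<inter> (- K) \<times> (- K))\<^sup>* \<Longrightarrow> u \<notin> K \<Longrightarrow> v \<notin> K"
  by (induction rule: rtrancl_induct) auto

lemma sect_Var_notin: "(\<zeta>, Var v) \<in> sect U K \<Longrightarrow> v \<notin> K"
  by (auto simp: sect_Var dest: avoiding_walk_end)

lemma conn_Var_notin: "(\<xi>, Var v) \<in> conn U D K \<Longrightarrow> v \<notin> K"
  by (erule conn_cases) (rule sect_Var_notin)

text \<open>A walk that starts below an arrowhead either has avoided \<open>K\<close> so far or has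
  met it, and then it can end in an arrowhead as a collider section. Hence a component entered from
  above is reached at each of its vertices in at least one of the two forms.\<close>

lemma sect_dichotomy:
  assumes "(b, v) \<in> U\<^sup>*"
  shows "(Res b, Var v) \<in> sect U K \<or> (Res b, Res v) \<in> sect U K"
  using assms
proof (induction rule: rtrancl_induct)
  case base
  show ?case by (cases "b \<in> K") (auto simp: sect_Var Res_sect_Res)
next
  case (step v w)
  show ?case
  proof (cases "w \<in> K")
    case True
    then show ?thesis using step.hyps by (auto simp: Res_sect_Res intro: rtrancl_into_rtrancl)
  next
    case False
    from step.IH show ?thesis
    proof
      assume s: "(Res b, Var v) \<in> sect U K"
      then have "v \<notin> K" by (rule sect_Var_notin)
      then show ?thesis using s step.hyps(2) False
        by (auto simp: sect_Var intro: rtrancl_into_rtrancl)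
    next
      assume "(Res b, Res v) \<in> sect U K"
      then show ?thesis using step.hyps(2) by (auto simp: Res_sect_Res intro: rtrancl_into_rtrancl)
    qed
  qed
qed

text \<open>In the application \<open>x\<close> lists the covariances of all variables with a
  combination of those in \<open>J\<close> and \<open>K\<close> that is uncorrelated with
  \<open>K\<close>. The conclusion is that it is uncorrelated with \<open>I\<close>, which is
  conditional independence without densities.\<close>

lemma separation_zero:
  assumes cg: "chain_graph N U D" and pd: "pd_on (verts N) M"
    and M: "\<And>v w. v \<in> verts N \<Longrightarrow> w \<in> verts N \<Longrightarrow> M v w \<noteq> 0 \<Longrightarrow> v = w \<or> (v, w) \<in> U"
    and E: "\<And>v w. v \<in> verts N \<Longrightarrow> w \<in> verts N \<Longrightarrow> E v w \<noteq> 0 \<Longrightarrow> (w, v) \<in> D"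
    and sub: "I \<subseteq> verts N" "J \<subseteq> verts N" "K \<subseteq> verts N" and IK: "I \<inter> K = {}"
    and sep: "\<And>i j. i \<in> I \<Longrightarrow> j \<in> J \<Longrightarrow> (Var i, Var j) \<notin> conn U D K"
    and g: "\<And>v. v \<in> verts N \<Longrightarrow> g v \<noteq> 0 \<Longrightarrow> v \<in> J \<union> K"
    and eq1: "\<And>v. v \<in> verts N \<Longrightarrow> mvec (verts N) M x v + mvec (verts N) E x v = mvec (verts N) M y v"
    and eq2: "\<And>v. v \<in> verts N \<Longrightarrow> mvec (verts N) M y v + mvec (verts N) (\<lambda>v w. E w v) y v = g v"
    and xK: "\<And>v. v \<in> K \<Longrightarrow> x v = 0"
    and i: "i \<in> I"
  shows "x i = 0"
proof -
  let ?V = "verts N"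
  \<comment> \<open>\<open>c\<close>: reached from \<open>I\<close>. \<open>entry\<close>: possible
    beginnings of a section on such a route. \<open>h\<close>: the component of \<open>v\<close>
    receives an arrow whose tail is reached. \<open>T\<close>: the anterior set of the
    overview.\<close>
  define c where "c \<eta> \<longleftrightarrow> (\<exists>i\<in>I. (Var i, \<eta>) \<in> conn U D K)" for \<eta>
  define entry where "entry \<zeta> \<longleftrightarrow> \<zeta> \<in> Var ` I \<or> (\<exists>\<rho>. c \<rho> \<and> (\<rho>, \<zeta>) \<in> cross D)" for \<zeta>
  define h where "h v \<longleftrightarrow> (\<exists>a b. c (Var a) \<and> (a, b) \<in> D \<and> (b, v) \<in> U\<^sup>*)" for v
  define T where "T = {v \<in> ?V. \<exists>t\<in>I \<union> J \<union> K. (v, t) \<in> (U \<union> D)\<^sup>*}"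
  have c_iff: "c \<eta> \<longleftrightarrow> (\<exists>\<zeta>. entry \<zeta> \<and> (\<zeta>, \<eta>) \<in> sect U K)" for \<eta>
  proof
    assume "c \<eta>"
    then obtain i where i: "i \<in> I" "(Var i, \<eta>) \<in> conn U D K" by (auto simp: c_def)
    from i(2) show "\<exists>\<zeta>. entry \<zeta> \<and> (\<zeta>, \<eta>) \<in> sect U K"
      by (rule conn_cases) (use i(1) in \<open>auto simp: entry_def c_def\<close>)
  next
    assume "\<exists>\<zeta>. entry \<zeta> \<and> (\<zeta>, \<eta>) \<in> sect U K"
    then show "c \<eta>" unfolding entry_def c_def by (blast intro: conn_base conn_step)
  qed
  have c_I: "c \<eta>" if "entry \<zeta>" "(\<zeta>, \<eta>) \<in> sect U K" for \<zeta> \<eta>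
    using that unfolding c_iff[of \<eta>] by blast
  have c_E: "\<exists>\<zeta>. entry \<zeta> \<and> (\<zeta>, \<eta>) \<in> sect U K" if "c \<eta>" for \<eta>
    using that unfolding c_iff[of \<eta>] .
  have c_notin: "v \<notin> K" if "c (Var v)" for v using that conn_Var_notin by (auto simp: c_def)
  have c_start: "c (Var i)" "c (Res i)" if "i \<in> I" for i
  proof -
    have "(Var i, Var i) \<in> sect U K" "(Var i, Res i) \<in> sect U K" using that IK by (auto simp: Var_sect)
    moreover have "entry (Var i)" using that by (simp add: entry_def)
    ultimately show "c (Var i)" "c (Res i)" by (blast intro: c_I)+
  qed
  have c_down: "c \<eta>" if "c (Var a)" "(a, b) \<in> D" "(Res b, \<eta>) \<in> sect U K" for a b \<eta>
  proof -
    have "(Var a, Res b) \<in> cross D" using that(2) by (auto simp: cross_iff)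
    then have "entry (Res b)" using that(1) unfolding entry_def by blast
    then show ?thesis using that(3) by (rule c_I)
  qed
  have c_up: "c \<eta>" if "c (Res b)" "(a, b) \<in> D" "(Var a, \<eta>) \<in> sect U K" for a b \<eta>
  proof -
    have "(Res b, Var a) \<in> cross D" using that(2) by (auto simp: cross_iff)
    then have "entry (Var a)" using that(1) unfolding entry_def by blast
    then show ?thesis using that(3) by (rule c_I)
  qed
  have c_up': "c (Var a)" if "c (Res b)" "(a, b) \<in> D" "a \<notin> K" for a b
    using c_up[OF that(1,2), of "Var a"] that(3) by (simp add: Var_sect)
  have c_U: "c (Var w)" if "c (Var v)" "(v, w) \<in> U" "w \<notin> K" for v w
  proof -
    from c_E[OF that(1)] obtain \<zeta> where \<zeta>: "entry \<zeta>" "(\<zeta>, Var v) \<in> sect U K" by blast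
    then have "(\<zeta>, Var w) \<in> sect U K"
      using that(2,3) sect_Var_notin[OF \<zeta>(2)] by (auto simp: sect_Var intro: rtrancl_into_rtrancl)
    with \<zeta>(1) show ?thesis by (rule c_I)
  qed
  have h_D: "h w" if "c (Var v)" "(v, w) \<in> D" for v w using that unfolding h_def by blast
  have h_U: "h w" if "h v" "(v, w) \<in> U" for v w
    using that unfolding h_def by (blast intro: rtrancl_into_rtrancl)
  have h_cases: "c (Var v) \<or> c (Res v)" if "h v" for v
    using that sect_dichotomy c_down unfolding h_def by blast
  \<comment> \<open>Induction along a path down to \<open>t\<close>. At \<open>t\<close> in
    \<open>J\<close> or \<open>K\<close> the index \<open>Var t\<close> is not reached, so the
    dichotomy leaves \<open>Res t\<close>. Further up, if \<open>Res v\<close> were not reached,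
    then \<open>Var v\<close> would be, outside \<open>K\<close>; one step down, the induction
    hypothesis provides an arrowhead \<open>Res w\<close>, from which the route turns back to
    \<open>Res v\<close>.\<close>
  have h_c: "h v \<longrightarrow> c (Res v)" if "(v, t) \<in> (U \<union> D)\<^sup>*" "t \<in> I \<union> J \<union> K" for v t
    using that
  proof (induction rule: converse_rtrancl_induct)
    case base
    then show ?case using c_start sep c_notin h_cases[of t] unfolding c_def by blast
  next
    case (step v w)
    show ?case
    proof
      assume hv: "h v"
      show "c (Res v)"
      proof (rule ccontr)
        assume n: "\<not> c (Res v)"
        then have cv: "c (Var v)" and vK: "v \<notin> K" using h_cases[OF hv] c_notin by auto
        show False
        proof (cases "(v, w) \<in> U")
          case True
          then have "c (Res w)" using step h_U[OF hv] by blast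
          from c_E[OF this] obtain \<zeta> where \<zeta>: "entry \<zeta>" "(\<zeta>, Res w) \<in> sect U K" by blast
          have wv: "(w, v) \<in> U" using True chain_graphD(3)[OF cg] by blast
          have "(\<zeta>, Res v) \<in> sect U K"
          proof (cases \<zeta>)
            case (Var u)
            then have "w \<notin> K" using \<zeta>(2) by (auto simp: Var_sect dest: avoiding_walk_end)
            then show ?thesis using Var \<zeta>(2) wv vK by (auto simp: Var_sect intro: rtrancl_into_rtrancl)
          next
            case (Res u)
            then show ?thesis using \<zeta>(2) wv by (auto simp: Res_sect_Res intro: rtrancl_into_rtrancl)
          qed
          with \<zeta>(1) have "c (Res v)" by (rule c_I)
          with n show False ..
        next
          case False
          then have D: "(v, w) \<in> D" using step.hyps(1) by blast
          then have "c (Res w)" using step h_D[OF cv] by blast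
          moreover have "(Var v, Res v) \<in> sect U K" using vK by (simp add: Var_sect)
          ultimately show False using c_up D n by blast
        qed
      qed
    qed
  qed
  have h_Res: "c (Res v)" if "h v" "v \<in> T" for v using that h_c unfolding T_def by blast
  have Var_Res: "c (Res v)" if "c (Var v)" "v \<in> T" for v
  proof -
    from c_E[OF that(1)] obtain \<zeta> where \<zeta>: "entry \<zeta>" "(\<zeta>, Var v) \<in> sect U K" by blast
    show ?thesis
    proof (cases \<zeta>)
      case (Var u)
      then have "(\<zeta>, Res v) \<in> sect U K" using \<zeta>(2) by (simp add: Var_sect)
      with \<zeta>(1) show ?thesis by (rule c_I)
    next
      case (Res b)
      then obtain a where "c (Var a)" "(a, b) \<in> D"
        using \<zeta>(1) unfolding entry_def cross_iff by blast
      moreover have "(b, v) \<in> U\<^sup>*"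
        using \<zeta>(2) Res rtrancl_mono[of "U \<inter> (- K) \<times> (- K)" U] by (auto simp: sect_Var)
      ultimately have "h v" unfolding h_def by blast
      then show ?thesis using h_Res that(2) by blast
    qed
  qed
  have T_closed: "v \<in> T" if "w \<in> T" "(v, w) \<in> U \<union> D" for v w
    using that chain_graphD(1,2)[OF cg] unfolding T_def by (blast intro: converse_rtrancl_into_rtrancl)
  have T_sub: "T \<subseteq> ?V" "I \<union> J \<union> K \<subseteq> T" using sub by (auto simp: T_def)
  have fin: "finite ?V" by (rule finite_verts)
  have symU: "(w, v) \<in> U" if "(v, w) \<in> U" for v w using that chain_graphD(3)[OF cg] by blast
  let ?rk = "\<lambda>v. card (ancestors U D v)"
  have rkM: "?rk v = ?rk w" if "v \<in> ?V" "w \<in> ?V" "M v w \<noteq> 0" for v w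
    using M[OF that] card_ancestors_U[OF cg] by auto
  have rkE: "?rk w < ?rk v" if "v \<in> ?V" "w \<in> ?V" "E v w \<noteq> 0" for v w
    using E[OF that] card_ancestors_D[OF cg] by auto
  have y0: "y v = 0" if v: "v \<in> ?V - T" for v
  proof -
    \<comment> \<open>The transposed system runs along arrows in the opposite direction, so ranks
      are reversed by subtracting from their maximum. It is homogeneous off \<open>T\<close>,
      because \<open>g\<close> lives on \<open>T\<close> and \<open>T\<close> is closed under
      passing to parents and neighbours.\<close>
    let ?B = "Max (?rk ` ?V)"
    have bound: "?rk v \<le> ?B" if "v \<in> ?V" for v using that fin by (intro Max_ge) auto
    have pd': "pd_on (?V - T) M" using pd by (rule pd_on_subset) auto
    show ?thesis
    proof (rule triangular_inj[OF pd', of "\<lambda>v. ?B - ?rk v" "\<lambda>v w. E w v"])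
      fix v w assume vw: "v \<in> ?V - T" "w \<in> ?V - T"
      show "?B - ?rk v = ?B - ?rk w" if "M v w \<noteq> 0" using rkM[of v w] that vw by simp
      show "?B - ?rk w < ?B - ?rk v" if "E w v \<noteq> 0"
        using rkE[of w v] that vw bound[of w] by fastforce
    next
      fix v assume v: "v \<in> ?V - T"
      have "mvec ?V M y v = mvec (?V - T) M y v"
        unfolding mvec_def
      proof (rule sum.mono_neutral_right)
        have "M v w = 0" if "w \<in> T" for w
          using M[of v w] T_closed[OF that, of v] T_sub that v by blast
        then show "\<forall>w\<in>?V - (?V - T). M v w * y w = 0" by simp
      qed (use fin in auto)
      moreover have "mvec ?V (\<lambda>v w. E w v) y v = mvec (?V - T) (\<lambda>v w. E w v) y v"
        unfolding mvec_def
      proof (rule sum.mono_neutral_right)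
        have "E w v = 0" if "w \<in> T" for w
          using E[of w v] T_closed[OF that, of v] T_sub that v by blast
        then show "\<forall>w\<in>?V - (?V - T). E w v * y w = 0" by simp
      qed (use fin in auto)
      moreover have "g v = 0" using g[of v] v T_sub by blast
      ultimately show "mvec (?V - T) M y v + mvec (?V - T) (\<lambda>v w. E w v) y v = 0"
        using eq2[of v] v by simp
    qed (use v in simp)
  qed
  \<comment> \<open>\<open>x\<close> is cut at single vertices, but \<open>z = x - y\<close> by
    whole components: the equation \<open>M z + E x = 0\<close> couples a component only with its
    parents.\<close>
  define xh where "xh v = (if v \<in> T \<and> c (Var v) then x v else 0)" for v
  define zh where "zh v = (if v \<in> T \<and> h v then x v - y v else 0)" for v
  define yh where "yh v = xh v - zh v" for v
  \<comment> \<open>The predicate \<open>h\<close> is constant on components. A parent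
    \<open>w\<close> of \<open>v\<close> outside \<open>K\<close> is kept exactly when
    \<open>h v\<close> holds; for the converse the route turns back at the arrowhead
    \<open>Res v\<close>.\<close>
  have claim1: "mvec ?V M zh v + mvec ?V E xh v = 0" if v: "v \<in> T" for v
  proof -
    have vV: "v \<in> ?V" using v T_sub by blast
    have "M v w * zh w = (if h v then M v w * (x w - y w) else 0)" if w: "w \<in> ?V" for w
    proof (cases "M v w = 0")
      case False
      then have "v = w \<or> (v, w) \<in> U" using M[OF vV w] by blast
      then have "w \<in> T" "h w \<longleftrightarrow> h v" using v T_closed h_U symU by blast+
      then show ?thesis by (simp add: zh_def)
    qed simp
    then have 1: "mvec ?V M zh v = (if h v then mvec ?V M x v - mvec ?V M y v else 0)"
      unfolding mvec_def by (simp add: sum_subtractf right_diff_distrib)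
    have "E v w * xh w = (if h v then E v w * x w else 0)" if w: "w \<in> ?V" for w
    proof (cases "E v w = 0 \<or> w \<in> K")
      case True
      then show ?thesis using xK by (auto simp: xh_def)
    next
      case False
      then have D: "(w, v) \<in> D" using E[OF vV w] by blast
      then have "w \<in> T" using v T_closed by blast
      moreover have "c (Var w) \<longleftrightarrow> h v" using h_D[OF _ D] c_up'[OF _ D] h_Res[OF _ v] False by blast
      ultimately show ?thesis by (simp add: xh_def)
    qed
    then have "mvec ?V E xh v = (if h v then mvec ?V E x v else 0)"
      unfolding mvec_def by simp
    then show ?thesis using 1 eq1[OF vV] by auto
  qed
  have claim2: "mvec ?V M yh v + mvec ?V (\<lambda>v w. E w v) yh v = 0" if v: "v \<in> T" "v \<notin> K" for v
  proof -
    have vV: "v \<in> ?V" using v T_sub by blast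
    have "M v w * xh w = (if c (Var v) then M v w * x w else 0)" if w: "w \<in> ?V" for w
    proof (cases "M v w = 0 \<or> w \<in> K")
      case True
      then show ?thesis using xK by (auto simp: xh_def)
    next
      case False
      then have "v = w \<or> (v, w) \<in> U" using M[OF vV w] by blast
      then have "w \<in> T" "c (Var w) \<longleftrightarrow> c (Var v)" using v T_closed c_U symU False by blast+
      then show ?thesis by (simp add: xh_def)
    qed
    then have 1: "mvec ?V M xh v = (if c (Var v) then mvec ?V M x v else 0)"
      unfolding mvec_def by simp
    have "E v w * xh w = (if c (Var v) then E v w * x w else 0)" if w: "w \<in> ?V" for w
    proof (cases "E v w = 0 \<or> w \<in> K")
      case True
      then show ?thesis using xK by (auto simp: xh_def)
    next
      case False
      then have D: "(w, v) \<in> D" using E[OF vV w] by blast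
      then have "w \<in> T" using v T_closed by blast
      have "c (Var v)" if "c (Var w)"
        using c_down[OF that D, of "Var v"] v(2) by (simp add: sect_Var)
      moreover have "c (Var w)" if "c (Var v)"
        using c_up'[OF Var_Res[OF that v(1)] D] False by blast
      ultimately have "c (Var w) \<longleftrightarrow> c (Var v)" by blast
      then show ?thesis using \<open>w \<in> T\<close> by (simp add: xh_def)
    qed
    then have 2: "mvec ?V E xh v = (if c (Var v) then mvec ?V E x v else 0)"
      unfolding mvec_def by simp
    have "E w v * yh w = (if c (Var v) then E w v * y w else 0)" if w: "w \<in> ?V" for w
    proof (cases "E w v = 0 \<or> w \<notin> T")
      case True
      then show ?thesis using y0[of w] w by (auto simp: yh_def xh_def zh_def)
    next
      case False
      then have D: "(v, w) \<in> D" and wT: "w \<in> T" using E[OF w vV] by blast+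
      show ?thesis
      proof (cases "c (Var v)")
        case True
        have "c (Var w)" if "w \<notin> K"
          using c_down[OF True D, of "Var w"] that by (simp add: sect_Var)
        then have "xh w = x w" using wT xK by (auto simp: xh_def)
        moreover have "zh w = x w - y w" using h_D[OF True D] wT by (simp add: zh_def)
        ultimately show ?thesis using True by (simp add: yh_def)
      next
        case n: False
        have "\<not> c (Res w)" using c_up'[OF _ D v(2)] n by blast
        then have "\<not> c (Var w)" "\<not> h w" using Var_Res h_Res wT by blast+
        then show ?thesis using n by (simp add: yh_def xh_def zh_def)
      qed
    qed
    then have 3: "mvec ?V (\<lambda>v w. E w v) yh v = (if c (Var v) then mvec ?V (\<lambda>v w. E w v) y v else 0)"
      unfolding mvec_def by simp
    \<comment> \<open>With \<open>claim1\<close> the left side becomes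
      \<open>M x + E x + E^T y\<close> at \<open>v\<close>, or 0 if \<open>Var v\<close> is not
      reached. By the two equations this is \<open>g v\<close>, and separation keeps a reached
      \<open>Var v\<close> out of \<open>J\<close>.\<close>
    have "mvec ?V M yh v = mvec ?V M xh v + mvec ?V E xh v"
      using claim1[OF v(1)] unfolding yh_def mvec_diff by simp
    moreover have "g v = 0" if "c (Var v)"
      using that g[OF vV] sep v(2) unfolding c_def by blast
    ultimately show ?thesis using 1 2 3 eq1[OF vV] eq2[OF vV] by auto
  qed
  have Myh: "mvec ?V M yh v = mvec ?V M xh v + mvec ?V E xh v" if "v \<in> T" for v
    using claim1[OF that] unfolding yh_def mvec_diff by simp
  \<comment> \<open>Energy argument:
    \<open>yh^T M yh = yh^T (M + E) xh = xh^T (M + E^T) yh = 0\<close>, the last step because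
    \<open>xh\<close> is supported where \<open>claim2\<close> applies. Definiteness of
    \<open>M\<close> gives \<open>yh = 0\<close>.\<close>
  have "(\<Sum>v\<in>?V. yh v * mvec ?V M yh v) =
      (\<Sum>v\<in>?V. yh v * mvec ?V M xh v) + (\<Sum>v\<in>?V. yh v * mvec ?V E xh v)"
    unfolding sum.distrib[symmetric]
  proof (intro sum.cong refl)
    fix v
    show "yh v * mvec ?V M yh v = yh v * mvec ?V M xh v + yh v * mvec ?V E xh v"
      using Myh[of v] by (cases "v \<in> T") (auto simp: distrib_left yh_def xh_def zh_def)
  qed
  also have "(\<Sum>v\<in>?V. yh v * mvec ?V M xh v) = (\<Sum>v\<in>?V. xh v * mvec ?V M yh v)"
    by (rule pd_on_swap[OF pd])
  also have "(\<Sum>v\<in>?V. yh v * mvec ?V E xh v) = (\<Sum>v\<in>?V. xh v * mvec ?V (\<lambda>v w. E w v) yh v)"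
    by (rule mvec_swap) simp
  also have "(\<Sum>v\<in>?V. xh v * mvec ?V M yh v) + (\<Sum>v\<in>?V. xh v * mvec ?V (\<lambda>v w. E w v) yh v) =
      (\<Sum>v\<in>?V. xh v * (mvec ?V M yh v + mvec ?V (\<lambda>v w. E w v) yh v))"
    by (simp add: sum.distrib distrib_left)
  also have "\<dots> = 0"
  proof (intro sum.neutral ballI)
    fix v
    show "xh v * (mvec ?V M yh v + mvec ?V (\<lambda>v w. E w v) yh v) = 0"
      using claim2[of v] c_notin[of v] by (auto simp: xh_def)
  qed
  finally have yh0: "yh v = 0" if "v \<in> ?V" for v using pd_on_zero[OF pd _ that] by blast
  \<comment> \<open>Now \<open>(M + E) xh = 0\<close> is known on \<open>T\<close> only. That is
    enough, since \<open>triangular_inj\<close> asks for the equation just where \<open>xh\<close>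
    is nonzero.\<close>
  have "xh i = 0"
  proof (rule triangular_inj[OF pd rkM rkE])
    fix v assume "v \<in> ?V" "xh v \<noteq> 0"
    then have "v \<in> T" by (auto simp: xh_def split: if_splits)
    have "mvec ?V M yh v = 0" using yh0 by (simp add: mvec_def)
    then show "mvec ?V M xh v + mvec ?V E xh v = 0" using Myh[OF \<open>v \<in> T\<close>] by simp
  qed (use i sub in auto)
  then show ?thesis using c_start(1)[OF i] T_sub i by (auto simp: xh_def split: if_splits)
qed

section \<open>Generic non-vanishing along connections\<close>

definition nodes :: "nat set \<Rightarrow> nat set \<Rightarrow> node set" where
  "nodes V K = Res ` V \<union> Var ` (V - K)"

fun saddle :: "(nat \<Rightarrow> nat \<Rightarrow> real) \<Rightarrow> (nat \<Rightarrow> nat \<Rightarrow> real) \<Rightarrow> node \<Rightarrow> node \<Rightarrow> real" where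
  "saddle M A (Res v) (Res w) = M v w"
| "saddle M A (Res v) (Var w) = A v w"
| "saddle M A (Var v) (Res w) = A w v"
| "saddle M A (Var v) (Var w) = 0"

definition right_inverse_on :: "'a set \<Rightarrow> ('a \<Rightarrow> 'a \<Rightarrow> real) \<Rightarrow> ('a \<Rightarrow> 'a \<Rightarrow> real) \<Rightarrow> bool" where
  "right_inverse_on S Q X \<longleftrightarrow>
     (\<forall>\<xi>\<in>S. \<forall>\<eta>\<in>S. (\<Sum>\<rho>\<in>S. Q \<xi> \<rho> * X \<rho> \<eta>) = (if \<xi> = \<eta> then 1 else 0))"

lemma right_inverse_onD:
  "right_inverse_on S Q X \<Longrightarrow> \<xi> \<in> S \<Longrightarrow> \<eta> \<in> S \<Longrightarrow> (\<Sum>\<rho>\<in>S. Q \<xi> \<rho> * X \<rho> \<eta>) = (if \<xi> = \<eta> then 1 else 0)"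
  by (simp add: right_inverse_on_def)

lemma finite_nodes: "finite V \<Longrightarrow> finite (nodes V K)"
  by (simp add: nodes_def)

lemma sum_nodes:
  assumes "finite V"
  shows "(\<Sum>\<rho>\<in>nodes V K. f \<rho>) = (\<Sum>v\<in>V. f (Res v)) + (\<Sum>v\<in>V - K. f (Var v))"
proof -
  have "(\<Sum>\<rho>\<in>nodes V K. f \<rho>) = (\<Sum>\<rho>\<in>Res ` V. f \<rho>) + (\<Sum>\<rho>\<in>Var ` (V - K). f \<rho>)"
    unfolding nodes_def using assms by (intro sum.union_disjoint) auto
  moreover have "(\<Sum>\<rho>\<in>Res ` V. f \<rho>) = (\<Sum>v\<in>V. f (Res v))"
    by (subst sum.reindex) (auto simp: inj_on_def)
  moreover have "(\<Sum>\<rho>\<in>Var ` (V - K). f \<rho>) = (\<Sum>v\<in>V - K. f (Var v))"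
    by (subst sum.reindex) (auto simp: inj_on_def)
  ultimately show ?thesis by simp
qed

lemma saddle_sym:
  assumes "\<And>v w. v \<in> V \<Longrightarrow> w \<in> V \<Longrightarrow> M v w = M w v" "\<xi> \<in> nodes V K" "\<eta> \<in> nodes V K"
  shows "saddle M A \<xi> \<eta> = saddle M A \<eta> \<xi>"
  using assms by (cases \<xi>; cases \<eta>) (auto simp: nodes_def)

text \<open>The opposite signs of the two kinds of diagonal entries are what rules out cancellation
  when an arrow is added.\<close>
lemma saddle_inverse_diag:
  assumes pd: "pd_on V M" and inv: "right_inverse_on (nodes V K) (saddle M A) X"
  shows "b \<in> V \<Longrightarrow> X (Res b) (Res b) \<ge> 0"
    and "a \<in> V - K \<Longrightarrow> X (Var a) (Var a) < 0"
proof -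
  have fin: "finite V" using pd by (rule pd_onD)
  have rows: "mvec V M (\<lambda>v. X (Res v) \<eta>) v + (\<Sum>u\<in>V - K. A v u * X (Var u) \<eta>) = (if \<eta> = Res v then 1 else 0)"
    if "\<eta> \<in> nodes V K" "v \<in> V" for \<eta> v
  proof -
    have "Res v \<in> nodes V K" using that(2) by (simp add: nodes_def)
    from right_inverse_onD[OF inv this that(1)] show ?thesis
      by (simp add: sum_nodes[OF fin] mvec_def eq_commute[of \<eta>])
  qed
  have cols: "(\<Sum>v\<in>V. A v u * X (Res v) \<eta>) = (if \<eta> = Var u then 1 else 0)"
    if "\<eta> \<in> nodes V K" "u \<in> V - K" for \<eta> u
  proof -
    have "Var u \<in> nodes V K" using that(2) by (simp add: nodes_def)
    from right_inverse_onD[OF inv this that(1)] show ?thesis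
      by (simp add: sum_nodes[OF fin] eq_commute[of \<eta>])
  qed
  \<comment> \<open>Pair a column of \<open>X\<close> with its own equations: the energy of its
    \<open>Res\<close> part equals the diagonal entry at a \<open>Res\<close> index and minus the
    diagonal entry at a \<open>Var\<close> index. Strictness in the second case holds because that
    \<open>Res\<close> part cannot vanish: \<open>A^T\<close> maps it to a unit vector.\<close>
  have quad: "(\<Sum>v\<in>V. X (Res v) \<eta> * mvec V M (\<lambda>v. X (Res v) \<eta>) v) =
      (\<Sum>v\<in>V. X (Res v) \<eta> * (if \<eta> = Res v then 1 else 0)) - (\<Sum>u\<in>V - K. X (Var u) \<eta> * (if \<eta> = Var u then 1 else 0))"
    if \<eta>: "\<eta> \<in> nodes V K" for \<eta>
  proof -
    have "(\<Sum>v\<in>V. X (Res v) \<eta> * mvec V M (\<lambda>v. X (Res v) \<eta>) v) =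
        (\<Sum>v\<in>V. X (Res v) \<eta> * ((if \<eta> = Res v then 1 else 0) - (\<Sum>u\<in>V - K. A v u * X (Var u) \<eta>)))"
      using rows[OF \<eta>] by (intro sum.cong refl) (simp only: add_diff_cancel flip: rows[OF \<eta>])
    also have "\<dots> = (\<Sum>v\<in>V. X (Res v) \<eta> * (if \<eta> = Res v then 1 else 0)) -
        (\<Sum>v\<in>V. \<Sum>u\<in>V - K. X (Res v) \<eta> * (A v u * X (Var u) \<eta>))"
      by (simp only: right_diff_distrib sum_subtractf sum_distrib_left)
    also have "(\<Sum>v\<in>V. \<Sum>u\<in>V - K. X (Res v) \<eta> * (A v u * X (Var u) \<eta>)) =
        (\<Sum>u\<in>V - K. \<Sum>v\<in>V. X (Res v) \<eta> * (A v u * X (Var u) \<eta>))" by (rule sum.swap)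
    also have "\<dots> = (\<Sum>u\<in>V - K. X (Var u) \<eta> * (if \<eta> = Var u then 1 else 0))"
    proof (intro sum.cong refl)
      fix u assume u: "u \<in> V - K"
      show "(\<Sum>v\<in>V. X (Res v) \<eta> * (A v u * X (Var u) \<eta>)) = X (Var u) \<eta> * (if \<eta> = Var u then 1 else 0)"
        unfolding cols[OF \<eta> u, symmetric] by (simp add: sum_distrib_left mult_ac)
    qed
    finally show ?thesis .
  qed
  have sel: "(\<Sum>v\<in>B. f v * (if d = v then 1 else 0)) = f d" if "d \<in> B" "finite B" for B :: "nat set" and f :: "nat \<Rightarrow> real" and d
  proof -
    have "(\<Sum>v\<in>B. f v * (if d = v then 1 else 0)) = (\<Sum>v\<in>B. if d = v then f v else (0 :: real))"
      by (intro sum.cong) auto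
    then show ?thesis using that by simp
  qed
  show "X (Res b) (Res b) \<ge> 0" if "b \<in> V"
    using quad[of "Res b"] pd_on_nonneg[OF pd, of "\<lambda>v. X (Res v) (Res b)"] that sel[OF that fin, of "\<lambda>v. X (Res v) (Res b)"]
    by (simp add: nodes_def)
  show "X (Var a) (Var a) < 0" if a: "a \<in> V - K"
  proof -
    have aS: "Var a \<in> nodes V K" using a by (simp add: nodes_def)
    have "\<exists>v\<in>V. X (Res v) (Var a) \<noteq> 0"
    proof (rule ccontr)
      assume "\<not> ?thesis"
      then have "(\<Sum>v\<in>V. A v a * X (Res v) (Var a)) = 0" by simp
      then show False using cols[OF aS a] by simp
    qed
    then obtain v where "v \<in> V" "X (Res v) (Var a) \<noteq> 0" by blast
    then have "0 < (\<Sum>v\<in>V. X (Res v) (Var a) * mvec V M (\<lambda>v. X (Res v) (Var a)) v)"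
      by (rule pd_onD(3)[OF pd])
    then show ?thesis
      using quad[OF aS] sel[of a "V - K" "\<lambda>u. X (Var u) (Var a)"] a fin by simp
  qed
qed

text \<open>The Woodbury formula for a symmetric change by \<open>t\<close> at the positions
  \<open>(p, q)\<close> and \<open>(q, p)\<close>; \<open>\<Delta>\<close> is the determinant of the
  resulting two-by-two system.\<close>

lemma right_inverse_update:
  fixes Q X :: "'a \<Rightarrow> 'a \<Rightarrow> real"
  assumes fin: "finite S" and inv: "right_inverse_on S Q X"
    and sym: "X q p = X p q" and pq: "p \<in> S" "q \<in> S" "p \<noteq> q"
    and \<Delta>: "(1 + t * X p q)\<^sup>2 - t\<^sup>2 * (X p p * X q q) = \<Delta>" "\<Delta> \<noteq> 0"
    and Q': "\<And>\<xi> \<eta>. \<xi> \<in> S \<Longrightarrow> \<eta> \<in> S \<Longrightarrow>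
      Q' \<xi> \<eta> = Q \<xi> \<eta> + (if \<xi> = p \<and> \<eta> = q \<or> \<xi> = q \<and> \<eta> = p then t else 0)"
  shows "right_inverse_on S Q' (\<lambda>\<xi> \<eta>. X \<xi> \<eta> -
    t * (X \<xi> p * (((1 + t * X p q) * X q \<eta> - t * X q q * X p \<eta>) / \<Delta>) +
         X \<xi> q * (((1 + t * X p q) * X p \<eta> - t * X p p * X q \<eta>) / \<Delta>)))"
    (is "right_inverse_on S Q' ?Y")
  unfolding right_inverse_on_def
proof (intro ballI)
  fix \<xi> \<eta> assume S: "\<xi> \<in> S" "\<eta> \<in> S"
  \<comment> \<open>These are the entries at \<open>q\<close> and \<open>p\<close> of the new
    column, by Cramer's rule.\<close>
  define wq where "wq = ((1 + t * X p q) * X q \<eta> - t * X q q * X p \<eta>) / \<Delta>"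
  define wp where "wp = ((1 + t * X p q) * X p \<eta> - t * X p p * X q \<eta>) / \<Delta>"
  have Y: "?Y \<rho> \<eta> = X \<rho> \<eta> - t * (X \<rho> p * wq + X \<rho> q * wp)" for \<rho> by (simp add: wq_def wp_def)
  have m: "\<Delta> * wq = (1 + t * X p q) * X q \<eta> - t * X q q * X p \<eta>"
    "\<Delta> * wp = (1 + t * X p q) * X p \<eta> - t * X p p * X q \<eta>"
    using \<Delta>(2) by (simp_all add: wq_def wp_def)
  have "\<Delta> * (X q \<eta> - t * (X p q * wq + X q q * wp)) = \<Delta> * wq"
    "\<Delta> * (X p \<eta> - t * (X p p * wq + X p q * wp)) = \<Delta> * wp"
  proof -
    have "\<Delta> * (X q \<eta> - t * (X p q * wq + X q q * wp)) =
        \<Delta> * X q \<eta> - t * (X p q * (\<Delta> * wq) + X q q * (\<Delta> * wp))" by (simp add: algebra_simps)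
    also have "\<dots> = \<Delta> * wq" unfolding m unfolding \<Delta>(1)[symmetric] by (simp add: power2_eq_square algebra_simps)
    finally show "\<Delta> * (X q \<eta> - t * (X p q * wq + X q q * wp)) = \<Delta> * wq" .
    have "\<Delta> * (X p \<eta> - t * (X p p * wq + X p q * wp)) =
        \<Delta> * X p \<eta> - t * (X p p * (\<Delta> * wq) + X p q * (\<Delta> * wp))" by (simp add: algebra_simps)
    also have "\<dots> = \<Delta> * wp" unfolding m unfolding \<Delta>(1)[symmetric] by (simp add: power2_eq_square algebra_simps)
    finally show "\<Delta> * (X p \<eta> - t * (X p p * wq + X p q * wp)) = \<Delta> * wp" .
  qed
  then have Yq: "?Y q \<eta> = wq" and Yp: "?Y p \<eta> = wp" using \<Delta>(2) sym unfolding Y by auto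
  have "(\<Sum>\<rho>\<in>S. Q \<xi> \<rho> * ?Y \<rho> \<eta>) = (\<Sum>\<rho>\<in>S. Q \<xi> \<rho> * X \<rho> \<eta>) -
      t * ((\<Sum>\<rho>\<in>S. Q \<xi> \<rho> * X \<rho> p) * wq + (\<Sum>\<rho>\<in>S. Q \<xi> \<rho> * X \<rho> q) * wp)"
    unfolding Y by (simp add: sum_subtractf sum.distrib sum_distrib_left sum_distrib_right algebra_simps)
  also have "\<dots> = (if \<xi> = \<eta> then 1 else 0) - t * ((if \<xi> = p then wq else 0) + (if \<xi> = q then wp else 0))"
    using inv S pq(1,2) by (simp add: right_inverse_on_def)
  finally have QY: "(\<Sum>\<rho>\<in>S. Q \<xi> \<rho> * ?Y \<rho> \<eta>) =
      (if \<xi> = \<eta> then 1 else 0) - t * ((if \<xi> = p then wq else 0) + (if \<xi> = q then wp else 0))" .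
  have "(\<Sum>\<rho>\<in>S. Q' \<xi> \<rho> * ?Y \<rho> \<eta>) = (\<Sum>\<rho>\<in>S. Q \<xi> \<rho> * ?Y \<rho> \<eta> +
      ((if \<rho> = q then (if \<xi> = p then t else 0) * ?Y \<rho> \<eta> else 0) + (if \<rho> = p then (if \<xi> = q then t else 0) * ?Y \<rho> \<eta> else 0)))"
    using Q'[OF S(1)] pq(3) by (intro sum.cong refl) (auto simp: distrib_right)
  also have "\<dots> = (\<Sum>\<rho>\<in>S. Q \<xi> \<rho> * ?Y \<rho> \<eta>) +
      ((if \<xi> = p then t else 0) * ?Y q \<eta> + (if \<xi> = q then t else 0) * ?Y p \<eta>)"
    unfolding sum.distrib using fin pq by (simp only: sum.delta if_True)
  also have "\<dots> = (if \<xi> = \<eta> then 1 else 0)"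
    unfolding QY Yp Yq using pq(3) by auto
  finally show "(\<Sum>\<rho>\<in>S. Q' \<xi> \<rho> * ?Y \<rho> \<eta>) = (if \<xi> = \<eta> then 1 else 0)" .
qed

text \<open>The alternatives supply the non-vanishing hypotheses of \<open>no_cancellation\<close>.
  For the last one: if neither end reaches \<open>Res b\<close> in the old graph, the new arrow is
  first passed downwards and last passed upwards, so in between \<open>Res b\<close> is connected to
  itself.\<close>

lemma conn_insert:
  assumes "(\<xi>, \<eta>) \<in> conn U (insert (a, b) D) K"
  shows "(\<xi>, \<eta>) \<in> conn U D K \<or> a \<notin> K \<and>
    ((\<xi>, Var a) \<in> conn U D K \<or> (\<xi>, Res b) \<in> conn U D K) \<and>
    ((Var a, \<eta>) \<in> conn U D K \<or> (Res b, \<eta>) \<in> conn U D K) \<and>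
    ((Res b, Res b) \<in> conn U D K \<or> (\<xi>, Res b) \<in> conn U D K \<or> (Res b, \<eta>) \<in> conn U D K)"
  using assms
proof (induction rule: conn_induct)
  case (base \<eta>)
  then show ?case by (blast intro: conn_base)
next
  case (step \<rho> \<zeta> \<eta>)
  from step.hyps(2) consider "(\<rho>, \<zeta>) \<in> cross D" | "\<rho> = Var a" "\<zeta> = Res b" | "\<rho> = Res b" "\<zeta> = Var a"
    unfolding cross_iff by blast
  then show ?case
  proof cases
    case 1
    then show ?thesis using step.IH step.hyps(3) by (blast intro: conn_step)
  next
    case 2
    then have "a \<notin> K" "(Res b, \<eta>) \<in> conn U D K"
      using step.hyps conn_Var_notin by (blast, blast intro: conn_base)
    then show ?thesis using step.IH unfolding 2(1) by blast
  next
    case 3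
    then have "a \<notin> K" "(Var a, \<eta>) \<in> conn U D K"
      using step.hyps(3) by (auto simp: Var_sect intro: conn_base)
    then show ?thesis using step.IH unfolding 3(1) by blast
  qed
qed

text \<open>A vertex has at most \<open>N - 1\<close> neighbours, so all row sums are at least 2:
  strictly dominant diagonal, non-positive off-diagonal entries.\<close>

definition grounded_laplacian :: "nat \<Rightarrow> (nat \<times> nat) set \<Rightarrow> nat \<Rightarrow> nat \<Rightarrow> real" where
  "grounded_laplacian N U v w = (if v = w then real N + 1 else if (v, w) \<in> U then -1 else 0)"

section \<open>The case without arrows: explicit inverse and its signs\<close>

context
  fixes N U
  assumes symU: "\<And>a b. (a, b) \<in> U \<Longrightarrow> (b, a) \<in> U" and UV: "U \<subseteq> verts N \<times> verts N"
    and irrefl: "\<And>v. (v, v) \<notin> U"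
begin

private abbreviation (input) "L \<equiv> grounded_laplacian N U"
private abbreviation (input) "\<V> \<equiv> verts N"

lemma laplacian_pd: "pd_on \<V> L"
  unfolding pd_on_def
proof (intro conjI allI impI ballI)
  show "finite \<V>" by (rule finite_verts)
  show "L i j = L j i" for i j using symU by (auto simp: grounded_laplacian_def)
  fix x :: "nat \<Rightarrow> real" assume "\<exists>i\<in>\<V>. x i \<noteq> 0"
  then obtain i where i: "i \<in> \<V>" "x i \<noteq> 0" by blast
  have card: "real (card \<V>) = real N" by (simp add: verts_def)
  \<comment> \<open>An edge contributes \<open>- x v * x w\<close>, bounded below by the mean of
    squares; on the diagonal equality holds, as \<open>N + 1 = (N + 2) - 1\<close>. After summation
    the coefficient is \<open>(N + 2) - N = 2\<close>.\<close>
  have bound: "(if v = w then (real N + 2) * (x v)\<^sup>2 else 0) - ((x v)\<^sup>2 / 2 + (x w)\<^sup>2 / 2) \<le> x v * L v w * x w" for v w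
  proof (cases "v = w")
    case True
    then show ?thesis by (simp add: grounded_laplacian_def power2_eq_square algebra_simps)
  next
    case False
    have "(x v - x w)\<^sup>2 \<ge> 0" by simp
    then have "x v * x w \<le> (x v)\<^sup>2 / 2 + (x w)\<^sup>2 / 2" by (simp add: power2_diff)
    then show ?thesis using False by (auto simp: grounded_laplacian_def)
  qed
  have "0 < 2 * (\<Sum>v\<in>\<V>. (x v)\<^sup>2)"
    using i finite_verts by (auto intro!: sum_pos2)
  also have "\<dots> = (\<Sum>v\<in>\<V>. \<Sum>w\<in>\<V>. (if v = w then (real N + 2) * (x v)\<^sup>2 else 0) - ((x v)\<^sup>2 / 2 + (x w)\<^sup>2 / 2))"
  proof -
    have "(\<Sum>w\<in>\<V>. (if v = w then (real N + 2) * (x v)\<^sup>2 else 0) - ((x v)\<^sup>2 / 2 + (x w)\<^sup>2 / 2)) =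
        (real N + 2) * (x v)\<^sup>2 - (real N * ((x v)\<^sup>2 / 2) + (\<Sum>w\<in>\<V>. (x w)\<^sup>2) / 2)" if "v \<in> \<V>" for v
      using that card finite_verts by (simp add: sum_subtractf sum.distrib sum_divide_distrib)
    then show ?thesis
      using card by (simp add: sum_subtractf sum.distrib sum_divide_distrib[symmetric] sum_distrib_left[symmetric] algebra_simps)
  qed
  also have "\<dots> \<le> (\<Sum>v\<in>\<V>. \<Sum>w\<in>\<V>. x v * L v w * x w)" by (intro sum_mono bound)
  finally show "0 < (\<Sum>v\<in>\<V>. \<Sum>w\<in>\<V>. x v * L v w * x w)" .
qed

lemma laplacian_offdiag: "v \<noteq> w \<Longrightarrow> L v w \<le> 0"
  by (simp add: grounded_laplacian_def)

text \<open>Minimum principle: at a negative minimum, replacing all values by the minimum can only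
  increase \<open>L h\<close>, and the result is the minimum times a positive row sum.\<close>

lemma laplacian_nonneg:
  assumes W: "\<And>v. v \<in> W \<Longrightarrow> mvec \<V> L h v \<ge> 0" and out: "\<And>v. v \<in> \<V> - W \<Longrightarrow> h v \<ge> 0" and v: "v \<in> \<V>"
  shows "h v \<ge> 0"
proof (rule ccontr)
  assume n: "\<not> ?thesis"
  have fin: "finite \<V>" by (rule finite_verts)
  have "Min (h ` \<V>) \<in> h ` \<V>" using fin v by (intro Min_in) auto
  then obtain u where u: "u \<in> \<V>" "Min (h ` \<V>) = h u" by auto
  then have min: "h u \<le> h w" if "w \<in> \<V>" for w using Min_le[of "h ` \<V>" "h w"] that fin by auto
  have neg: "h u < 0" using min[OF v] n by simp
  then have "u \<in> W" using out u by force
  have "mvec \<V> L h u \<le> (\<Sum>w\<in>\<V>. L u w * h u)"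
    unfolding mvec_def
  proof (intro sum_mono)
    fix w assume "w \<in> \<V>"
    then show "L u w * h w \<le> L u w * h u"
      using min laplacian_offdiag[of u w] by (cases "u = w") (auto intro: mult_left_mono_neg)
  qed
  also have "\<dots> = h u * (\<Sum>w\<in>\<V>. L u w)" by (simp add: sum_distrib_left mult.commute)
  also have "\<dots> < 0"
  proof -
    have "2 = (\<Sum>w\<in>\<V>. (if u = w then real N + 2 else 0) - 1)"
      using u fin by (simp add: sum_subtractf verts_def)
    also have "\<dots> \<le> (\<Sum>w\<in>\<V>. L u w)" by (intro sum_mono) (auto simp: grounded_laplacian_def)
    finally show ?thesis using neg by (intro mult_neg_pos) auto
  qed
  finally show False using W[OF \<open>u \<in> W\<close>] by simp
qed

text \<open>At a zero of a non-negative \<open>h\<close> every summand is non-positive, so any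
  single one is an upper bound. Positivity therefore spreads along edges.\<close>

lemma laplacian_vanish:
  assumes "\<And>v. v \<in> \<V> \<Longrightarrow> h v \<ge> 0" "v \<in> \<V>" "h v = 0" "w \<in> \<V>"
  shows "mvec \<V> L h v \<le> L v w * h w"
proof -
  have "mvec \<V> L h v = L v w * h w + (\<Sum>u\<in>\<V> - {w}. L v u * h u)"
    unfolding mvec_def using assms(4) finite_verts by (simp add: sum.remove)
  moreover have "(\<Sum>u\<in>\<V> - {w}. L v u * h u) \<le> 0"
  proof (intro sum_nonpos)
    fix u assume "u \<in> \<V> - {w}"
    then show "L v u * h u \<le> 0"
      using assms(1)[of u] assms(3) laplacian_offdiag[of v u] by (cases "v = u") (auto intro: mult_nonpos_nonneg)
  qed
  ultimately show ?thesis by simp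
qed

lemma laplacian_pos_source:
  assumes "\<And>v. v \<in> \<V> \<Longrightarrow> h v \<ge> 0" "v \<in> \<V>" "mvec \<V> L h v > 0"
  shows "h v > 0"
  using laplacian_vanish[OF assms(1,2) _ assms(2)] assms by force

lemma laplacian_pos_step:
  assumes "\<And>v. v \<in> \<V> \<Longrightarrow> h v \<ge> 0" "(v, w) \<in> U" "mvec \<V> L h v \<ge> 0" "h w > 0"
  shows "h v > 0"
proof (rule ccontr)
  have vw: "v \<in> \<V>" "w \<in> \<V>" "v \<noteq> w" using assms(2) UV irrefl by auto
  assume "\<not> ?thesis"
  then have "h v = 0" using assms(1)[OF vw(1)] by simp
  then have "mvec \<V> L h v \<le> L v w * h w" using assms(1) vw by (intro laplacian_vanish)
  then show False using assms(2-4) vw(3) by (simp add: grounded_laplacian_def)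
qed

text \<open>Block inverse of the saddle matrix for \<open>A = M = L\<close>. Expanding the inverse
  of \<open>L\<close> as a Neumann series counts weighted walks: the inverse over
  \<open>\<V> - K\<close> counts those avoiding \<open>K\<close>, and the difference in the last
  clause those meeting \<open>K\<close>, in parallel with \<open>sect\<close>.\<close>

fun sections_inverse :: "nat set \<Rightarrow> node \<Rightarrow> node \<Rightarrow> real" where
  "sections_inverse K (Var u) (Var v) = - inv_on (\<V> - K) L u v"
| "sections_inverse K (Res u) (Var v) = inv_on (\<V> - K) L u v"
| "sections_inverse K (Var u) (Res v) = inv_on (\<V> - K) L u v"
| "sections_inverse K (Res u) (Res v) = inv_on \<V> L u v - inv_on (\<V> - K) L u v"

lemma laplacian_pd_sub: "pd_on (\<V> - K) L"
  using laplacian_pd by (rule pd_on_subset) auto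

lemma mvec_inv_col: "v \<in> \<V> \<Longrightarrow> b \<in> \<V> \<Longrightarrow> mvec \<V> L (\<lambda>u. inv_on \<V> L u b) v = (if v = b then 1 else 0)"
  using inv_on_mult[OF laplacian_pd] by (simp add: mvec_def)

lemma mvec_inv_sub_col:
  assumes "v \<in> \<V> - K"
  shows "mvec \<V> L (\<lambda>u. inv_on (\<V> - K) L u b) v = (if v = b then 1 else 0)"
proof -
  have "mvec \<V> L (\<lambda>u. inv_on (\<V> - K) L u b) v = mvec (\<V> - K) L (\<lambda>u. inv_on (\<V> - K) L u b) v"
    using finite_verts inv_on_outside[OF laplacian_pd_sub] by (intro mvec_restrict) auto
  also have "\<dots> = (if v = b then 1 else 0)"
  proof (cases "b \<in> \<V> - K")
    case True
    then show ?thesis using inv_on_mult[OF laplacian_pd_sub assms] by (simp add: mvec_def)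
  next
    case False
    then have "mvec (\<V> - K) L (\<lambda>u. inv_on (\<V> - K) L u b) v = 0"
      using inv_on_outside[OF laplacian_pd_sub] by (simp add: mvec_def)
    then show ?thesis using False assms by auto
  qed
  finally show ?thesis .
qed

lemma sections_inverse:
  "right_inverse_on (nodes \<V> K) (saddle L L) (sections_inverse K)"
  unfolding right_inverse_on_def sum_nodes[OF finite_verts]
proof (intro ballI)
  fix \<xi> \<eta> assume S: "\<xi> \<in> nodes \<V> K" "\<eta> \<in> nodes \<V> K"
  let ?R = "inv_on \<V> L" and ?R' = "inv_on (\<V> - K) L"
  have symL: "L v w = L w v" for v w using symU by (auto simp: grounded_laplacian_def)
  have ext: "(\<Sum>u\<in>\<V> - K. L v u * ?R' u b) = mvec \<V> L (\<lambda>u. ?R' u b) v" for v b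
    unfolding mvec_def using finite_verts inv_on_outside[OF laplacian_pd_sub]
    by (intro sum.mono_neutral_left) auto
  consider v b where "\<xi> = Res v" "\<eta> = Res b" "v \<in> \<V>" "b \<in> \<V>"
    | v b where "\<xi> = Res v" "\<eta> = Var b" "v \<in> \<V>" "b \<in> \<V> - K"
    | v b where "\<xi> = Var v" "\<eta> = Res b" "v \<in> \<V> - K" "b \<in> \<V>"
    | v b where "\<xi> = Var v" "\<eta> = Var b" "v \<in> \<V> - K" "b \<in> \<V> - K"
    using S by (auto simp: nodes_def)
  then show "(\<Sum>v\<in>\<V>. saddle L L \<xi> (Res v) * sections_inverse K (Res v) \<eta>) +
      (\<Sum>v\<in>\<V> - K. saddle L L \<xi> (Var v) * sections_inverse K (Var v) \<eta>) = (if \<xi> = \<eta> then 1 else 0)"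
  proof cases
    case (1 v b)
    have "(\<Sum>u\<in>\<V>. L v u * (?R u b - ?R' u b)) = mvec \<V> L (\<lambda>u. ?R u b) v - mvec \<V> L (\<lambda>u. ?R' u b) v"
      unfolding mvec_def by (simp add: right_diff_distrib sum_subtractf)
    then show ?thesis using 1 mvec_inv_col[of v b] by (simp add: ext)
  next
    case (2 v b)
    then show ?thesis using ext[of v b] by (simp add: mvec_def sum_negf)
  next
    case (3 v b)
    have "(\<Sum>u\<in>\<V>. L u v * (?R u b - ?R' u b)) = mvec \<V> L (\<lambda>u. ?R u b) v - mvec \<V> L (\<lambda>u. ?R' u b) v"
      unfolding mvec_def by (simp add: right_diff_distrib sum_subtractf symL[of _ v])
    then show ?thesis using 3 mvec_inv_col[of v b] mvec_inv_sub_col[of v K b] by simp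
  next
    case (4 v b)
    have "(\<Sum>u\<in>\<V>. L u v * ?R' u b) = mvec \<V> L (\<lambda>u. ?R' u b) v"
      unfolding mvec_def by (simp add: symL[of _ v])
    then show ?thesis using 4 mvec_inv_sub_col[of v K b] by simp
  qed
qed

lemma inv_sub_nonneg: "inv_on (\<V> - K) L v b \<ge> 0"
proof (cases "v \<in> \<V>")
  case True
  show ?thesis
    by (rule laplacian_nonneg[of "\<V> - K" "\<lambda>v. inv_on (\<V> - K) L v b" v])
      (use True mvec_inv_sub_col inv_on_outside[OF laplacian_pd_sub] in auto)
qed (use inv_on_outside[OF laplacian_pd_sub] in auto)

lemma inv_sub_pos:
  assumes "(u, b) \<in> (U \<inter> (- K) \<times> (- K))\<^sup>*" "b \<in> \<V> - K"
  shows "inv_on (\<V> - K) L u b > 0"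
  using assms(1)
proof (induction rule: converse_rtrancl_induct)
  case base
  show ?case
    using laplacian_pos_source[of "\<lambda>v. inv_on (\<V> - K) L v b" b] inv_sub_nonneg assms(2) mvec_inv_sub_col[OF assms(2), of b]
    by simp
next
  case (step u w)
  have "u \<in> \<V> - K" using step.hyps(1) UV by auto
  then show ?case
    using laplacian_pos_step[of "\<lambda>v. inv_on (\<V> - K) L v b" u w] inv_sub_nonneg step
      mvec_inv_sub_col[of u K b] by simp
qed

lemma inv_nonneg: "v \<in> \<V> \<Longrightarrow> b \<in> \<V> \<Longrightarrow> inv_on \<V> L v b \<ge> 0"
  using inv_sub_nonneg[of "{}"] by simp

lemma inv_pos:
  assumes "(u, b) \<in> U\<^sup>*" "b \<in> \<V>"
  shows "inv_on \<V> L u b > 0"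
  using inv_sub_pos[of u b "{}"] assms by simp

text \<open>The difference is annihilated by \<open>L\<close> off \<open>K\<close> and equals the
  full inverse on \<open>K\<close>, which is positive at \<open>k\<close>. The minimum principle
  gives its sign, and positivity spreads from \<open>k\<close> back to \<open>u\<close>.\<close>

lemma inv_diff_pos:
  assumes uk: "(u, k) \<in> U\<^sup>*" and kb: "(k, b) \<in> U\<^sup>*" and k: "k \<in> K" "k \<in> \<V>" and b: "b \<in> \<V>"
  shows "inv_on \<V> L u b - inv_on (\<V> - K) L u b > 0"
proof -
  define h where "h v = inv_on \<V> L v b - inv_on (\<V> - K) L v b" for v
  have inK: "h v = inv_on \<V> L v b" if "v \<in> K" for v
    using that inv_on_outside[OF laplacian_pd_sub] by (simp add: h_def)
  have harm: "mvec \<V> L h v = 0" if "v \<in> \<V> - K" for v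
    using that b mvec_inv_col[of v b] mvec_inv_sub_col[OF that, of b] unfolding h_def mvec_diff by simp
  have nonneg: "h v \<ge> 0" if "v \<in> \<V>" for v
    by (rule laplacian_nonneg[of "\<V> - K" h]) (use that harm inK inv_nonneg b in auto)
  have "h u > 0 \<and> (u, b) \<in> U\<^sup>*"
    using uk
  proof (induction rule: converse_rtrancl_induct)
    case base
    show ?case using inK[OF k(1)] inv_pos[OF kb b] kb by simp
  next
    case (step u w)
    then have ub: "(u, b) \<in> U\<^sup>*" by (blast intro: converse_rtrancl_into_rtrancl)
    show ?case
    proof (cases "u \<in> K")
      case True
      then show ?thesis using inK inv_pos[OF ub b] ub by simp
    next
      case False
      then have "u \<in> \<V> - K" using step.hyps UV by auto
      then show ?thesis
        using laplacian_pos_step[of h u w] nonneg step.hyps(1) harm step.IH ub by simp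
    qed
  qed
  then show ?thesis by (simp add: h_def)
qed

lemma sections_inverse_nonzero:
  assumes s: "(\<xi>, \<eta>) \<in> sect U K" and S: "\<xi> \<in> nodes \<V> K" "\<eta> \<in> nodes \<V> K" and K: "K \<subseteq> \<V>"
  shows "sections_inverse K \<xi> \<eta> \<noteq> 0"
proof (cases "is_res \<xi> \<and> is_res \<eta>")
  case True
  then obtain u b where "\<xi> = Res u" "\<eta> = Res b" by (cases \<xi>; cases \<eta>) auto
  then show ?thesis using s S K inv_diff_pos[of u _ b K] by (fastforce simp: Res_sect_Res nodes_def)
next
  case False
  have walk: "vertex \<xi> \<notin> K" "(vertex \<xi>, vertex \<eta>) \<in> (U \<inter> (- K) \<times> (- K))\<^sup>*"
    using s False by (auto simp: sect_def split: if_splits)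
  have "vertex \<eta> \<in> \<V>" using S by (auto simp: nodes_def)
  moreover have "vertex \<eta> \<notin> K" using avoiding_walk_end[OF walk(2,1)] .
  ultimately have "inv_on (\<V> - K) L (vertex \<xi>) (vertex \<eta>) > 0" using inv_sub_pos[OF walk(2)] by simp
  then show ?thesis using False by (cases \<xi>; cases \<eta>) auto
qed

end

text \<open>Eliminating \<open>b2\<close> leaves \<open>a2\<close> times a form in
  \<open>a1\<close>, \<open>b1\<close> with non-negative coefficients. Here \<open>\<alpha>\<close>
  stands for minus the diagonal entry at \<open>Var a\<close> and \<open>\<beta>\<close> for the one
  at \<open>Res b\<close>; equal signs of these entries would make the form indefinite.\<close>

lemma no_cancellation:
  fixes \<alpha> \<beta> a1 b1 a2 b2 :: real
  assumes "\<alpha> > 0" "\<beta> \<ge> 0" "\<beta> * a1 * a2 = \<alpha> * b1 * b2" "a1 * b2 + b1 * a2 = 0"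
    and "a1 \<noteq> 0 \<or> b1 \<noteq> 0" "a2 \<noteq> 0 \<or> b2 \<noteq> 0" "\<beta> \<noteq> 0 \<or> b1 \<noteq> 0 \<or> b2 \<noteq> 0"
  shows False
proof -
  have "a2 * (\<beta> * a1\<^sup>2 + \<alpha> * b1\<^sup>2) = a1 * (\<beta> * a1 * a2) + \<alpha> * b1 * (b1 * a2)"
    by (simp add: power2_eq_square algebra_simps)
  also have "\<dots> = \<alpha> * b1 * (a1 * b2 + b1 * a2)" unfolding assms(3) by (simp add: algebra_simps)
  also have "\<dots> = 0" by (simp add: assms(4))
  finally have *: "a2 = 0 \<or> \<beta> * a1\<^sup>2 + \<alpha> * b1\<^sup>2 = 0" by simp
  show False
  proof (cases "a2 = 0")
    case True
    then show False using assms by auto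
  next
    case False
    then have z: "\<beta> * a1\<^sup>2 + \<alpha> * b1\<^sup>2 = 0" using * by simp
    have "\<beta> * a1\<^sup>2 \<ge> 0" "\<alpha> * b1\<^sup>2 \<ge> 0" using assms(1,2) by auto
    then have "\<beta> * a1\<^sup>2 = 0" "\<alpha> * b1\<^sup>2 = 0" using z by linarith+
    then have "b1 = 0" "\<beta> = 0 \<or> a1 = 0" using assms(1) by auto
    then show False using assms False by auto
  qed
qed

lemma generic_saddle_inverse:
  assumes cg: "chain_graph N U D" and K: "K \<subseteq> verts N" and "D' \<subseteq> D"
  shows "\<exists>E X. (\<forall>v w. E v w \<noteq> 0 \<longrightarrow> (w, v) \<in> D') \<and>
    right_inverse_on (nodes (verts N) K)
      (saddle (grounded_laplacian N U) (\<lambda>v w. grounded_laplacian N U v w + E v w)) X \<and>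
    (\<forall>\<xi>\<in>nodes (verts N) K. \<forall>\<eta>\<in>nodes (verts N) K. (\<xi>, \<eta>) \<in> conn U D' K \<longrightarrow> X \<xi> \<eta> \<noteq> 0)"
proof -
  let ?V = "verts N" and ?L = "grounded_laplacian N U"
  let ?S = "nodes ?V K"
  have U: "\<And>a b. (a, b) \<in> U \<Longrightarrow> (b, a) \<in> U" "U \<subseteq> ?V \<times> ?V" "\<And>v. (v, v) \<notin> U"
    using cg unfolding chain_graph_def sym_def by blast+
  have pd: "pd_on ?V ?L" by (rule laplacian_pd[OF U])
  have finS: "finite ?S" by (intro finite_nodes finite_verts)
  have "finite D" using chain_graphD(2)[OF cg] finite_verts by (meson finite_SigmaI finite_subset)
  then have "finite D'" using assms(3) by (rule finite_subset[rotated])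
  then show ?thesis using assms(3)
  proof (induction D' rule: finite_induct)
    case empty
    have "conn U {} K = sect U K" by (auto simp: conn_def cross_def)
    then show ?case
      using sections_inverse[OF U, of K] sections_inverse_nonzero[OF U _ _ _ K]
      by (intro exI[of _ "\<lambda>_ _. 0"] exI[of _ "sections_inverse N U K"]) simp
  next
    case (insert e D0)
    obtain a b where e: "e = (a, b)" by fastforce
    have ab: "a \<in> ?V" "b \<in> ?V" using insert.prems e chain_graphD(2)[OF cg] by auto
    have "D0 \<subseteq> D" using insert.prems by simp
    from insert.IH[OF this] obtain E X where "\<forall>v w. E v w \<noteq> 0 \<longrightarrow> (w, v) \<in> D0"
      and inv: "right_inverse_on ?S (saddle ?L (\<lambda>v w. ?L v w + E v w)) X"
      and "\<forall>\<xi>\<in>?S. \<forall>\<eta>\<in>?S. (\<xi>, \<eta>) \<in> conn U D0 K \<longrightarrow> X \<xi> \<eta> \<noteq> 0"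
      by (elim exE conjE)
    then have E: "\<And>v w. E v w \<noteq> 0 \<Longrightarrow> (w, v) \<in> D0"
      and nz: "\<And>\<xi> \<eta>. \<xi> \<in> ?S \<Longrightarrow> \<eta> \<in> ?S \<Longrightarrow> (\<xi>, \<eta>) \<in> conn U D0 K \<Longrightarrow> X \<xi> \<eta> \<noteq> 0"
      by simp_all
    show ?case
    proof (cases "a \<in> K")
      case True
      \<comment> \<open>An arrow with tail in \<open>K\<close> creates no connection, so its
        coefficient may stay 0.\<close>
      then have "X \<xi> \<eta> \<noteq> 0" if "\<xi> \<in> ?S" "\<eta> \<in> ?S" "(\<xi>, \<eta>) \<in> conn U (insert e D0) K" for \<xi> \<eta>
        using conn_insert[OF that(3)[unfolded e]] that(1,2) nz by blast
      then show ?thesis using E inv by (intro exI[of _ E] exI[of _ X]) simp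
    next
      case False
      define p q where "p = Var a" and "q = Res b"
      have pq: "p \<in> ?S" "q \<in> ?S" "p \<noteq> q" using ab False by (auto simp: p_def q_def nodes_def)
      have signs: "X p p < 0" "X q q \<ge> 0"
        using saddle_inverse_diag[OF pd inv] ab False by (auto simp: p_def q_def)
      have sym: "X \<xi> \<eta> = X \<eta> \<xi>" if "\<xi> \<in> ?S" "\<eta> \<in> ?S" for \<xi> \<eta>
      proof (rule right_inverse_sym[OF finS _ _ that])
        fix i j assume ij: "i \<in> ?S" "j \<in> ?S"
        show "saddle ?L (\<lambda>v w. ?L v w + E v w) i j = saddle ?L (\<lambda>v w. ?L v w + E v w) j i"
          by (rule saddle_sym[OF _ ij]) (rule pd_onD(2)[OF pd])
        show "(\<Sum>k\<in>?S. saddle ?L (\<lambda>v w. ?L v w + E v w) i k * X k j) = (if i = j then 1 else 0)"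
          by (rule right_inverse_onD[OF inv ij])
      qed
      let ?\<Delta> = "[:1, 2 * X p q, (X p q)\<^sup>2 - X p p * X q q:]"
      define s where "s \<xi> \<eta> = X \<xi> p * X q \<eta> + X \<xi> q * X p \<eta>" for \<xi> \<eta>
      define r where "r \<xi> \<eta> = X q q * X \<xi> p * X p \<eta> + X p p * X \<xi> q * X q \<eta>" for \<xi> \<eta>
      \<comment> \<open>The updated entry times \<open>\<Delta>\<close>, as a polynomial in
        \<open>t\<close>. Its coefficients vanish together only if the old entry, \<open>s\<close>
        and \<open>r\<close> do, and then \<open>no_cancellation\<close> applies. Finitely many
        \<open>t\<close> are bad for some pair of indices.\<close>
      define f where "f \<xi> \<eta> = Polynomial.smult (X \<xi> \<eta>) ?\<Delta> + [:0, - s \<xi> \<eta>, r \<xi> \<eta> - X p q * s \<xi> \<eta>:]" for \<xi> \<eta>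
      define bad where "bad = {t. poly ?\<Delta> t = 0} \<union>
        (\<Union>(\<xi>, \<eta>)\<in>{(\<xi>, \<eta>) \<in> ?S \<times> ?S. f \<xi> \<eta> \<noteq> 0}. {t. poly (f \<xi> \<eta>) t = 0})"
      have "finite bad"
        unfolding bad_def using finS
        by (intro finite_UnI finite_UN_I poly_roots_finite)
           (auto intro: finite_subset[of _ "?S \<times> ?S"] poly_roots_finite)
      then obtain t where t: "t \<notin> bad" using ex_new_if_finite infinite_UNIV_char_0 by blast
      define \<Delta> where "\<Delta> = poly ?\<Delta> t"
      have \<Delta>0: "\<Delta> \<noteq> 0" using t by (simp add: bad_def \<Delta>_def)
      have \<Delta>: "(1 + t * X p q)\<^sup>2 - t\<^sup>2 * (X p p * X q q) = \<Delta>"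
        by (simp add: \<Delta>_def power2_eq_square algebra_simps)
      define E' where "E' v w = E v w + (if v = b \<and> w = a then t else 0)" for v w
      define X' where "X' \<xi> \<eta> = X \<xi> \<eta> -
        t * (X \<xi> p * (((1 + t * X p q) * X q \<eta> - t * X q q * X p \<eta>) / \<Delta>) +
             X \<xi> q * (((1 + t * X p q) * X p \<eta> - t * X p p * X q \<eta>) / \<Delta>))" for \<xi> \<eta>
      have "right_inverse_on ?S (saddle ?L (\<lambda>v w. ?L v w + E' v w)) X'"
        unfolding X'_def
      proof (rule right_inverse_update[OF finS inv sym[OF pq(2,1)] pq \<Delta> \<Delta>0])
        fix \<xi> \<eta>
        show "saddle ?L (\<lambda>v w. ?L v w + E' v w) \<xi> \<eta> = saddle ?L (\<lambda>v w. ?L v w + E v w) \<xi> \<eta> +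
            (if \<xi> = p \<and> \<eta> = q \<or> \<xi> = q \<and> \<eta> = p then t else 0)"
          by (cases \<xi>; cases \<eta>) (auto simp: p_def q_def E'_def)
      qed
      moreover have "X' \<xi> \<eta> \<noteq> 0" if S: "\<xi> \<in> ?S" "\<eta> \<in> ?S" and c: "(\<xi>, \<eta>) \<in> conn U (insert e D0) K" for \<xi> \<eta>
      proof -
        have "f \<xi> \<eta> \<noteq> 0"
        proof
          assume "f \<xi> \<eta> = 0"
          then have "X \<xi> \<eta> = 0" "s \<xi> \<eta> = 0" "r \<xi> \<eta> = 0" by (auto simp: f_def)
          then have eqs: "X q q * X \<xi> p * X p \<eta> = (- X p p) * X \<xi> q * X q \<eta>"
            "X \<xi> p * X q \<eta> + X \<xi> q * X p \<eta> = 0" by (auto simp: s_def r_def)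
          have "(\<xi>, \<eta>) \<notin> conn U D0 K" using nz[OF S] \<open>X \<xi> \<eta> = 0\<close> by blast
          then have "X \<xi> p \<noteq> 0 \<or> X \<xi> q \<noteq> 0" "X p \<eta> \<noteq> 0 \<or> X q \<eta> \<noteq> 0"
            "X q q \<noteq> 0 \<or> X \<xi> q \<noteq> 0 \<or> X q \<eta> \<noteq> 0"
            using conn_insert[OF c[unfolded e]] nz S pq unfolding p_def q_def by blast+
          then show False
            using no_cancellation[OF _ signs(2) eqs] signs(1) by simp
        qed
        then have "poly (f \<xi> \<eta>) t \<noteq> 0" using t S by (auto simp: bad_def)
        moreover have "\<Delta> * X' \<xi> \<eta> = poly (f \<xi> \<eta>) t"
        proof -
          have "\<Delta> * X' \<xi> \<eta> = \<Delta> * X \<xi> \<eta> -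
              t * (X \<xi> p * ((1 + t * X p q) * X q \<eta> - t * X q q * X p \<eta>) +
                   X \<xi> q * ((1 + t * X p q) * X p \<eta> - t * X p p * X q \<eta>))"
            unfolding X'_def using \<Delta>0 by (simp add: field_simps)
          also have "\<dots> = poly (f \<xi> \<eta>) t"
            unfolding f_def \<Delta>_def s_def r_def by (simp add: algebra_simps)
          finally show ?thesis .
        qed
        ultimately show ?thesis by auto
      qed
      moreover have "(w, v) \<in> insert e D0" if "E' v w \<noteq> 0" for v w
        using that E[of v w] e by (auto simp: E'_def split: if_splits)
      ultimately show ?thesis by (intro exI[of _ E'] exI[of _ X'] conjI allI ballI impI)
    qed
  qed
qed

section \<open>Conditional independence of regular Gaussians\<close>

definition gquad :: "nat set \<Rightarrow> (nat \<Rightarrow> nat \<Rightarrow> real) \<Rightarrow> (nat \<Rightarrow> real) \<Rightarrow> real" where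
  "gquad A Sg d = (\<Sum>i\<in>A. d i * mvec A (inv_on A Sg) d i)"

definition gnorm :: "nat set \<Rightarrow> (nat \<Rightarrow> nat \<Rightarrow> real) \<Rightarrow> real" where
  "gnorm A Sg = 1 / sqrt ((2 * pi) ^ card A * det_on A Sg)"

lemma gdens_shift: "gdens A mu Sg (\<lambda>i. mu i + d i) = exp (- gquad A Sg d / 2) * gnorm A Sg"
  by (simp add: gdens_def gquad_def gnorm_def quad_eq)

lemma gnorm_pos: "pd_on A Sg \<Longrightarrow> gnorm A Sg > 0"
  using pd_on_det_pos[of A Sg] by (simp add: gnorm_def)

lemma gquad_zero: "gquad A Sg (\<lambda>_. 0) = 0"
  by (simp add: gquad_def)

lemma mvec_inv_outside: "pd_on A Sg \<Longrightarrow> i \<notin> A \<Longrightarrow> mvec A (inv_on A Sg) d i = 0"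
  using inv_on_outside[of A Sg] by (simp add: mvec_def)

text \<open>Polarisation at a unit vector: the means by which identities between densities, at all
  points, are turned into identities between precision matrices.\<close>

lemma gquad_polar:
  assumes pd: "pd_on A Sg"
  shows "gquad A Sg (\<lambda>k. of_bool (k = v) + x k) = gquad A Sg (\<lambda>k. of_bool (k = v)) + gquad A Sg x
    + 2 * mvec A (inv_on A Sg) x v"
proof -
  let ?W = "inv_on A Sg" and ?e = "\<lambda>k. of_bool (k = v) :: real"
  have fin: "finite A" using pd by (rule pd_onD)
  have sel: "(\<Sum>k\<in>A. ?e k * mvec A ?W x k) = mvec A ?W x v"
  proof -
    have "(\<Sum>k\<in>A. ?e k * mvec A ?W x k) = (\<Sum>k\<in>A. if k = v then mvec A ?W x k else 0)"
      by (intro sum.cong) auto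
    then show ?thesis using fin mvec_inv_outside[OF pd, of v] by simp
  qed
  have sw: "(\<Sum>k\<in>A. x k * mvec A ?W ?e k) = (\<Sum>k\<in>A. ?e k * mvec A ?W x k)"
    by (rule pd_on_swap[OF pd_on_inv_on[OF pd]])
  have "gquad A Sg (\<lambda>k. ?e k + x k) = gquad A Sg ?e + gquad A Sg x +
      ((\<Sum>k\<in>A. ?e k * mvec A ?W x k) + (\<Sum>k\<in>A. x k * mvec A ?W ?e k))"
    unfolding gquad_def mvec_add by (simp only: distrib_left distrib_right sum.distrib ac_simps)
  then show ?thesis unfolding sw sel by simp
qed

lemma mvec_unit:
  assumes "pd_on A Sg"
  shows "mvec A (inv_on A Sg) (\<lambda>k. of_bool (k = j)) i = inv_on A Sg i j"
proof -
  have "mvec A (inv_on A Sg) (\<lambda>k. of_bool (k = j)) i = (\<Sum>k\<in>A. if k = j then inv_on A Sg i k else 0)"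
    unfolding mvec_def by (intro sum.cong) auto
  then show ?thesis using pd_onD(1)[OF assms] inv_on_outside[OF assms] by simp
qed

text \<open>The last hypothesis says that a combination of \<open>I\<close> and \<open>K\<close>
  uncorrelated with \<open>K\<close> is uncorrelated with \<open>J\<close>. So the residual of
  \<open>i\<close> after regression on the rest of \<open>I\<close> and \<open>K\<close> does not
  change when \<open>J\<close> is added, and both determinants gain the same factor.\<close>

lemma det_on_cond_indep:
  assumes "finite I" "pd_on (I \<union> J \<union> K) Sg" "I \<inter> (J \<union> K) = {}" "J \<inter> K = {}"
    and "\<And>v j. (\<And>k. k \<in> K \<Longrightarrow> mvec (I \<union> K) Sg v k = 0) \<Longrightarrow> j \<in> J \<Longrightarrow> mvec (I \<union> K) Sg v j = 0"
  shows "det_on (I \<union> J \<union> K) Sg * det_on K Sg = det_on (I \<union> K) Sg * det_on (J \<union> K) Sg"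
  using assms
proof (induction I rule: finite_induct)
  case empty
  then show ?case by simp
next
  case (insert i I)
  let ?A = "I \<union> K" and ?B = "I \<union> J \<union> K"
  have sets: "insert i I \<union> K = insert i ?A" "insert i I \<union> J \<union> K = insert i ?B" by auto
  have pdB: "pd_on (insert i ?B) Sg" using insert.prems(1) by simp
  then have pdA: "pd_on (insert i ?A) Sg" by (rule pd_on_subset) auto
  have notin: "i \<notin> ?A" "i \<notin> ?B" using insert.hyps(2) insert.prems(2) by auto
  have fin: "finite (insert i ?B)" using pdB by (rule pd_onD)
  have "det_on ?B Sg * det_on K Sg = det_on ?A Sg * det_on (J \<union> K) Sg"
  proof (rule insert.IH)
    show "pd_on ?B Sg" using pdB by (rule pd_on_subset) auto
    fix v j assume v: "\<And>k. k \<in> K \<Longrightarrow> mvec ?A Sg v k = 0" and j: "j \<in> J"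
    have ext: "mvec (insert i ?A) Sg (v(i := 0)) l = mvec ?A Sg v l" for l
    proof -
      have "mvec (insert i ?A) Sg (v(i := 0)) l = mvec ?A Sg (v(i := 0)) l"
        using fin by (intro mvec_restrict) auto
      also have "\<dots> = mvec ?A Sg v l" using notin by (intro mvec_cong) auto
      finally show ?thesis .
    qed
    show "mvec ?A Sg v j = 0"
      using insert.prems(4)[of "v(i := 0)" j] v j unfolding sets ext by blast
  qed (use insert.prems(2,3) in auto)
  obtain u where u: "u i = 1" "\<And>l. l \<in> ?A \<Longrightarrow> mvec (insert i ?A) Sg u l = 0"
    using pd_on_regression[OF pdA notin(1)] by blast
  define u' where "u' l = (if l \<in> insert i ?A then u l else 0)" for l
  have ext: "mvec (insert i ?B) Sg u' l = mvec (insert i ?A) Sg u l" for l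
  proof -
    have "mvec (insert i ?B) Sg u' l = mvec (insert i ?A) Sg u' l"
      using fin by (intro mvec_restrict) (auto simp: u'_def)
    also have "\<dots> = mvec (insert i ?A) Sg u l" by (intro mvec_cong) (auto simp: u'_def)
    finally show ?thesis .
  qed
  have uJ: "mvec (insert i ?A) Sg u j = 0" if "j \<in> J" for j
    using insert.prems(4)[of u j] u(2) that unfolding sets by blast
  have "det_on (insert i ?A) Sg = mvec (insert i ?A) Sg u i * det_on ?A Sg"
    by (rule det_on_insert_regression[OF pdA notin(1) u])
  moreover have "det_on (insert i ?B) Sg = mvec (insert i ?B) Sg u' i * det_on ?B Sg"
  proof (rule det_on_insert_regression[OF pdB notin(2)])
    show "u' i = 1" using u by (simp add: u'_def)
    show "mvec (insert i ?B) Sg u' l = 0" if "l \<in> ?B" for l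
      unfolding ext using that u(2) uJ by blast
  qed
  ultimately show ?case
    using \<open>det_on ?B Sg * det_on K Sg = det_on ?A Sg * det_on (J \<union> K) Sg\<close>
    unfolding sets ext by (simp add: mult.assoc)
qed

lemma cond_indepI:
  assumes pd: "pd_on (I \<union> J \<union> K) Sg" and disj: "I \<inter> J = {}" "I \<inter> K = {}" "J \<inter> K = {}"
    and orth: "\<And>w i. (\<And>k. k \<in> K \<Longrightarrow> mvec (J \<union> K) Sg w k = 0) \<Longrightarrow> i \<in> I \<Longrightarrow> mvec (J \<union> K) Sg w i = 0"
  shows "cond_indep mu Sg I J K"
proof -
  let ?S = "I \<union> J \<union> K"
  have finS: "finite ?S" using pd by (rule pd_onD)
  have pds: "pd_on (I \<union> K) Sg" "pd_on (J \<union> K) Sg" "pd_on K Sg" using pd by (auto elim: pd_on_subset)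
  have ext: "mvec ?S Sg w l = mvec A Sg w l" if "A \<subseteq> ?S" "\<And>l. l \<notin> A \<Longrightarrow> w l = 0" for w l A
    using that finS by (intro mvec_restrict) auto
  \<comment> \<open>The same condition with \<open>I\<close> and \<open>J\<close> exchanged: pair
    \<open>v\<close> with the residual \<open>w\<close> of \<open>j\<close> after regression on
    \<open>K\<close> and use the symmetry of \<open>Sg\<close>.\<close>
  have orth': "mvec (I \<union> K) Sg v j = 0" if v: "\<And>k. k \<in> K \<Longrightarrow> mvec (I \<union> K) Sg v k = 0" and j: "j \<in> J" for v j
  proof -
    have "j \<notin> K" using j disj by blast
    have "pd_on (insert j K) Sg" using pds(2) by (rule pd_on_subset) (use j in auto)
    from pd_on_regression[OF this \<open>j \<notin> K\<close>] obtain w0 where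
      w0: "w0 j = 1" "\<And>l. l \<in> K \<Longrightarrow> mvec (insert j K) Sg w0 l = 0" by blast
    define w where "w l = (if l \<in> insert j K then w0 l else 0)" for l
    define v' where "v' l = (if l \<in> I \<union> K then v l else 0)" for l
    have wext: "mvec A Sg w l = mvec (insert j K) Sg w0 l" if "insert j K \<subseteq> A" "finite A" for A l
    proof -
      have "mvec A Sg w l = mvec (insert j K) Sg w l" using that by (intro mvec_restrict) (auto simp: w_def)
      also have "\<dots> = mvec (insert j K) Sg w0 l" by (intro mvec_cong) (auto simp: w_def)
      finally show ?thesis .
    qed
    have wS: "mvec ?S Sg w l = mvec (J \<union> K) Sg w l" for l
      using wext[of ?S l] wext[of "J \<union> K" l] finS j by auto
    have wK: "mvec (J \<union> K) Sg w l = 0" if "l \<in> K" for l using wext[of "J \<union> K" l] w0(2) that finS j by auto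
    have w0S: "mvec ?S Sg w l = 0" if "l \<in> I \<union> K" for l
      unfolding wS using that wK orth[OF wK] by blast
    have vS: "mvec ?S Sg v' l = mvec (I \<union> K) Sg v l" for l
    proof -
      have "mvec ?S Sg v' l = mvec (I \<union> K) Sg v' l" by (rule ext) (auto simp: v'_def)
      also have "\<dots> = mvec (I \<union> K) Sg v l" by (intro mvec_cong) (auto simp: v'_def)
      finally show ?thesis .
    qed
    have "(\<Sum>l\<in>?S. w l * mvec ?S Sg v' l) = (\<Sum>l\<in>?S. if l = j then mvec ?S Sg v' l else 0)"
    proof (intro sum.cong refl)
      fix l assume "l \<in> ?S"
      show "w l * mvec ?S Sg v' l = (if l = j then mvec ?S Sg v' l else 0)"
        using v[of l] w0(1) unfolding vS by (auto simp: w_def)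
    qed
    also have "\<dots> = mvec ?S Sg v' j" using finS j by simp
    finally have "mvec ?S Sg v' j = (\<Sum>l\<in>?S. w l * mvec ?S Sg v' l)" by simp
    also have "\<dots> = (\<Sum>l\<in>?S. v' l * mvec ?S Sg w l)" by (rule pd_on_swap[OF pd])
    also have "\<dots> = 0"
    proof (intro sum.neutral ballI)
      fix l
      show "v' l * mvec ?S Sg w l = 0" using w0S[of l] by (auto simp: v'_def)
    qed
    finally show ?thesis unfolding vS .
  qed
  have dets: "det_on ?S Sg * det_on K Sg = det_on (I \<union> K) Sg * det_on (J \<union> K) Sg"
    using finS pd disj orth' by (intro det_on_cond_indep) auto
  have quads: "gquad ?S Sg d + gquad K Sg d = gquad (I \<union> K) Sg d + gquad (J \<union> K) Sg d" for d
  proof -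
    let ?a = "mvec (I \<union> K) (inv_on (I \<union> K) Sg) d"
    let ?b = "mvec (J \<union> K) (inv_on (J \<union> K) Sg) d"
    let ?c = "mvec K (inv_on K Sg) d"
    have out: "?a l = 0" if "l \<notin> I \<union> K" for l using mvec_inv_outside[OF pds(1) that] .
    have outb: "?b l = 0" if "l \<notin> J \<union> K" for l using mvec_inv_outside[OF pds(2) that] .
    have outc: "?c l = 0" if "l \<notin> K" for l using mvec_inv_outside[OF pds(3) that] .
    have A: "mvec ?S Sg ?a l = mvec (I \<union> K) Sg ?a l" for l by (rule ext) (use out in auto)
    have B: "mvec ?S Sg ?b l = mvec (J \<union> K) Sg ?b l" for l by (rule ext) (use outb in auto)
    have C: "mvec ?S Sg ?c l = mvec K Sg ?c l" for l by (rule ext) (use outc in auto)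
    have CI: "mvec (I \<union> K) Sg ?c l = mvec K Sg ?c l" for l
      using finS outc by (intro mvec_restrict) auto
    have CJ: "mvec (J \<union> K) Sg ?c l = mvec K Sg ?c l" for l
      using finS outc by (intro mvec_restrict) auto
    \<comment> \<open>On \<open>I\<close> the terms of \<open>?b\<close> and \<open>?c\<close>
      cancel by \<open>orth\<close>, on \<open>J\<close> those of \<open>?a\<close> and
      \<open>?c\<close> by \<open>orth'\<close>, and on \<open>K\<close> all three give
      \<open>d\<close>.\<close>
    have sol: "mvec ?S Sg (\<lambda>l. (?a l + ?b l) - ?c l) l = d l" if l: "l \<in> ?S" for l
    proof -
      have e: "mvec ?S Sg (\<lambda>l. (?a l + ?b l) - ?c l) l =
          mvec (I \<union> K) Sg ?a l + mvec (J \<union> K) Sg ?b l - mvec K Sg ?c l"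
        unfolding mvec_diff mvec_add A B C ..
      have aI: "mvec (I \<union> K) Sg ?a l = d l" if "l \<in> I \<union> K" for l by (rule mvec_inv_on[OF pds(1) that])
      have bJ: "mvec (J \<union> K) Sg ?b l = d l" if "l \<in> J \<union> K" for l by (rule mvec_inv_on[OF pds(2) that])
      have cK: "mvec K Sg ?c l = d l" if "l \<in> K" for l by (rule mvec_inv_on[OF pds(3) that])
      have bc: "mvec (J \<union> K) Sg (\<lambda>l. ?b l - ?c l) l = mvec (J \<union> K) Sg ?b l - mvec K Sg ?c l" for l
        unfolding mvec_diff CJ ..
      have ac: "mvec (I \<union> K) Sg (\<lambda>l. ?a l - ?c l) l = mvec (I \<union> K) Sg ?a l - mvec K Sg ?c l" for l
        unfolding mvec_diff CI ..
      have bcI: "mvec (J \<union> K) Sg ?b l - mvec K Sg ?c l = 0" if "l \<in> I" for l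
        unfolding bc[symmetric] by (rule orth[OF _ that]) (use bJ cK in \<open>simp add: bc\<close>)
      have acJ: "mvec (I \<union> K) Sg ?a l - mvec K Sg ?c l = 0" if "l \<in> J" for l
        unfolding ac[symmetric] by (rule orth'[OF _ that]) (use aI cK in \<open>simp add: ac\<close>)
      from l consider "l \<in> I" | "l \<in> J" | "l \<in> K" by blast
      then show ?thesis
      proof cases
        case 1
        then show ?thesis using e aI[of l] bcI[of l] by simp
      next
        case 2
        then show ?thesis using e bJ[of l] acJ[of l] by simp
      next
        case 3
        then show ?thesis using e aI[of l] bJ[of l] cK[of l] by simp
      qed
    qed
    have "gquad ?S Sg d = (\<Sum>l\<in>?S. d l * ((?a l + ?b l) - ?c l))"
      unfolding gquad_def
    proof (intro sum.cong refl)
      fix l assume "l \<in> ?S"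
      then show "d l * mvec ?S (inv_on ?S Sg) d l = d l * ((?a l + ?b l) - ?c l)"
        by (simp only: inv_on_unique[OF pd sol])
    qed
    also have "\<dots> = (\<Sum>l\<in>?S. d l * ?a l) + (\<Sum>l\<in>?S. d l * ?b l) - (\<Sum>l\<in>?S. d l * ?c l)"
      by (simp only: right_diff_distrib distrib_left sum.distrib sum_subtractf)
    also have "(\<Sum>l\<in>?S. d l * ?a l) = gquad (I \<union> K) Sg d"
      unfolding gquad_def by (rule sum.mono_neutral_right) (use finS out in auto)
    also have "(\<Sum>l\<in>?S. d l * ?b l) = gquad (J \<union> K) Sg d"
      unfolding gquad_def by (rule sum.mono_neutral_right) (use finS outb in auto)
    also have "(\<Sum>l\<in>?S. d l * ?c l) = gquad K Sg d"
      unfolding gquad_def by (rule sum.mono_neutral_right) (use finS outc in auto)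
    finally show ?thesis by simp
  qed
  have norms: "gnorm ?S Sg * gnorm K Sg = gnorm (I \<union> K) Sg * gnorm (J \<union> K) Sg"
  proof -
    have fins: "finite I" "finite J" "finite K" using finS by auto
    have "card ?S + card K = card (I \<union> K) + card (J \<union> K)"
      using fins disj by (simp add: card_Un_disjoint Int_Un_distrib2)
    then have pis: "(2 * pi) ^ card ?S * (2 * pi) ^ card K = (2 * pi) ^ card (I \<union> K) * (2 * pi) ^ card (J \<union> K)"
      by (simp only: power_add[symmetric])
    have "((2 * pi) ^ card ?S * det_on ?S Sg) * ((2 * pi) ^ card K * det_on K Sg) =
        ((2 * pi) ^ card ?S * (2 * pi) ^ card K) * (det_on ?S Sg * det_on K Sg)"
      by (simp only: mult_ac)
    also have "\<dots> = ((2 * pi) ^ card (I \<union> K) * det_on (I \<union> K) Sg) * ((2 * pi) ^ card (J \<union> K) * det_on (J \<union> K) Sg)"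
      unfolding pis dets by (simp only: mult_ac)
    finally show ?thesis unfolding gnorm_def by (simp add: real_sqrt_mult[symmetric])
  qed
  show ?thesis
    unfolding cond_indep_def
  proof
    fix x
    define d where "d i = x i - mu i" for i
    have x: "x = (\<lambda>i. mu i + d i)" by (auto simp: d_def)
    have "exp (- gquad ?S Sg d / 2) * exp (- gquad K Sg d / 2) =
        exp (- gquad (I \<union> K) Sg d / 2) * exp (- gquad (J \<union> K) Sg d / 2)"
      using quads[of d] by (simp add: exp_add[symmetric] field_simps)
    then have "(exp (- gquad ?S Sg d / 2) * exp (- gquad K Sg d / 2)) * (gnorm ?S Sg * gnorm K Sg) =
        (exp (- gquad (I \<union> K) Sg d / 2) * exp (- gquad (J \<union> K) Sg d / 2)) * (gnorm (I \<union> K) Sg * gnorm (J \<union> K) Sg)"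
      by (simp only: norms)
    then show "gdens ?S mu Sg x * gdens K mu Sg x = gdens (I \<union> K) mu Sg x * gdens (J \<union> K) mu Sg x"
      unfolding x gdens_shift by (simp only: mult_ac)
  qed
qed

text \<open>\<open>g\<close> holds the coefficients of the residual of \<open>j\<close> given
  \<open>K\<close>. Independence makes it uncorrelated with \<open>i\<close> too.\<close>

lemma cond_indepD:
  assumes pd: "pd_on (I \<union> J \<union> K) Sg" and disj: "I \<inter> J = {}" "I \<inter> K = {}" "J \<inter> K = {}"
    and ci: "cond_indep mu Sg I J K" and ij: "i \<in> I" "j \<in> J"
  shows "\<exists>g. g j = 1 \<and> (\<forall>v. g v \<noteq> 0 \<longrightarrow> v = j \<or> v \<in> K) \<and> (\<forall>k\<in>insert i K. mvec (I \<union> J \<union> K) Sg g k = 0)"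
proof -
  let ?S = "I \<union> J \<union> K"
  let ?W = "inv_on ?S Sg"
  have finS: "finite ?S" using pd by (rule pd_onD)
  have pds: "pd_on (I \<union> K) Sg" "pd_on (J \<union> K) Sg" "pd_on K Sg" using pd by (auto elim: pd_on_subset)
  have pos: "gnorm ?S Sg > 0" "gnorm K Sg > 0" using gnorm_pos pd pds by auto
  have eq: "exp (- gquad ?S Sg d / 2) * gnorm ?S Sg * (exp (- gquad K Sg d / 2) * gnorm K Sg) =
      exp (- gquad (I \<union> K) Sg d / 2) * gnorm (I \<union> K) Sg * (exp (- gquad (J \<union> K) Sg d / 2) * gnorm (J \<union> K) Sg)" for d
    using ci[unfolded cond_indep_def, rule_format, of "\<lambda>i. mu i + d i"] unfolding gdens_shift .
  have norms: "gnorm ?S Sg * gnorm K Sg = gnorm (I \<union> K) Sg * gnorm (J \<union> K) Sg"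
    using eq[of "\<lambda>_. 0"] by (simp add: gquad_zero)
  have quads: "gquad ?S Sg d + gquad K Sg d = gquad (I \<union> K) Sg d + gquad (J \<union> K) Sg d" for d
  proof -
    have "exp (- gquad ?S Sg d / 2) * exp (- gquad K Sg d / 2) * (gnorm ?S Sg * gnorm K Sg) =
        exp (- gquad (I \<union> K) Sg d / 2) * exp (- gquad (J \<union> K) Sg d / 2) * (gnorm (I \<union> K) Sg * gnorm (J \<union> K) Sg)"
      using eq[of d] by (simp only: mult_ac)
    then have "exp (- gquad ?S Sg d / 2) * exp (- gquad K Sg d / 2) =
        exp (- gquad (I \<union> K) Sg d / 2) * exp (- gquad (J \<union> K) Sg d / 2)"
      unfolding norms[symmetric] using pos by simp
    then have "exp (- gquad ?S Sg d / 2 + - gquad K Sg d / 2) =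
        exp (- gquad (I \<union> K) Sg d / 2 + - gquad (J \<union> K) Sg d / 2)" by (simp only: exp_add)
    then show ?thesis by simp
  qed
  \<comment> \<open>Polarising at two unit vectors leaves the mixed entry alone; each of the three
    smaller index sets misses \<open>i\<close> or \<open>l\<close>.\<close>
  have W0: "?W i l = 0" if i: "i \<in> I" and l: "l \<in> J" for i l
  proof -
    let ?d = "\<lambda>k. of_bool (k = i) + of_bool (k = l) :: real"
    have "inv_on (I \<union> K) Sg i l = 0" "inv_on (J \<union> K) Sg i l = 0" "inv_on K Sg i l = 0"
      using inv_on_outside[OF pds(1), of i l] inv_on_outside[OF pds(2), of i l]
        inv_on_outside[OF pds(3), of i l] i l disj by blast+
    then show ?thesis
      using quads[of ?d] quads[of "\<lambda>k. of_bool (k = i)"] quads[of "\<lambda>k. of_bool (k = l)"]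
      by (simp add: gquad_polar[OF pd] gquad_polar[OF pds(1)] gquad_polar[OF pds(2)] gquad_polar[OF pds(3)]
          mvec_unit[OF pd] mvec_unit[OF pds(1)] mvec_unit[OF pds(2)] mvec_unit[OF pds(3)])
  qed
  \<comment> \<open>Solve on the block \<open>J\<close> of the precision matrix. As its mixed block
    with \<open>I\<close> is 0, the image \<open>?g\<close> of the solution lives on
    \<open>j\<close> and \<open>K\<close>, while \<open>Sg\<close> maps \<open>?g\<close> back to a
    vector supported on \<open>J\<close>.\<close>
  have "pd_on J ?W" using pd_on_inv_on[OF pd] by (rule pd_on_subset) auto
  from pd_on_solve[OF this, of "\<lambda>k. if k = j then 1 else 0"] obtain x0 where
    x0: "\<And>l. l \<in> J \<Longrightarrow> mvec J ?W x0 l = (if l = j then 1 else 0)" by blast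
  define x where "x l = (if l \<in> J then x0 l else 0)" for l
  have x: "mvec ?S ?W x l = mvec J ?W x0 l" for l
  proof -
    have "mvec ?S ?W x l = mvec J ?W x l" using finS by (intro mvec_restrict) (auto simp: x_def)
    also have "\<dots> = mvec J ?W x0 l" by (intro mvec_cong) (auto simp: x_def)
    finally show ?thesis .
  qed
  let ?g = "mvec ?S ?W x"
  have "?g j = 1" using x x0[OF ij(2)] by simp
  moreover have "v = j \<or> v \<in> K" if "?g v \<noteq> 0" for v
  proof (rule ccontr)
    assume n: "\<not> ?thesis"
    have "v \<in> ?S" using that mvec_inv_outside[OF pd, of v] by blast
    then consider "v \<in> I" | "v \<in> J" using n by blast
    then show False
    proof cases
      case 1
      then have "mvec J ?W x0 v = 0" using W0 by (simp add: mvec_def)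
      then show False using that x by simp
    next
      case 2
      then show False using that x x0[of v] n by simp
    qed
  qed
  moreover have "mvec ?S Sg ?g k = 0" if "k \<in> insert i K" for k
  proof -
    have "mvec ?S Sg ?g k = x k" using that ij by (intro mvec_inv_on[OF pd]) auto
    then show ?thesis using that ij disj by (auto simp: x_def)
  qed
  ultimately show ?thesis by blast
qed

section \<open>The precision system of a chain graph model\<close>

definition comp_prec ::
  "nat \<Rightarrow> (nat \<times> nat) set \<Rightarrow> (nat \<times> nat) set \<Rightarrow> (nat \<Rightarrow> nat \<Rightarrow> real) \<Rightarrow> nat \<Rightarrow> nat \<Rightarrow> real" where
  "comp_prec N U D Sg v w = (if w \<in> comp_of N U v then Omega_of N U D Sg v v w else 0)"

definition arrow_prec ::
  "nat \<Rightarrow> (nat \<times> nat) set \<Rightarrow> (nat \<times> nat) set \<Rightarrow> (nat \<Rightarrow> nat \<Rightarrow> real) \<Rightarrow> nat \<Rightarrow> nat \<Rightarrow> real" where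
  "arrow_prec N U D Sg v w = (if w \<in> comp_of N U v then 0 else Omega_of N U D Sg v v w)"

lemma gaussian_pd: "regular_gaussian N mu Sg \<Longrightarrow> pd_on (verts N) Sg"
  by (simp add: regular_gaussian_def pd_on_def finite_verts)

context
  fixes N U D mu Sg
  assumes cg: "chain_graph N U D" and ng: "in_NG N U D mu Sg"
begin

private abbreviation (input) "V \<equiv> verts N"
private abbreviation (input) "B \<equiv> comp_of N U"
private abbreviation (input) "P v \<equiv> parents D (comp_of N U v)"
private abbreviation (input) "rk v \<equiv> card (ancestors U D v)"

lemma pdV: "pd_on V Sg"
  using ng gaussian_pd unfolding in_NG_def by blast

lemma comp_self: "v \<in> V \<Longrightarrow> v \<in> B v"
  by (simp add: comp_of_def)

lemma comp_eq: "w \<in> B v \<Longrightarrow> B w = B v"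
proof -
  assume "w \<in> B v"
  then have vw: "(v, w) \<in> U\<^sup>*" by (simp add: comp_of_def)
  have "sym (U\<^sup>*)" using cg by (intro sym_rtrancl) (simp add: chain_graph_def)
  then have "(w, v) \<in> U\<^sup>*" using vw by (rule symD)
  then show ?thesis using vw unfolding comp_of_def by (auto intro: rtrancl_trans)
qed

lemma comp_sub: "B v \<subseteq> V" "P v \<subseteq> V"
  using chain_graphD(2)[OF cg] by (auto simp: comp_of_def parents_def)

lemma comps: "comps_on U V = B ` V"
proof -
  have "U \<inter> V \<times> V = U" using chain_graphD(1)[OF cg] by blast
  then show ?thesis by (auto simp: comps_on_def comp_of_def image_def)
qed

lemma rk_comp: "w \<in> B v \<Longrightarrow> rk w = rk v"
proof -
  assume "w \<in> B v"
  then have "(v, w) \<in> U\<^sup>*" by (simp add: comp_of_def)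
  then show ?thesis by induction (use card_ancestors_U[OF cg] in auto)
qed

lemma rk_parent: "w \<in> P v \<Longrightarrow> rk w < rk v"
  using card_ancestors_D[OF cg] rk_comp unfolding parents_def by fastforce

lemma comp_parents_disjoint: "B v \<inter> P v = {}"
  using rk_comp rk_parent by fastforce

lemma no_arrow_into_family: "u \<in> B v \<Longrightarrow> w \<in> B v \<union> P v \<Longrightarrow> (u, w) \<notin> D"
  using card_ancestors_D[OF cg, of u w] rk_comp rk_parent by fastforce

lemma pdF: "pd_on (B v \<union> P v) Sg" "pd_on (P v) Sg"
  using comp_sub[of v] by (auto intro: pd_on_subset[OF pdV])

text \<open>A pairwise Markov property for vertices of the component itself: a missing moral edge
  makes the density split, and the mixed entry of the precision matrix is 0.\<close>

lemma prec_support: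
  assumes v: "v \<in> V" and vw: "v \<noteq> w" and nz: "inv_on (B v \<union> P v) Sg v w \<noteq> 0"
  shows "(v, w) \<in> U \<or> (w, v) \<in> D"
proof (rule ccontr)
  assume n: "\<not> ?thesis"
  let ?A = "B v \<union> P v"
  have w: "w \<in> ?A" using inv_on_outside[OF pdF(1)] nz by blast
  have vB: "v \<in> B v" using v by (rule comp_self)
  \<comment> \<open>\<open>v\<close> has no child inside its own family, so moralisation adds no
    edge at \<open>v\<close>.\<close>
  have "\<not> moral_adj U D ?A v w"
  proof
    assume "moral_adj U D ?A v w"
    then consider "adj U D v w" | C where "C \<in> comps_on U ?A" "v \<in> parents D C"
      unfolding moral_adj_def by blast
    then show False
    proof cases
      case 1
      then show False using n no_arrow_into_family[OF vB w] by (auto simp: adj_def)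
    next
      case 2
      then obtain c where "c \<in> ?A" "(v, c) \<in> D" by (auto simp: parents_def comps_on_def)
      then show False using no_arrow_into_family[OF vB] by blast
    qed
  qed
  then have split: "v \<notin> S \<or> w \<notin> S" if "moral_complete U D ?A S" for S
    using that vw unfolding moral_complete_def by blast
  have "B v \<in> comps_on U V" using comps v by blast
  from bspec[OF ng[unfolded in_NG_def, THEN conjunct2, THEN conjunct2] this]
  obtain psi :: "nat set \<Rightarrow> (nat \<Rightarrow> real) \<Rightarrow> real" where
    psi: "\<forall>S y z. (\<forall>i\<in>S. y i = z i) \<longrightarrow> psi S y = psi S z"
    "\<forall>x. gdens ?A mu Sg x = (\<Prod>S | moral_complete U D ?A S. psi S x)"
    by (elim exE conjE)
  have dep: "psi S y = psi S z" if "\<forall>i\<in>S. y i = z i" for S y z using psi(1) that by blast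
  have fac: "gdens ?A mu Sg x = (\<Prod>S | moral_complete U D ?A S. psi S x)" for x using psi(2) by blast
  let ?e = "\<lambda>u k. of_bool (k = u) :: real"
  let ?x = "\<lambda>d i. mu i + d i"
  \<comment> \<open>Each factor ignores \<open>v\<close> or \<open>w\<close>, hence satisfies a
    cross-product identity. It involves no division, so factors with value 0 are harmless.\<close>
  have "psi S (?x (\<lambda>k. ?e v k + ?e w k)) * psi S (?x (\<lambda>_. 0)) = psi S (?x (?e v)) * psi S (?x (?e w))"
    if "moral_complete U D ?A S" for S
    using split[OF that]
  proof
    assume S: "v \<notin> S"
    have "psi S (?x (\<lambda>k. ?e v k + ?e w k)) = psi S (?x (?e w))" by (rule dep) (use S in auto)
    moreover have "psi S (?x (\<lambda>_. 0)) = psi S (?x (?e v))" by (rule dep) (use S in auto)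
    ultimately show ?thesis by simp
  next
    assume S: "w \<notin> S"
    have "psi S (?x (\<lambda>k. ?e v k + ?e w k)) = psi S (?x (?e v))" by (rule dep) (use S in auto)
    moreover have "psi S (?x (\<lambda>_. 0)) = psi S (?x (?e w))" by (rule dep) (use S in auto)
    ultimately show ?thesis by simp
  qed
  then have "gdens ?A mu Sg (?x (\<lambda>k. ?e v k + ?e w k)) * gdens ?A mu Sg (?x (\<lambda>_. 0)) =
      gdens ?A mu Sg (?x (?e v)) * gdens ?A mu Sg (?x (?e w))"
    unfolding fac prod.distrib[symmetric] by (intro prod.cong) auto
  then have "exp (- gquad ?A Sg (\<lambda>k. ?e v k + ?e w k) / 2) * (gnorm ?A Sg * gnorm ?A Sg) =
      exp (- gquad ?A Sg (?e v) / 2) * exp (- gquad ?A Sg (?e w) / 2) * (gnorm ?A Sg * gnorm ?A Sg)"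
    unfolding gdens_shift gquad_zero by (simp add: mult_ac)
  then have "exp (- gquad ?A Sg (\<lambda>k. ?e v k + ?e w k) / 2) =
      exp (- gquad ?A Sg (?e v) / 2) * exp (- gquad ?A Sg (?e w) / 2)"
    using gnorm_pos[OF pdF(1), of v] by simp
  then have "gquad ?A Sg (\<lambda>k. ?e v k + ?e w k) = gquad ?A Sg (?e v) + gquad ?A Sg (?e w)"
    unfolding exp_add[symmetric] by simp
  then show False
    using nz unfolding gquad_polar[OF pdF(1)] mvec_unit[OF pdF(1)] by simp
qed

lemma comp_prec_support:
  assumes "v \<in> V" "comp_prec N U D Sg v w \<noteq> 0" shows "v = w \<or> (v, w) \<in> U"
proof (rule ccontr)
  assume n: "\<not> ?thesis"
  have "w \<in> B v" "inv_on (B v \<union> P v) Sg v w \<noteq> 0"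
    using assms(2) by (auto simp: comp_prec_def Omega_of_def split: if_splits)
  then show False
    using n prec_support[OF assms(1), of w] no_arrow_into_family[of w v v] comp_self[OF assms(1)] by blast
qed

lemma arrow_prec_support:
  assumes "v \<in> V" "w \<in> V" "arrow_prec N U D Sg v w \<noteq> 0" shows "(w, v) \<in> D"
proof -
  have nB: "w \<notin> B v" and nz: "inv_on (B v \<union> P v) Sg v w \<noteq> 0"
    using assms(3) by (auto simp: arrow_prec_def Omega_of_def split: if_splits)
  have "v \<noteq> w" using nB comp_self[OF assms(1)] by blast
  moreover have "(v, w) \<notin> U" using nB assms(2) by (auto simp: comp_of_def)
  ultimately show ?thesis using prec_support[OF assms(1) _ nz] by blast
qed

lemma comp_prec_sym:
  assumes "v \<in> V" "w \<in> V"
  shows "comp_prec N U D Sg v w = comp_prec N U D Sg w v"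
proof (cases "w \<in> B v")
  case True
  then have "B w = B v" by (rule comp_eq)
  moreover from this have "v \<in> B w" using comp_self assms(1) by blast
  ultimately show ?thesis
    using True inv_on_sym[OF pdF(1), of v v w] by (simp add: comp_prec_def Omega_of_def)
next
  case False
  then have "v \<notin> B w" using comp_eq comp_self assms(2) by blast
  then show ?thesis using False by (simp add: comp_prec_def)
qed

lemma sum_comps: "(\<Sum>v\<in>V. f v) = (\<Sum>C\<in>comps_on U V. \<Sum>v\<in>C. f v :: real)"
proof -
  have "V = \<Union> (comps_on U V)" unfolding comps using comp_self comp_sub by blast
  moreover have "(\<Sum>v\<in>\<Union> (comps_on U V). f v) = (\<Sum>C\<in>comps_on U V. \<Sum>v\<in>C. f v)"
  proof (subst sum.Union_disjoint)
    show "\<forall>A\<in>comps_on U V. finite A"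
      unfolding comps using comp_sub(1) finite_verts finite_subset by blast
    show "\<forall>A\<in>comps_on U V. \<forall>B\<in>comps_on U V. A \<noteq> B \<longrightarrow> A \<inter> B = {}"
      unfolding comps using comp_eq by blast
  qed simp
  ultimately show ?thesis by simp
qed

lemma mvec_comp_prec:
  assumes "w \<in> B v"
  shows "mvec V (comp_prec N U D Sg) x w = mvec (B v) (inv_on (B v \<union> P v) Sg) x w"
proof -
  have Bw: "B w = B v" using assms by (rule comp_eq)
  have "mvec V (comp_prec N U D Sg) x w = (\<Sum>u\<in>B v. comp_prec N U D Sg w u * x u)"
    unfolding mvec_def using comp_sub finite_verts Bw
    by (intro sum.mono_neutral_right) (auto simp: comp_prec_def)
  also have "\<dots> = mvec (B v) (inv_on (B v \<union> P v) Sg) x w"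
    unfolding mvec_def using Bw by (intro sum.cong) (auto simp: comp_prec_def Omega_of_def)
  finally show ?thesis .
qed

lemma pd_comp_prec: "pd_on V (comp_prec N U D Sg)"
  unfolding pd_on_def
proof (intro conjI ballI allI impI)
  show "finite V" by (rule finite_verts)
  fix x :: "nat \<Rightarrow> real" assume "\<exists>i\<in>V. x i \<noteq> 0"
  then obtain v where v: "v \<in> V" "x v \<noteq> 0" by blast
  let ?q = "\<lambda>C. \<Sum>w\<in>C. x w * mvec C (inv_on (C \<union> parents D C) Sg) x w"
  have pdB: "pd_on (B u) (inv_on (B u \<union> P u) Sg)" for u
    using pd_on_inv_on[OF pdF(1)[of u]] by (rule pd_on_subset) auto
  have "(\<Sum>w\<in>V. x w * mvec V (comp_prec N U D Sg) x w) = (\<Sum>C\<in>comps_on U V. ?q C)"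
    unfolding sum_comps
  proof (intro sum.cong refl)
    fix C w assume "C \<in> comps_on U V" "w \<in> C"
    then show "x w * mvec V (comp_prec N U D Sg) x w = x w * mvec C (inv_on (C \<union> parents D C) Sg) x w"
      unfolding comps using mvec_comp_prec by auto
  qed
  also have "\<dots> > 0"
  proof (rule sum_pos2)
    show "finite (comps_on U V)" unfolding comps using finite_verts by simp
    show "B v \<in> comps_on U V" unfolding comps using v by blast
    show "0 < ?q (B v)" by (rule pd_onD(3)[OF pdB, where i = v]) (use v comp_self in auto)
    show "0 \<le> ?q C" if "C \<in> comps_on U V" for C
      using that pd_on_nonneg[OF pdB] unfolding comps by blast
  qed
  finally show "(\<Sum>i\<in>V. \<Sum>j\<in>V. x i * comp_prec N U D Sg i j * x j) > 0" unfolding quad_eq .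
qed (rule comp_prec_sym)

lemma gquad_factorization:
  "gquad V Sg d = (\<Sum>C\<in>comps_on U V. gquad (C \<union> parents D C) Sg d - gquad (parents D C) Sg d)"
proof -
  let ?C = "comps_on U V"
  have fin: "finite ?C" unfolding comps using finite_verts by simp
  let ?n = "\<lambda>C. gnorm (C \<union> parents D C) Sg / gnorm (parents D C) Sg"
  let ?q = "\<lambda>C d. gquad (C \<union> parents D C) Sg d - gquad (parents D C) Sg d"
  have eq: "exp (- gquad V Sg d / 2) * gnorm V Sg = exp (- (\<Sum>C\<in>?C. ?q C d) / 2) * (\<Prod>C\<in>?C. ?n C)" for d
  proof -
    have "exp (- gquad V Sg d / 2) * gnorm V Sg =
        (\<Prod>C\<in>?C. exp (- gquad (C \<union> parents D C) Sg d / 2) * gnorm (C \<union> parents D C) Sg /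
          (exp (- gquad (parents D C) Sg d / 2) * gnorm (parents D C) Sg))"
      using ng unfolding in_NG_def gdens_shift[symmetric, of _ _ _ mu] by blast
    also have "\<dots> = (\<Prod>C\<in>?C. exp (- ?q C d / 2) * ?n C)"
    proof (intro prod.cong refl)
      fix C
      have "exp (- ?q C d / 2) = exp (- gquad (C \<union> parents D C) Sg d / 2) / exp (- gquad (parents D C) Sg d / 2)"
        unfolding exp_diff[symmetric] by (simp add: field_simps)
      then show "exp (- gquad (C \<union> parents D C) Sg d / 2) * gnorm (C \<union> parents D C) Sg /
          (exp (- gquad (parents D C) Sg d / 2) * gnorm (parents D C) Sg) = exp (- ?q C d / 2) * ?n C"
        by simp
    qed
    also have "\<dots> = exp (\<Sum>C\<in>?C. - ?q C d / 2) * (\<Prod>C\<in>?C. ?n C)"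
      by (simp only: prod.distrib exp_sum[OF fin])
    also have "(\<Sum>C\<in>?C. - ?q C d / 2) = - (\<Sum>C\<in>?C. ?q C d) / 2"
      by (simp only: sum_negf sum_divide_distrib[symmetric])
    finally show ?thesis .
  qed
  \<comment> \<open>At the mean all exponents vanish, which isolates the normalising
    constants.\<close>
  have "gnorm V Sg = (\<Prod>C\<in>?C. ?n C)" using eq[of "\<lambda>_. 0"] by (simp add: gquad_zero)
  then have "exp (- gquad V Sg d / 2) = exp (- (\<Sum>C\<in>?C. ?q C d) / 2)"
    using eq[of d] gnorm_pos[OF pdV] by simp
  then show ?thesis by simp
qed

lemma precision_factorization:
  "mvec V (inv_on V Sg) x v = (\<Sum>C\<in>comps_on U V.
     mvec (C \<union> parents D C) (inv_on (C \<union> parents D C) Sg) x v - mvec (parents D C) (inv_on (parents D C) Sg) x v)"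
proof -
  let ?q = "\<lambda>C d. gquad (C \<union> parents D C) Sg d - gquad (parents D C) Sg d"
  let ?e = "\<lambda>k. of_bool (k = v) :: real"
  let ?b = "\<lambda>C. mvec (C \<union> parents D C) (inv_on (C \<union> parents D C) Sg) x v - mvec (parents D C) (inv_on (parents D C) Sg) x v"
  have "?q C (\<lambda>k. ?e k + x k) = ?q C ?e + ?q C x + 2 * ?b C" if "C \<in> comps_on U V" for C
    using that gquad_polar[OF pdF(1)] gquad_polar[OF pdF(2)] unfolding comps by auto
  then have "(\<Sum>C\<in>comps_on U V. ?q C (\<lambda>k. ?e k + x k)) =
      (\<Sum>C\<in>comps_on U V. ?q C ?e) + (\<Sum>C\<in>comps_on U V. ?q C x) + 2 * (\<Sum>C\<in>comps_on U V. ?b C)"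
    by (simp only: sum.distrib sum_distrib_left cong: sum.cong)
  then show ?thesis
    using gquad_polar[OF pdV, of v x] unfolding gquad_factorization by simp
qed

text \<open>A Schur complement: conditionally on the parents, the component has precision matrix
  \<open>inv_on (B v \<union> P v) Sg\<close> restricted to \<open>B v\<close>.\<close>
lemma component_gradient:
  assumes v: "v \<in> V" and My: "\<And>w. w \<in> B v \<Longrightarrow>
      mvec (B v) (inv_on (B v \<union> P v) Sg) y w = mvec (B v \<union> P v) (inv_on (B v \<union> P v) Sg) x w"
  shows "(\<Sum>w\<in>B v. inv_on (B v \<union> P v) Sg w u * y w) =
    mvec (B v \<union> P v) (inv_on (B v \<union> P v) Sg) x u - mvec (P v) (inv_on (P v) Sg) x u"
proof -
  let ?A = "B v \<union> P v"
  let ?W = "inv_on ?A Sg"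
  have fin: "finite ?A" using pdF(1) by (rule pd_onD)
  \<comment> \<open>\<open>?W\<close> maps \<open>z\<close> to a vector supported on the parents,
    and \<open>Sg\<close> maps that vector back to \<open>x\<close> there; so it is the parents'
    precision matrix applied to \<open>x\<close>.\<close>
  define z where "z w = (if w \<in> B v then x w - y w else x w)" for w
  have z: "mvec ?A ?W z u = mvec ?A ?W x u - mvec (B v) ?W y u" for u
  proof -
    let ?y = "\<lambda>w. if w \<in> B v then y w else 0"
    have "mvec ?A ?W ?y u = mvec (B v) ?W ?y u" using fin by (intro mvec_restrict) auto
    moreover have "mvec (B v) ?W ?y u = mvec (B v) ?W y u" by (intro mvec_cong) auto
    moreover have "mvec ?A ?W z u = mvec ?A ?W (\<lambda>w. x w - ?y w) u" by (intro mvec_cong) (auto simp: z_def)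
    ultimately show ?thesis unfolding mvec_diff by simp
  qed
  have zB: "mvec ?A ?W z u = 0" if "u \<in> B v" for u unfolding z using My[OF that] by simp
  have zP: "mvec (P v) Sg (mvec ?A ?W z) u = x u" if u: "u \<in> P v" for u
  proof -
    have "mvec (P v) Sg (mvec ?A ?W z) u = mvec ?A Sg (mvec ?A ?W z) u"
      by (rule mvec_restrict[symmetric]) (use fin zB in auto)
    also have "\<dots> = z u" using u by (intro mvec_inv_on[OF pdF(1)]) auto
    also have "\<dots> = x u" using u comp_parents_disjoint by (auto simp: z_def)
    finally show ?thesis .
  qed
  have sw: "(\<Sum>w\<in>B v. ?W w u * y w) = mvec (B v) ?W y u"
    unfolding mvec_def using inv_on_sym[OF pdF(1), of v _ u] by simp
  consider "u \<in> B v" | "u \<in> P v" | "u \<notin> ?A" by blast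
  then show ?thesis
  proof cases
    case 1
    then have "u \<notin> P v" using comp_parents_disjoint by blast
    then show ?thesis unfolding sw using My[OF 1] mvec_inv_outside[OF pdF(2)] by simp
  next
    case 2
    have "mvec (P v) (inv_on (P v) Sg) x u = mvec ?A ?W z u"
      by (rule inv_on_unique[OF pdF(2) zP 2])
    then show ?thesis unfolding sw z by simp
  next
    case 3
    then have "u \<notin> P v" by blast
    then show ?thesis
      unfolding sw using 3 mvec_inv_outside[OF pdF(1), of u v x] mvec_inv_outside[OF pdF(2), of u v x]
        inv_on_outside[OF pdF(1), of u v] by (simp add: mvec_def[of "B v"])
  qed
qed

text \<open>The first equation defines \<open>y\<close>, as \<open>M\<close> is invertible. The
  second collects \<open>component_gradient\<close> over all components;
  \<open>precision_factorization\<close> identifies the sum with the precision matrix applied to the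
  covariance vector of \<open>g\<close>.\<close>

lemma precision_system:
  defines "M \<equiv> comp_prec N U D Sg" and "E \<equiv> arrow_prec N U D Sg"
  shows "\<exists>y. \<forall>v\<in>V. mvec V M (mvec V Sg g) v + mvec V E (mvec V Sg g) v = mvec V M y v \<and>
    mvec V M y v + mvec V (\<lambda>v w. E w v) y v = g v"
proof -
  let ?x = "mvec V Sg g"
  let ?\<Omega> = "\<lambda>v w. inv_on (B v \<union> P v) Sg v w"
  have ME: "M v w + E v w = ?\<Omega> v w" for v w
    by (simp add: M_def E_def comp_prec_def arrow_prec_def Omega_of_def)
  have sumME: "mvec V M x v + mvec V E x v = mvec V ?\<Omega> x v" for x v
    unfolding mvec_def sum.distrib[symmetric] by (simp only: distrib_right[symmetric] ME)
  obtain y where y: "\<And>v. v \<in> V \<Longrightarrow> mvec V M y v = mvec V M ?x v + mvec V E ?x v"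
    using pd_on_solve[OF pd_comp_prec, of "\<lambda>v. mvec V M ?x v + mvec V E ?x v"] unfolding M_def by blast
  have "mvec V M y v + mvec V (\<lambda>v w. E w v) y v = g v" if v: "v \<in> V" for v
  proof -
    have "mvec V M y v + mvec V (\<lambda>v w. E w v) y v = (\<Sum>w\<in>V. ?\<Omega> w v * y w)"
    proof -
      have "mvec V M y v = (\<Sum>w\<in>V. M w v * y w)"
        unfolding mvec_def M_def using comp_prec_sym[OF v] by (intro sum.cong) auto
      then show ?thesis
        unfolding mvec_def by (simp only: sum.distrib[symmetric] distrib_right[symmetric] ME)
    qed
    also have "\<dots> = (\<Sum>C\<in>comps_on U V. \<Sum>w\<in>C. inv_on (C \<union> parents D C) Sg w v * y w)"
      unfolding sum_comps
    proof (intro sum.cong refl)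
      fix C w assume "C \<in> comps_on U V" "w \<in> C"
      then have "B w = C" unfolding comps using comp_eq by blast
      then show "?\<Omega> w v * y w = inv_on (C \<union> parents D C) Sg w v * y w" by simp
    qed
    also have "\<dots> = (\<Sum>C\<in>comps_on U V. mvec (C \<union> parents D C) (inv_on (C \<union> parents D C) Sg) ?x v -
        mvec (parents D C) (inv_on (parents D C) Sg) ?x v)"
    proof (intro sum.cong refl)
      fix C assume "C \<in> comps_on U V"
      then obtain u where u: "u \<in> V" "C = B u" unfolding comps by blast
      show "(\<Sum>w\<in>C. inv_on (C \<union> parents D C) Sg w v * y w) =
          mvec (C \<union> parents D C) (inv_on (C \<union> parents D C) Sg) ?x v -
          mvec (parents D C) (inv_on (parents D C) Sg) ?x v"
        unfolding u(2)
      proof (rule component_gradient[OF u(1)])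
        fix w assume w: "w \<in> B u"
        then have wV: "w \<in> V" and Bw: "B w = B u" using comp_sub comp_eq by blast+
        have "mvec (B u) (inv_on (B u \<union> P u) Sg) y w = mvec V ?\<Omega> ?x w"
          using y[OF wV] mvec_comp_prec[OF w, of y] sumME[of ?x w] unfolding M_def by simp
        also have "\<dots> = mvec (B u \<union> P u) (inv_on (B u \<union> P u) Sg) ?x w"
          unfolding mvec_def Bw using comp_sub[of u] finite_verts inv_on_outside[OF pdF(1), of w u]
          by (intro sum.mono_neutral_right) auto
        finally show "mvec (B u) (inv_on (B u \<union> P u) Sg) y w = mvec (B u \<union> P u) (inv_on (B u \<union> P u) Sg) ?x w" .
      qed
    qed
    also have "\<dots> = mvec V (inv_on V Sg) ?x v" by (rule precision_factorization[symmetric])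
    also have "\<dots> = g v" by (rule inv_on_unique[OF pdV _ v]) simp
    finally show ?thesis .
  qed
  then show ?thesis using y by (intro exI[of _ y]) simp
qed

lemma separated_imp_cond_indep:
  assumes sub: "I \<subseteq> V" "J \<subseteq> V" "K \<subseteq> V" and disj: "I \<inter> J = {}" "I \<inter> K = {}" "J \<inter> K = {}"
    and sep: "separated U D I J K"
  shows "cond_indep mu Sg I J K"
proof (rule cond_indepI[OF _ disj])
  show "pd_on (I \<union> J \<union> K) Sg" using pdV by (rule pd_on_subset) (use sub in auto)
  fix w i assume w: "\<And>k. k \<in> K \<Longrightarrow> mvec (J \<union> K) Sg w k = 0" and i: "i \<in> I"
  define g where "g v = (if v \<in> J \<union> K then w v else 0)" for v
  have g: "mvec V Sg g l = mvec (J \<union> K) Sg w l" for l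
  proof -
    have "mvec V Sg g l = mvec (J \<union> K) Sg g l"
      using finite_verts sub by (intro mvec_restrict) (auto simp: g_def)
    also have "\<dots> = mvec (J \<union> K) Sg w l" by (intro mvec_cong) (auto simp: g_def)
    finally show ?thesis .
  qed
  obtain y where y: "\<And>v. v \<in> V \<Longrightarrow> mvec V (comp_prec N U D Sg) (mvec V Sg g) v +
      mvec V (arrow_prec N U D Sg) (mvec V Sg g) v = mvec V (comp_prec N U D Sg) y v"
    "\<And>v. v \<in> V \<Longrightarrow> mvec V (comp_prec N U D Sg) y v + mvec V (\<lambda>v w. arrow_prec N U D Sg w v) y v = g v"
    using precision_system by blast
  have "mvec V Sg g i = 0"
  proof (rule separation_zero[OF cg pd_comp_prec _ _ sub disj(2) _ _ y])
    show "v = w \<or> (v, w) \<in> U" if "v \<in> V" "comp_prec N U D Sg v w \<noteq> 0" for v w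
      using comp_prec_support[OF that] .
    show "(w, v) \<in> D" if "v \<in> V" "w \<in> V" "arrow_prec N U D Sg v w \<noteq> 0" for v w
      using arrow_prec_support[OF that] .
    show "(Var i, Var j) \<notin> conn U D K" if "i \<in> I" "j \<in> J" for i j
      using sep that unfolding separated_iff_conn[OF cg] by blast
    show "v \<in> J \<union> K" if "g v \<noteq> 0" for v using that by (auto simp: g_def split: if_splits)
    show "mvec V Sg g v = 0" if "v \<in> K" for v unfolding g by (rule w[OF that])
  qed (use i in auto)
  then show "mvec (J \<union> K) Sg w i = 0" unfolding g .
qed

end

section \<open>Dependence as the non-vanishing of a polynomial\<close>

definition sym_part :: "(nat \<times> nat) set \<Rightarrow> (nd_index \<Rightarrow> real) \<Rightarrow> nat \<Rightarrow> nat \<Rightarrow> real" where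
  "sym_part U \<theta> v w = (if v = w then \<theta> (Diag v) else if (v, w) \<in> U then \<theta> (UEdge (min v w) (max v w)) else 0)"

definition arrow_part :: "(nat \<times> nat) set \<Rightarrow> (nd_index \<Rightarrow> real) \<Rightarrow> nat \<Rightarrow> nat \<Rightarrow> real" where
  "arrow_part D \<theta> v w = (if (w, v) \<in> D then \<theta> (DEdge w v) else 0)"

lemma nd_params_parts:
  assumes cg: "chain_graph N U D" and ng: "in_NG N U D mu Sg" and v: "v \<in> verts N" and w: "w \<in> verts N"
  shows sym_part_nd_params: "sym_part U (nd_params N U D mu Sg) v w = comp_prec N U D Sg v w"
    and arrow_part_nd_params: "arrow_part D (nd_params N U D mu Sg) v w = arrow_prec N U D Sg v w"
proof -
  let ?\<theta> = "nd_params N U D mu Sg"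
  have diag: "?\<theta> (Diag v) = Omega_of N U D Sg v v v"
    using v by (simp add: nd_params_def nd_indices_def)
  have edge: "?\<theta> (UEdge a b) = Omega_of N U D Sg a a b" if "(a, b) \<in> U" "a < b" for a b
    using that by (auto simp: nd_params_def nd_indices_def)
  have arrow: "?\<theta> (DEdge k j) = Omega_of N U D Sg j j k" if "(k, j) \<in> D" for k j
    using that by (auto simp: nd_params_def nd_indices_def)
  have U_comp: "b \<in> comp_of N U a" if "(a, b) \<in> U" for a b
    using that chain_graphD(1)[OF cg] by (auto simp: comp_of_def)
  show "sym_part U ?\<theta> v w = comp_prec N U D Sg v w"
  proof (cases "v = w \<or> (v, w) \<in> U")
    case False
    then show ?thesis using comp_prec_support[OF cg ng v, of w] by (auto simp: sym_part_def)
  next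
    case True
    then consider "v = w" | "(v, w) \<in> U" "v < w" | "(v, w) \<in> U" "w < v" by linarith
    then show ?thesis
    proof cases
      case 1
      then show ?thesis using diag v by (simp add: sym_part_def comp_prec_def comp_of_def)
    next
      case 2
      then show ?thesis using edge[of v w] U_comp[of v w] by (simp add: sym_part_def comp_prec_def)
    next
      case 3
      then have "(w, v) \<in> U" using chain_graphD(3)[OF cg] by blast
      then have "comp_prec N U D Sg w v = ?\<theta> (UEdge w v)"
        using edge[of w v] U_comp[of w v] 3 by (simp add: comp_prec_def)
      then show ?thesis using 3 comp_prec_sym[OF cg ng v w] by (simp add: sym_part_def)
    qed
  qed
  show "arrow_part D ?\<theta> v w = arrow_prec N U D Sg v w"
  proof (cases "(w, v) \<in> D")
    case False
    then show ?thesis using arrow_prec_support[OF cg ng v w] by (auto simp: arrow_part_def)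
  next
    case True
    have "w \<notin> comp_of N U v"
      using no_arrow_into_family[OF cg ng, of w v v] True comp_self[OF cg ng v] by blast
    then show ?thesis using True arrow[OF True] by (simp add: arrow_part_def arrow_prec_def)
  qed
qed

text \<open>Up to sign and a nonzero factor, the determinant of this matrix is the conditional covariance of
  \<open>i\<close> and \<open>j\<close> given \<open>K\<close>.\<close>
definition dep_matrix ::
  "(nat \<times> nat) set \<Rightarrow> (nat \<times> nat) set \<Rightarrow> nat \<Rightarrow> nat \<Rightarrow> (nd_index \<Rightarrow> real) \<Rightarrow> node \<Rightarrow> node \<Rightarrow> real" where
  "dep_matrix U D i j \<theta> \<xi> \<eta> = (if \<xi> = Var j then of_bool (\<eta> = Var i)
     else saddle (sym_part U \<theta>) (\<lambda>v w. sym_part U \<theta> v w + arrow_part D \<theta> v w) \<xi> \<eta>)"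

text \<open>The enumeration \<open>e\<close> of the nodes is chosen independently of the parameters,
  so the determinant is a polynomial in them.\<close>

definition dep_det ::
  "nat \<Rightarrow> (nat \<times> nat) set \<Rightarrow> (nat \<times> nat) set \<Rightarrow> nat \<Rightarrow> nat \<Rightarrow> nat set \<Rightarrow> (nd_index \<Rightarrow> real) \<Rightarrow> real" where
  "dep_det N U D i j K \<theta> =
     (let n = card (nodes (verts N) K);
          e = (SOME e. bij_betw e {0..<n} (nodes (verts N) K))
      in Determinant.det (Matrix.mat n n (\<lambda>(r, c). dep_matrix U D i j \<theta> (e r) (e c))))"

lemma dep_det_enum:
  obtains e where "bij_betw e {0..<card (nodes (verts N) K)} (nodes (verts N) K)"
    "\<And>\<theta>. dep_det N U D i j K \<theta> = Determinant.det
       (Matrix.mat (card (nodes (verts N) K)) (card (nodes (verts N) K)) (\<lambda>(r, c). dep_matrix U D i j \<theta> (e r) (e c)))"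
proof -
  let ?S = "nodes (verts N) K"
  let ?e = "SOME e. bij_betw e {0..<card ?S} ?S"
  have "\<exists>e. bij_betw e {0..<card ?S} ?S"
    by (intro ex_bij_betw_nat_finite finite_nodes finite_verts)
  then have "bij_betw ?e {0..<card ?S} ?S" by (rule someI_ex)
  then show thesis by (rule that) (simp add: dep_det_def Let_def)
qed

lemma det_mat_zero_iff_kernel:
  fixes R :: "'a \<Rightarrow> 'a \<Rightarrow> real"
  assumes e: "bij_betw e {0..<n} S"
  shows "Determinant.det (Matrix.mat n n (\<lambda>(r, c). R (e r) (e c))) = 0 \<longleftrightarrow>
    (\<exists>u. (\<exists>\<eta>\<in>S. u \<eta> \<noteq> 0) \<and> (\<forall>\<xi>\<in>S. (\<Sum>\<eta>\<in>S. R \<xi> \<eta> * u \<eta>) = 0))"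
proof -
  let ?A = "Matrix.mat n n (\<lambda>(r, c). R (e r) (e c))"
  have row: "vec_index (?A *\<^sub>v z) r = (\<Sum>c = 0..<n. R (e r) (e c) * vec_index z c)" if "r < n" "z \<in> carrier_vec n" for r z
    using that by (simp add: scalar_prod_def)
  have inS: "e r \<in> S" if "r < n" for r using e that by (auto simp: bij_betw_def)
  have surj: "\<exists>r<n. \<xi> = e r" if "\<xi> \<in> S" for \<xi> using e that by (auto simp: bij_betw_def)
  have reindex: "(\<Sum>\<eta>\<in>S. f \<eta>) = (\<Sum>c = 0..<n. f (e c))" for f :: "'a \<Rightarrow> real"
    using sum.reindex_bij_betw[OF e, of f] by simp
  have "Determinant.det ?A = 0 \<longleftrightarrow> (\<exists>z. z \<in> carrier_vec n \<and> z \<noteq> 0\<^sub>v n \<and> ?A *\<^sub>v z = 0\<^sub>v n)"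
    by (rule det_0_iff_vec_prod_zero) simp
  also have "\<dots> \<longleftrightarrow> (\<exists>u. (\<exists>\<eta>\<in>S. u \<eta> \<noteq> 0) \<and> (\<forall>\<xi>\<in>S. (\<Sum>\<eta>\<in>S. R \<xi> \<eta> * u \<eta>) = 0))"
  proof
    assume "\<exists>z. z \<in> carrier_vec n \<and> z \<noteq> 0\<^sub>v n \<and> ?A *\<^sub>v z = 0\<^sub>v n"
    then obtain z where z: "z \<in> carrier_vec n" "z \<noteq> 0\<^sub>v n" "?A *\<^sub>v z = 0\<^sub>v n" by blast
    define u where "u \<eta> = vec_index z (the_inv_into {0..<n} e \<eta>)" for \<eta>
    have u: "u (e c) = vec_index z c" if "c < n" for c
      using that e by (simp add: u_def the_inv_into_f_f bij_betw_def)
    have "\<exists>c<n. vec_index z c \<noteq> 0"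
    proof (rule ccontr)
      assume "\<not> ?thesis"
      then have "z = 0\<^sub>v n" using z(1) by (intro eq_vecI) auto
      then show False using z(2) by simp
    qed
    then obtain c where "c < n" "vec_index z c \<noteq> 0" by blast
    then have "\<exists>\<eta>\<in>S. u \<eta> \<noteq> 0" using u inS by (intro bexI[of _ "e c"]) auto
    moreover have "(\<Sum>\<eta>\<in>S. R \<xi> \<eta> * u \<eta>) = 0" if "\<xi> \<in> S" for \<xi>
    proof -
      obtain r where r: "r < n" "\<xi> = e r" using surj[OF \<open>\<xi> \<in> S\<close>] by blast
      have "(\<Sum>\<eta>\<in>S. R \<xi> \<eta> * u \<eta>) = (\<Sum>c = 0..<n. R (e r) (e c) * vec_index z c)"
        unfolding reindex r(2) by (intro sum.cong refl) (simp add: u)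
      also have "\<dots> = 0" using row[OF r(1) z(1)] z(3) r(1) by simp
      finally show ?thesis .
    qed
    ultimately show "\<exists>u. (\<exists>\<eta>\<in>S. u \<eta> \<noteq> 0) \<and> (\<forall>\<xi>\<in>S. (\<Sum>\<eta>\<in>S. R \<xi> \<eta> * u \<eta>) = 0)" by blast
  next
    assume "\<exists>u. (\<exists>\<eta>\<in>S. u \<eta> \<noteq> 0) \<and> (\<forall>\<xi>\<in>S. (\<Sum>\<eta>\<in>S. R \<xi> \<eta> * u \<eta>) = 0)"
    then obtain u \<eta> where u: "\<eta> \<in> S" "u \<eta> \<noteq> 0" "\<And>\<xi>. \<xi> \<in> S \<Longrightarrow> (\<Sum>\<eta>\<in>S. R \<xi> \<eta> * u \<eta>) = 0" by blast
    let ?z = "Matrix.vec n (\<lambda>c. u (e c))"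
    have z: "?z \<in> carrier_vec n" by simp
    obtain c where c: "c < n" "\<eta> = e c" using surj[OF u(1)] by blast
    have "vec_index ?z c \<noteq> 0" using c u(2) by simp
    then have "?z \<noteq> 0\<^sub>v n" using c(1) by (metis index_zero_vec(1))
    moreover have "?A *\<^sub>v ?z = 0\<^sub>v n"
    proof (rule eq_vecI)
      fix r assume "r < dim_vec (0\<^sub>v n :: real Matrix.vec)"
      then have r: "r < n" by simp
      have "vec_index (?A *\<^sub>v ?z) r = (\<Sum>c = 0..<n. R (e r) (e c) * u (e c))"
        unfolding row[OF r z] by (intro sum.cong refl) simp
      also have "\<dots> = 0" using u(3)[OF inS[OF r]] unfolding reindex .
      finally show "vec_index (?A *\<^sub>v ?z) r = vec_index (0\<^sub>v n) r" using r by simp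
    qed simp
    ultimately show "\<exists>z. z \<in> carrier_vec n \<and> z \<noteq> 0\<^sub>v n \<and> ?A *\<^sub>v z = 0\<^sub>v n" using z by blast
  qed
  finally show ?thesis .
qed

lemma dep_det_zero_iff:
  "dep_det N U D i j K \<theta> = 0 \<longleftrightarrow> (\<exists>u. (\<exists>\<eta>\<in>nodes (verts N) K. u \<eta> \<noteq> 0) \<and>
     (\<forall>\<xi>\<in>nodes (verts N) K. (\<Sum>\<eta>\<in>nodes (verts N) K. dep_matrix U D i j \<theta> \<xi> \<eta> * u \<eta>) = 0))"
proof -
  obtain e where e: "bij_betw e {0..<card (nodes (verts N) K)} (nodes (verts N) K)"
    "\<And>\<theta>. dep_det N U D i j K \<theta> = Determinant.det
       (Matrix.mat (card (nodes (verts N) K)) (card (nodes (verts N) K)) (\<lambda>(r, c). dep_matrix U D i j \<theta> (e r) (e c)))"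
    by (rule dep_det_enum[of N K U D i j]) (rule that)
  show ?thesis unfolding e(2) by (rule det_mat_zero_iff_kernel[OF e(1)])
qed

lemma finite_nd_indices:
  assumes "chain_graph N U D" shows "finite (nd_indices N U D)"
proof -
  have fin: "finite U" "finite D"
    using chain_graphD(1,2)[OF assms] finite_verts by (meson finite_SigmaI finite_subset)+
  have "{UEdge a b |a b. (a, b) \<in> U \<and> a < b} \<subseteq> (\<lambda>(a, b). UEdge a b) ` U"
    "{DEdge k j |k j. (k, j) \<in> D} \<subseteq> (\<lambda>(k, j). DEdge k j) ` D" by auto
  then show ?thesis using fin finite_verts unfolding nd_indices_def by (auto intro: finite_subset)
qed

lemma sep_poly_dep_det:
  assumes cg: "chain_graph N U D"
  shows "sep_poly (nd_indices N U D) (dep_det N U D i j K)"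
proof -
  let ?I = "nd_indices N U D"
  have sp: "sep_poly ?I (\<lambda>\<theta>. sym_part U \<theta> v w)" if "v \<in> verts N" for v w
  proof (cases "v = w")
    case True
    then show ?thesis using that by (simp add: sym_part_def nd_indices_def sep_poly_coord)
  next
    case False
    show ?thesis
    proof (cases "(v, w) \<in> U")
      case True
      then have "(min v w, max v w) \<in> U" "min v w < max v w"
        using False chain_graphD(3)[OF cg] by (auto simp: min_def max_def)
      then have "UEdge (min v w) (max v w) \<in> ?I" by (auto simp: nd_indices_def)
      then show ?thesis using True False by (simp add: sym_part_def sep_poly_coord)
    next
      case False
      then show ?thesis using \<open>v \<noteq> w\<close> by (simp add: sym_part_def sep_poly_const)
    qed
  qed
  have ap: "sep_poly ?I (\<lambda>\<theta>. arrow_part D \<theta> v w)" for v w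
    by (cases "(w, v) \<in> D") (auto simp: arrow_part_def nd_indices_def intro: sep_poly_coord sep_poly_const)
  have entry: "sep_poly ?I (\<lambda>\<theta>. dep_matrix U D i j \<theta> \<xi> \<eta>)"
    if "\<xi> \<in> nodes (verts N) K" "\<eta> \<in> nodes (verts N) K" for \<xi> \<eta>
  proof (cases "\<xi> = Var j")
    case True
    then show ?thesis by (simp add: dep_matrix_def sep_poly_const)
  next
    case False
    have "vertex \<xi> \<in> verts N" "vertex \<eta> \<in> verts N" using that by (auto simp: nodes_def)
    then show ?thesis using False
      by (cases \<xi>; cases \<eta>) (auto simp: dep_matrix_def intro: sp ap sep_poly_const sep_poly_add)
  qed
  obtain e where e: "bij_betw e {0..<card (nodes (verts N) K)} (nodes (verts N) K)"
    "\<And>\<theta>. dep_det N U D i j K \<theta> = Determinant.det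
       (Matrix.mat (card (nodes (verts N) K)) (card (nodes (verts N) K)) (\<lambda>(r, c). dep_matrix U D i j \<theta> (e r) (e c)))"
    by (rule dep_det_enum[of N K U D i j]) (rule that)
  let ?n = "card (nodes (verts N) K)"
  have inS: "e r \<in> nodes (verts N) K" if "r < ?n" for r using e(1) that by (auto simp: bij_betw_def)
  have "dep_det N U D i j K = (\<lambda>\<theta>. \<Sum>p | p permutes {0..<?n}.
      of_int (sign p) * (\<Prod>r = 0..<?n. dep_matrix U D i j \<theta> (e r) (e (p r))))"
  proof
    fix \<theta>
    have "p r < ?n" if "p permutes {0..<?n}" "r < ?n" for p r
      using permutes_in_image[OF that(1), of r] that(2) by simp
    then show "dep_det N U D i j K \<theta> = (\<Sum>p | p permutes {0..<?n}.
      of_int (sign p) * (\<Prod>r = 0..<?n. dep_matrix U D i j \<theta> (e r) (e (p r))))"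
      unfolding e(2) by (subst det_def'[of _ ?n]) (auto intro!: sum.cong prod.cong)
  qed
  moreover have "sep_poly ?I (\<lambda>\<theta>. dep_matrix U D i j \<theta> (e r) (e (p r)))"
    if "p permutes {0..<?n}" "r \<in> {0..<?n}" for p r
    using permutes_in_image[OF that(1), of r] that(2) by (intro entry inS) auto
  ultimately show ?thesis
    by (simp only:) (intro sep_poly_sum sep_poly_mult sep_poly_const sep_poly_prod, simp)
qed

text \<open>Symmetry of \<open>Q\<close> lets its right inverse \<open>X\<close> act from the left.
  A vector solving all equations but the one at \<open>\<beta>\<close> is then a multiple of row
  \<open>\<beta>\<close> of \<open>X\<close>.\<close>

lemma right_inverse_solve:
  assumes fin: "finite S" and sym: "\<And>\<xi> \<eta>. \<xi> \<in> S \<Longrightarrow> \<eta> \<in> S \<Longrightarrow> Q \<xi> \<eta> = Q \<eta> \<xi>"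
    and inv: "right_inverse_on S Q X"
    and u: "\<And>\<xi>. \<xi> \<in> S \<Longrightarrow> \<xi> \<noteq> \<beta> \<Longrightarrow> mvec S Q u \<xi> = 0" and \<beta>: "\<beta> \<in> S" and \<zeta>: "\<zeta> \<in> S"
  shows "u \<zeta> = X \<beta> \<zeta> * mvec S Q u \<beta>"
proof -
  have sel: "(\<Sum>\<xi>\<in>S. f \<xi> * (if \<xi> = \<delta> then 1 else 0)) = f \<delta>" if "\<delta> \<in> S" for f :: "'a \<Rightarrow> real" and \<delta>
  proof -
    have "(\<Sum>\<xi>\<in>S. f \<xi> * (if \<xi> = \<delta> then 1 else 0)) = (\<Sum>\<xi>\<in>S. if \<xi> = \<delta> then f \<xi> else 0)"
      by (intro sum.cong) auto
    then show ?thesis using fin that by simp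
  qed
  have "u \<zeta> = (\<Sum>\<xi>\<in>S. u \<xi> * mvec S Q (\<lambda>\<rho>. X \<rho> \<zeta>) \<xi>)"
  proof -
    have "(\<Sum>\<xi>\<in>S. u \<xi> * mvec S Q (\<lambda>\<rho>. X \<rho> \<zeta>) \<xi>) = (\<Sum>\<xi>\<in>S. u \<xi> * (if \<xi> = \<zeta> then 1 else 0))"
      using right_inverse_onD[OF inv _ \<zeta>] by (intro sum.cong refl) (simp add: mvec_def)
    then show ?thesis using sel[OF \<zeta>] by simp
  qed
  also have "\<dots> = (\<Sum>\<xi>\<in>S. X \<xi> \<zeta> * mvec S Q u \<xi>)" using sym by (intro mvec_swap)
  also have "\<dots> = (\<Sum>\<xi>\<in>S. (X \<xi> \<zeta> * mvec S Q u \<xi>) * (if \<xi> = \<beta> then 1 else 0))"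
    using u by (intro sum.cong) auto
  also have "\<dots> = X \<beta> \<zeta> * mvec S Q u \<beta>" by (rule sel[OF \<beta>])
  finally show ?thesis .
qed

text \<open>A kernel vector satisfies every saddle equation except that of \<open>Var j\<close>, so
  it is a multiple of row \<open>Var j\<close> of \<open>X\<close>. The replaced row demands a zero
  at \<open>Var i\<close>, where \<open>X\<close> is nonzero, so the multiple is 0.\<close>

lemma dep_det_nonzero:
  assumes cg: "chain_graph N U D" and K: "K \<subseteq> verts N"
    and ij: "i \<in> verts N - K" "j \<in> verts N - K" and conn: "(Var i, Var j) \<in> conn U D K"
  shows "\<exists>\<theta>\<in>PiE (nd_indices N U D) (\<lambda>_. UNIV). dep_det N U D i j K \<theta> \<noteq> 0"
proof -
  let ?V = "verts N" and ?L = "grounded_laplacian N U" and ?I = "nd_indices N U D"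
  let ?S = "nodes ?V K"
  obtain E X where E: "\<forall>v w. E v w \<noteq> 0 \<longrightarrow> (w, v) \<in> D"
    and inv: "right_inverse_on ?S (saddle ?L (\<lambda>v w. ?L v w + E v w)) X"
    and nz: "\<forall>\<xi>\<in>?S. \<forall>\<eta>\<in>?S. (\<xi>, \<eta>) \<in> conn U D K \<longrightarrow> X \<xi> \<eta> \<noteq> 0"
    using generic_saddle_inverse[OF cg K subset_refl] by (elim exE conjE)
  let ?Q = "saddle ?L (\<lambda>v w. ?L v w + E v w)"
  have U: "\<And>a b. (a, b) \<in> U \<Longrightarrow> (b, a) \<in> U" "U \<subseteq> ?V \<times> ?V" "\<And>v. (v, v) \<notin> U"
    using cg unfolding chain_graph_def sym_def by blast+
  have finS: "finite ?S" by (intro finite_nodes finite_verts)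
  have symQ: "?Q \<xi> \<eta> = ?Q \<eta> \<xi>" if "\<xi> \<in> ?S" "\<eta> \<in> ?S" for \<xi> \<eta>
    by (rule saddle_sym[OF _ that]) (rule pd_onD(2)[OF laplacian_pd[OF U]])
  \<comment> \<open>\<open>DEdge\<close> names the tail first, \<open>E\<close> the head
    first.\<close>
  define \<theta> where "\<theta> = restrict (\<lambda>k. case k of Mean v \<Rightarrow> 0 | Diag v \<Rightarrow> real N + 1 | UEdge a b \<Rightarrow> -1
      | DEdge a b \<Rightarrow> E b a) ?I"
  have sp: "sym_part U \<theta> v w = ?L v w" if "v \<in> ?V" for v w
  proof (cases "(v, w) \<in> U")
    case True
    then have "v \<noteq> w" using U(3) by blast
    then have "(min v w, max v w) \<in> U" "min v w < max v w" using True U(1) by (auto simp: min_def max_def)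
    then have "UEdge (min v w) (max v w) \<in> ?I" by (auto simp: nd_indices_def)
    then show ?thesis using True \<open>v \<noteq> w\<close> by (simp add: sym_part_def grounded_laplacian_def \<theta>_def)
  next
    case False
    then show ?thesis using that by (auto simp: sym_part_def grounded_laplacian_def \<theta>_def nd_indices_def)
  qed
  have ap: "arrow_part D \<theta> v w = E v w" for v w
    using E by (auto simp: arrow_part_def \<theta>_def nd_indices_def)
  have Q: "saddle (sym_part U \<theta>) (\<lambda>v w. sym_part U \<theta> v w + arrow_part D \<theta> v w) \<xi> \<eta> = ?Q \<xi> \<eta>"
    if "\<xi> \<in> ?S" "\<eta> \<in> ?S" for \<xi> \<eta>
  proof -
    have "vertex \<xi> \<in> ?V" "vertex \<eta> \<in> ?V" using that by (auto simp: nodes_def)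
    then show ?thesis by (cases \<xi>; cases \<eta>) (auto simp: sp ap)
  qed
  have vars: "Var i \<in> ?S" "Var j \<in> ?S" using ij by (auto simp: nodes_def)
  have "X (Var i) (Var j) = X (Var j) (Var i)"
    by (rule right_inverse_sym[OF finS symQ right_inverse_onD[OF inv] vars])
  then have Xji: "X (Var j) (Var i) \<noteq> 0" using nz vars conn by metis
  have "dep_det N U D i j K \<theta> \<noteq> 0"
  proof
    assume "dep_det N U D i j K \<theta> = 0"
    then obtain u \<zeta> where \<zeta>: "\<zeta> \<in> ?S" "u \<zeta> \<noteq> 0"
      and u: "\<And>\<xi>. \<xi> \<in> ?S \<Longrightarrow> (\<Sum>\<eta>\<in>?S. dep_matrix U D i j \<theta> \<xi> \<eta> * u \<eta>) = 0"
      unfolding dep_det_zero_iff by blast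
    have rows: "mvec ?S ?Q u \<xi> = 0" if "\<xi> \<in> ?S" "\<xi> \<noteq> Var j" for \<xi>
    proof -
      have "(\<Sum>\<eta>\<in>?S. dep_matrix U D i j \<theta> \<xi> \<eta> * u \<eta>) = mvec ?S ?Q u \<xi>"
        unfolding mvec_def using that by (intro sum.cong refl) (simp add: dep_matrix_def Q)
      then show ?thesis using u[OF that(1)] by simp
    qed
    have "(\<Sum>\<eta>\<in>?S. dep_matrix U D i j \<theta> (Var j) \<eta> * u \<eta>) = (\<Sum>\<eta>\<in>?S. if \<eta> = Var i then u \<eta> else 0)"
      by (intro sum.cong) (auto simp: dep_matrix_def)
    then have "u (Var i) = 0" using u[OF vars(2)] vars(1) finS by simp
    moreover have sol: "u \<zeta> = X (Var j) \<zeta> * mvec ?S ?Q u (Var j)" if "\<zeta> \<in> ?S" for \<zeta>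
      by (rule right_inverse_solve[OF finS symQ inv rows vars(2) that])
    ultimately have "mvec ?S ?Q u (Var j) = 0" using sol[OF vars(1)] Xji by simp
    then show False using sol[OF \<zeta>(1)] \<zeta>(2) by simp
  qed
  moreover have "\<theta> \<in> PiE ?I (\<lambda>_. UNIV)" by (simp add: \<theta>_def)
  ultimately show ?thesis by blast
qed

lemma cond_indep_imp_dep_det_zero:
  assumes cg: "chain_graph N U D" and ng: "in_NG N U D mu Sg"
    and sub: "I \<subseteq> verts N" "J \<subseteq> verts N" "K \<subseteq> verts N"
    and disj: "I \<inter> J = {}" "I \<inter> K = {}" "J \<inter> K = {}"
    and ci: "cond_indep mu Sg I J K" and ij: "i \<in> I" "j \<in> J"
  shows "dep_det N U D i j K (nd_params N U D mu Sg) = 0"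
proof -
  let ?V = "verts N" and ?\<theta> = "nd_params N U D mu Sg"
  let ?S = "nodes ?V K"
  let ?M = "comp_prec N U D Sg" and ?E = "arrow_prec N U D Sg"
  have pd: "pd_on (I \<union> J \<union> K) Sg" using pdV[OF cg ng] by (rule pd_on_subset) (use sub in auto)
  obtain g where g: "g j = 1" "\<And>v. g v \<noteq> 0 \<Longrightarrow> v = j \<or> v \<in> K" "\<And>k. k \<in> insert i K \<Longrightarrow> mvec (I \<union> J \<union> K) Sg g k = 0"
    using cond_indepD[OF pd disj ci ij] by blast
  let ?x = "mvec ?V Sg g"
  have x0: "?x k = 0" if "k \<in> insert i K" for k
  proof -
    have "?x k = mvec (I \<union> J \<union> K) Sg g k"
    proof (rule mvec_restrict)
      show "g l = 0" if "l \<in> ?V - (I \<union> J \<union> K)" for l using g(2)[of l] that ij by blast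
    qed (use finite_verts sub in auto)
    then show ?thesis using g(3)[OF that] by simp
  qed
  obtain y where y1: "\<And>v. v \<in> ?V \<Longrightarrow> mvec ?V ?M ?x v + mvec ?V ?E ?x v = mvec ?V ?M y v"
    and y2: "\<And>v. v \<in> ?V \<Longrightarrow> mvec ?V ?M y v + mvec ?V (\<lambda>v w. ?E w v) y v = g v"
    using precision_system[OF cg ng] by blast
  \<comment> \<open>Kernel vector. The \<open>Res\<close> rows read \<open>A x - M y = 0\<close>,
    the \<open>Var v\<close> rows give \<open>- g v\<close>, which is 0 for \<open>v\<close> outside
    \<open>K\<close> other than \<open>j\<close>, and the replaced row is
    \<open>x i = 0\<close>.\<close>
  define u where "u \<eta> = (case \<eta> of Res v \<Rightarrow> - y v | Var v \<Rightarrow> ?x v)" for \<eta>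
  have Q: "saddle (sym_part U ?\<theta>) (\<lambda>v w. sym_part U ?\<theta> v w + arrow_part D ?\<theta> v w) \<xi> \<eta> =
      saddle ?M (\<lambda>v w. ?M v w + ?E v w) \<xi> \<eta>"
    if "\<xi> \<in> ?S" "\<eta> \<in> ?S" for \<xi> \<eta>
  proof -
    have "vertex \<xi> \<in> ?V" "vertex \<eta> \<in> ?V" using that by (auto simp: nodes_def)
    then show ?thesis
      by (cases \<xi>; cases \<eta>) (auto simp: sym_part_nd_params[OF cg ng] arrow_part_nd_params[OF cg ng])
  qed
  have finS: "finite ?S" by (intro finite_nodes finite_verts)
  have "(\<Sum>\<eta>\<in>?S. dep_matrix U D i j ?\<theta> \<xi> \<eta> * u \<eta>) = 0" if \<xi>: "\<xi> \<in> ?S" for \<xi>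
  proof (cases "\<xi> = Var j")
    case True
    have "(\<Sum>\<eta>\<in>?S. dep_matrix U D i j ?\<theta> \<xi> \<eta> * u \<eta>) = (\<Sum>\<eta>\<in>?S. if \<eta> = Var i then u \<eta> else 0)"
      using True by (intro sum.cong) (auto simp: dep_matrix_def)
    also have "\<dots> = 0" using finS x0[of i] by (simp add: u_def)
    finally show ?thesis .
  next
    case False
    have "(\<Sum>\<eta>\<in>?S. dep_matrix U D i j ?\<theta> \<xi> \<eta> * u \<eta>) =
        (\<Sum>\<eta>\<in>?S. saddle ?M (\<lambda>v w. ?M v w + ?E v w) \<xi> \<eta> * u \<eta>)"
      using False \<xi> by (intro sum.cong refl) (simp add: dep_matrix_def Q)
    also have "\<dots> = 0"
    proof (cases \<xi>)
      case (Res v)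
      then have v: "v \<in> ?V" using \<xi> by (auto simp: nodes_def)
      have "(\<Sum>w\<in>?V - K. (?M v w + ?E v w) * ?x w) = (\<Sum>w\<in>?V. (?M v w + ?E v w) * ?x w)"
        using finite_verts x0 by (intro sum.mono_neutral_left) auto
      also have "\<dots> = mvec ?V ?M ?x v + mvec ?V ?E ?x v"
        unfolding mvec_def[of ?V ?M] mvec_def[of ?V ?E] by (simp only: distrib_right sum.distrib)
      also have "\<dots> = (\<Sum>w\<in>?V. ?M v w * y w)" unfolding y1[OF v] by (simp add: mvec_def)
      finally show ?thesis
        unfolding sum_nodes[OF finite_verts] Res by (simp add: u_def sum_negf)
    next
      case (Var v)
      then have v: "v \<in> ?V" "v \<notin> K" "v \<noteq> j" using \<xi> False by (auto simp: nodes_def)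
      have "(\<Sum>w\<in>?V. (?M w v + ?E w v) * y w) = (\<Sum>w\<in>?V. ?M v w * y w + ?E w v * y w)"
        using comp_prec_sym[OF cg ng v(1)] by (intro sum.cong refl) (simp add: distrib_right)
      also have "\<dots> = g v" using y2[OF v(1)] by (simp add: mvec_def sum.distrib)
      also have "\<dots> = 0" using g(2) v by blast
      finally show ?thesis
        unfolding sum_nodes[OF finite_verts] Var by (simp add: u_def sum_negf)
    qed
    finally show ?thesis .
  qed
  moreover have "\<exists>\<eta>\<in>?S. u \<eta> \<noteq> 0"
  proof (rule ccontr)
    assume n: "\<not> ?thesis"
    \<comment> \<open>If \<open>y\<close> vanished, the second equation would force
      \<open>g j = 0\<close>.\<close>
    have "y v = 0" if "v \<in> ?V" for v
      using bspec[OF n[simplified], of "Res v"] that by (simp add: u_def nodes_def)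
    then have "g j = 0" using y2[of j] sub ij by (auto simp: mvec_def)
    then show False using g(1) by simp
  qed
  ultimately show ?thesis unfolding dep_det_zero_iff by blast
qed

theorem theorem2:
  assumes "chain_graph N U D"
  shows "{nd_params N U D mu Sg | mu Sg.
            in_NG N U D mu Sg \<and> \<not> faithful N U D mu Sg}
         \<in> null_sets (nd_lebesgue N U D)"
proof -
  let ?V = "verts N" and ?I = "nd_indices N U D"
  let ?P = "PiM ?I (\<lambda>_. lborel :: real measure)"
  define T where "T = {(i, j, K). K \<subseteq> ?V \<and> i \<in> ?V - K \<and> j \<in> ?V - K \<and> (Var i, Var j) \<in> conn U D K}"
  define Z where "Z = (\<lambda>(i, j, K). {\<theta> \<in> space ?P. dep_det N U D i j K \<theta> = 0})"
  have "T \<subseteq> ?V \<times> ?V \<times> Pow ?V" by (auto simp: T_def)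
  then have "finite T" by (rule finite_subset) (simp add: finite_verts)
  have "Z t \<in> null_sets ?P" if "t \<in> T" for t
  proof -
    obtain i j K where t: "t = (i, j, K)" by (cases t) auto
    have c: "K \<subseteq> ?V" "i \<in> ?V - K" "j \<in> ?V - K" "(Var i, Var j) \<in> conn U D K"
      using that by (auto simp: T_def t)
    obtain \<theta> where "\<theta> \<in> PiE ?I (\<lambda>_. UNIV)" "dep_det N U D i j K \<theta> \<noteq> 0"
      using dep_det_nonzero[OF assms c] by blast
    from sep_poly_null_sets[OF finite_nd_indices[OF assms] sep_poly_dep_det[OF assms] this]
    show ?thesis unfolding Z_def t by simp
  qed
  then have null: "(\<Union>t\<in>T. Z t) \<in> null_sets ?P"
    using \<open>finite T\<close> by (intro null_sets_UN') (auto intro: countable_finite)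
  have "\<exists>t\<in>T. nd_params N U D mu Sg \<in> Z t"
    if ng: "in_NG N U D mu Sg" and nf: "\<not> faithful N U D mu Sg" for mu Sg
  proof -
    obtain I J K where sub: "I \<subseteq> ?V" "J \<subseteq> ?V" "K \<subseteq> ?V"
      and disj: "I \<inter> J = {}" "I \<inter> K = {}" "J \<inter> K = {}"
      and diff: "cond_indep mu Sg I J K \<noteq> separated U D I J K"
      using nf unfolding faithful_def by blast
    \<comment> \<open>By the Markov property unfaithfulness can only be an independence without
      separation, which a connected pair in \<open>T\<close> witnesses.\<close>
    have ci: "cond_indep mu Sg I J K" and nsep: "\<not> separated U D I J K"
      using diff separated_imp_cond_indep[OF assms ng sub disj] by blast+
    then obtain i j where ij: "i \<in> I" "j \<in> J" "(Var i, Var j) \<in> conn U D K"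
      unfolding separated_iff_conn[OF assms] by blast
    have "(i, j, K) \<in> T" using ij sub disj by (auto simp: T_def)
    moreover have "dep_det N U D i j K (nd_params N U D mu Sg) = 0"
      by (rule cond_indep_imp_dep_det_zero[OF assms ng sub disj ci ij(1,2)])
    ultimately show ?thesis by (intro bexI[of _ "(i, j, K)"]) (auto simp: Z_def space_PiM nd_params_def)
  qed
  then have "{nd_params N U D mu Sg | mu Sg. in_NG N U D mu Sg \<and> \<not> faithful N U D mu Sg} \<subseteq> (\<Union>t\<in>T. Z t)"
    by blast
  \<comment> \<open>In the completed measure a subset of a null set is null, so inclusion in the
    finite union suffices.\<close>
  then show ?thesis
    unfolding nd_lebesgue_def null_sets_completion_iff2 using null by blast
qed

end
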